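(* Let $K = \overline{\mathbb{F}}_5$ be the algebraic closure of the field of five elements and let $G = G_2(K)$ be the simple algebraic group of type $G_2$ over $K$. Let $t \in G$ be an involution; let $s_1, s_2 \in G$ be representatives of the two conjugacy classes of elements of order $4$ in $G$, labelled so that $C_G(s_1) = A_1T'$ and $C_G(s_2) = \tilde{A}_1T''$, where $A_1$ (resp. $\tilde{A}_1$) is an $SL_2(K)$ subgroup of $G$ generated by long (resp. short) root subgroups and $T'$, $T''$ are $1$-dimensional tori; and let $u = x_{\beta}(1)x_{3\alpha+\beta}(1)$, where $\alpha$ (resp. $\beta$) is the short (resp. long) simple root of $G$. Then: (i) The triples of conjugacy classes $\mathbf{C} = (t^G, s_1^G, u^G)$ and $\mathbf{D} = (t^G, s_2^G, u^G)$ are rigid in $G$. (ii) Every triple of elements in $\mathbf{C}_0$ or in $\mathbf{D}_0$ generates a subgroup of $G$ isomorphic to the symmetric group $\mathrm{Sym}_5$. (iii) For every integer $n \geq 1$, none of the finite groups $G_2(5^n)$, $SL_3(5^n)$, $SU_3(5^n)$ is a $(2,4,5)$-group.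
   Context: Rigidity: let $G$ be a connected simple algebraic group over an algebraically closed field and let $\mathbf{C} = (C_1,\ldots,C_s)$ be an $s$-tuple of conjugacy classes of $G$. Put $$\mathbf{C}_0 = \{(x_1,\ldots,x_s) \in C_1 \times \cdots \times C_s : x_1x_2\cdots x_s = 1\}.$$ The tuple $\mathbf{C}$ is called rigid in $G$ if $\mathbf{C}_0$ is non-empty and forms a single orbit under the action of $G$ by simultaneous conjugation. The set $\mathbf{D}_0$ is defined in the same way from $\mathbf{D}$. $(a,b,c)$-groups: a group is an $(a,b,c)$-group (is $(a,b,c)$-generated) if it is generated by elements $x, y, z$ of respective orders $a, b, c$ such that $xyz = 1$. Notation and known facts about $G = G_2(K)$, $K = \overline{\mathbb{F}}_5$: $g^G$ denotes the $G$-conjugacy class of $g$ and $C_G(g)$ its centraliser. For a root $\gamma$, $x_\gamma(c)$ ($c \in K$) denotes the elements of the corresponding root subgroup, with respect to a fixed maximal torus and choice of simple roots $\alpha$ (short) and $\beta$ (long). The group $G$ has a unique class of involutions; for a representative $t$, $C_G(t) = A_1\tilde{A}_1$ is a central product of two subgroups $SL_2(K)$, where $A_1$ (resp. $\tilde{A}_1$) is generated by long (resp. short) root subgroups of $G$. There are exactly two classes of elements of order $4$, distinguished by their centralisers as in the claim. The group $G$ has three classes of unipotent elements of order $5$: the long root elements, the short root elements, and the class labelled $G_2(a_1)$, of which $u = x_\beta(1)x_{3\alpha+\beta}(1)$ is a representative; $C_G(u) = U_4.\mathrm{Sym}_3$ with $U_4$ a connected unipotent group of dimension $4$. $G_2(5^n)$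 denotes the finite group of fixed points in $G$ of $\sigma^n$, where $\sigma$ is the Frobenius morphism of $G$ induced by the field map $x \mapsto x^5$ of $K$. *)

theory Defs
  imports
    "HOL-Analysis.Determinants"
    "HOL-Library.Numeral_Type"
    "HOL-Algebra.Sym_Groups"
    "HOL-Algebra.Group_Action"
    "HOL-Algebra.Multiplicative_Group"
    "HOL-Algebra.Algebraic_Closure_Type"
    "Berlekamp_Zassenhaus.Finite_Field"
begin

section \<open>Tuples of conjugacy classes in a group\<close>

definition conjugate :: "('g, 'm) monoid_scheme \<Rightarrow> 'g \<Rightarrow> 'g \<Rightarrow> 'g"
  where "conjugate G g x = g \<otimes>\<^bsub>G\<^esub> x \<otimes>\<^bsub>G\<^esub> inv\<^bsub>G\<^esub> g"

definition conj_class :: "('g, 'm) monoid_scheme \<Rightarrow> 'g \<Rightarrow> 'g set"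
  where "conj_class G x = orbit G (conjugate G) x"

definition centralizer :: "('g, 'm) monoid_scheme \<Rightarrow> 'g \<Rightarrow> 'g set"
  where "centralizer G x = {g \<in> carrier G. g \<otimes>\<^bsub>G\<^esub> x = x \<otimes>\<^bsub>G\<^esub> g}"

text \<open>An \<open>s\<close>-tuple is a list of length \<open>s\<close>; \<open>listset\<close> is the Cartesian product.\<close>

definition product_one_tuples :: "('g, 'm) monoid_scheme \<Rightarrow> 'g set list \<Rightarrow> 'g list set"
  where "product_one_tuples G Cs =
    {xs \<in> listset Cs. foldr (\<otimes>\<^bsub>G\<^esub>) xs \<one>\<^bsub>G\<^esub> = \<one>\<^bsub>G\<^esub>}"

definition rigid :: "('g, 'm) monoid_scheme \<Rightarrow> 'g set list \<Rightarrow> bool"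
  where "rigid G Cs \<longleftrightarrow>
    product_one_tuples G Cs \<noteq> {} \<and>
    (\<exists>xs \<in> product_one_tuples G Cs.
       product_one_tuples G Cs = orbit G (\<lambda>g. map (conjugate G g)) xs)"

definition abc_group :: "('g, 'm) monoid_scheme \<Rightarrow> nat \<Rightarrow> nat \<Rightarrow> nat \<Rightarrow> bool"
  where "abc_group G a b c \<longleftrightarrow>
    (\<exists>x \<in> carrier G. \<exists>y \<in> carrier G. \<exists>z \<in> carrier G.
       group.ord G x = a \<and> group.ord G y = b \<and> group.ord G z = c \<and>
       x \<otimes>\<^bsub>G\<^esub> y \<otimes>\<^bsub>G\<^esub> z = \<one>\<^bsub>G\<^esub> \<and> generate G {x, y, z} = carrier G)"


section \<open>Matrix groups and their algebraic isomorphisms\<close>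

definition GL :: "('k::field ^ 'n ^ 'n) monoid"
  where "GL = \<lparr>carrier = {A. invertible A}, mult = (**), one = mat 1\<rparr>"

definition SL :: "('k::field ^ 'n ^ 'n) set"
  where "SL = {A. det A = 1}"

inductive_set polynomial_maps :: "('k::field ^ 'n ^ 'm \<Rightarrow> 'k) set" where
  const: "(\<lambda>_. c) \<in> polynomial_maps"
| entry: "(\<lambda>A. A $ i $ j) \<in> polynomial_maps"
| add: "p \<in> polynomial_maps \<Longrightarrow> q \<in> polynomial_maps \<Longrightarrow> (\<lambda>A. p A + q A) \<in> polynomial_maps"
| mult: "p \<in> polynomial_maps \<Longrightarrow> q \<in> polynomial_maps \<Longrightarrow> (\<lambda>A. p A * q A) \<in> polynomial_maps"

definition polynomial_matrix_map ::
    "('k::field ^ 'n ^ 'n \<Rightarrow> 'k ^ 'm ^ 'm) \<Rightarrow> bool"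
  where "polynomial_matrix_map f \<longleftrightarrow> (\<forall>i j. (\<lambda>A. f A $ i $ j) \<in> polynomial_maps)"

text \<open>
  Isomorphism of linear algebraic groups \<open>H\<close> and \<open>H'\<close> lying in special linear groups. A closed
  subset of \<open>SL\<close> is closed in the affine space of all matrices, so the regular functions on it are
  exactly the restrictions of polynomials in the matrix entries (no inverse of the determinant is
  needed). If \<open>H\<close> is closed then so is \<open>H'\<close>.
\<close>

definition alg_group_isomorphic ::
    "('k::field ^ 'n ^ 'n) set \<Rightarrow> ('k ^ 'm ^ 'm) set \<Rightarrow> bool"
  where "alg_group_isomorphic H H' \<longleftrightarrow>
    (\<exists>f g. polynomial_matrix_map f \<and> polynomial_matrix_map g \<and>
       f ` H = H' \<and> (\<forall>A \<in> H. g (f A) = A) \<and>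
       (\<forall>A \<in> H. \<forall>B \<in> H. f (A ** B) = f A ** f B))"

text \<open>The multiplicative group, embedded in \<open>SL\<^sub>2\<close> as the matrices \<open>diag(c, 1/c)\<close>.\<close>

definition multiplicative_torus :: "('k::field ^ 2 ^ 2) set"
  where "multiplicative_torus =
    {A. A $ 1 $ 2 = 0 \<and> A $ 2 $ 1 = 0 \<and> A $ 1 $ 1 * A $ 2 $ 2 = 1}"

definition one_dim_torus :: "('k::field ^ 'n ^ 'n) set \<Rightarrow> bool"
  where "one_dim_torus T \<longleftrightarrow> alg_group_isomorphic (multiplicative_torus :: ('k ^ 2 ^ 2) set) T"


section \<open>The algebraic closure of the field with five elements\<close>

typedef five = "{..<5::nat}"
  by (rule exI[of _ 0]) simp

lemma card_five: "CARD(five) = 5"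
  using type_definition.card[OF type_definition_five] by simp

instance five :: prime_card
  by standard (simp add: card_five)

type_synonym F5 = "five mod_ring"
type_synonym K = "F5 alg_closure"


section \<open>The group \<open>G\<^sub>2(K)\<close>\<close>

text \<open>
  \<open>G\<^sub>2(K)\<close> is the Chevalley group of type \<open>G\<^sub>2\<close> over \<open>K\<close>, that is, the group generated by the root
  elements \<open>x\<^sub>\<gamma>(c) = exp(c e\<^sub>\<gamma>)\<close>, in the seven-dimensional representation of highest weight
  \<open>2\<alpha> + \<beta>\<close>. (As the weight and root lattices of \<open>G\<^sub>2\<close> coincide, all faithful representations give
  the same group.) The coordinates \<open>1,\<dots>,7\<close> belong to the weights \<open>2\<alpha>+\<beta>, \<alpha>+\<beta>, \<alpha>, 0, -\<alpha>, -\<alpha>-\<beta>,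
  -2\<alpha>-\<beta>\<close>. A root \<open>i \<alpha> + j \<beta>\<close> is represented by the pair \<open>(i, j)\<close>.
\<close>

definition matrix_unit :: "7 \<Rightarrow> 7 \<Rightarrow> K ^ 7 ^ 7"
  where "matrix_unit i j = (\<chi> a b. if a = i \<and> b = j then 1 else 0)"

definition bracket :: "K ^ 7 ^ 7 \<Rightarrow> K ^ 7 ^ 7 \<Rightarrow> K ^ 7 ^ 7"
  where "bracket A B = A ** B - B ** A"

definition e_alpha :: "K ^ 7 ^ 7"
  where "e_alpha = matrix_unit 1 2 + mat 2 ** matrix_unit 3 4 + matrix_unit 4 5 + matrix_unit 6 7"

definition e_beta :: "K ^ 7 ^ 7"
  where "e_beta = matrix_unit 2 3 + matrix_unit 5 6"

definition f_alpha :: "K ^ 7 ^ 7"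
  where "f_alpha = matrix_unit 2 1 + matrix_unit 4 3 + mat 2 ** matrix_unit 5 4 + matrix_unit 7 6"

definition f_beta :: "K ^ 7 ^ 7"
  where "f_beta = matrix_unit 3 2 + matrix_unit 6 5"

definition pos_long_roots :: "(int \<times> int) set"
  where "pos_long_roots = {(0, 1), (3, 1), (3, 2)}"

definition pos_short_roots :: "(int \<times> int) set"
  where "pos_short_roots = {(1, 0), (1, 1), (2, 1)}"

definition long_roots :: "(int \<times> int) set"
  where "long_roots = pos_long_roots \<union> uminus ` pos_long_roots"

definition short_roots :: "(int \<times> int) set"
  where "short_roots = pos_short_roots \<union> uminus ` pos_short_roots"

definition roots :: "(int \<times> int) set"
  where "roots = long_roots \<union> short_roots"

text \<open>
  In a Chevalley basis \<open>[e\<^sub>\<gamma>, e\<^sub>\<delta>] = \<plusminus>(p + 1) e\<^bsub>\<gamma>+\<delta>\<^esub>\<close> with \<open>p\<close> maximal such that \<open>\<delta> - p \<gamma>\<close> is a root.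
  This gives the multiples below, starting from the vectors \<open>x\<close>, \<open>y\<close> for the two simple roots (or
  for their negatives); the remaining sign ambiguity does not affect the root subgroups.
\<close>

definition chevalley_vector :: "K ^ 7 ^ 7 \<Rightarrow> K ^ 7 ^ 7 \<Rightarrow> int \<times> int \<Rightarrow> K ^ 7 ^ 7"
  where "chevalley_vector x y \<gamma> =
    (if \<gamma> = (1, 0) then x
     else if \<gamma> = (0, 1) then y
     else if \<gamma> = (1, 1) then bracket x y
     else if \<gamma> = (2, 1) then mat (1 / 2) ** bracket x (bracket x y)
     else if \<gamma> = (3, 1) then mat (1 / 6) ** bracket x (bracket x (bracket x y))
     else if \<gamma> = (3, 2) then mat (1 / 6) ** bracket y (bracket x (bracket x (bracket x y)))
     else 0)"

definition root_vector :: "int \<times> int \<Rightarrow> K ^ 7 ^ 7"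
  where "root_vector \<gamma> =
    (if \<gamma> \<in> pos_long_roots \<union> pos_short_roots
     then chevalley_vector e_alpha e_beta \<gamma>
     else chevalley_vector f_alpha f_beta (- \<gamma>))"

text \<open>The cube of every \<open>e\<^sub>\<gamma>\<close> vanishes (\<open>root_vector_cube\<close> below), so this is the exponential of \<open>c e\<^sub>\<gamma>\<close>.\<close>

definition root_element :: "int \<times> int \<Rightarrow> K \<Rightarrow> K ^ 7 ^ 7"
  where "root_element \<gamma> c =
    mat 1 + mat c ** root_vector \<gamma> + mat (c\<^sup>2 / 2) ** (root_vector \<gamma> ** root_vector \<gamma>)"

definition G2 :: "(K ^ 7 ^ 7) monoid"
  where "G2 = GL\<lparr>carrier := generate GL (\<Union>\<gamma> \<in> roots. range (root_element \<gamma>))\<rparr>"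

lemma matrix_unit_mult:
  "matrix_unit i j ** matrix_unit k l = (if j = k then matrix_unit i l else 0)"
  by (auto simp: matrix_unit_def matrix_matrix_mult_def vec_eq_iff if_distrib[of "\<lambda>x. x * _"]
      if_distrib[of "\<lambda>x. _ * x"] sum.delta' cong: if_cong)

lemma mat_mult_eq: "mat c ** (A :: K ^ 7 ^ 7) = (\<chi> i j. c * A $ i $ j)"
  by (simp add: vec_eq_iff mat_def matrix_matrix_mult_def if_distrib[of "\<lambda>x. x * _"] cong: if_cong)

lemma matrix_calculus:
  fixes A B C :: "K ^ 7 ^ 7"
  shows "(mat c ** A) ** B = mat c ** (A ** B)" "A ** (mat c ** B) = mat c ** (A ** B)"
    "mat c ** (mat d ** A) = mat (c * d) ** A"
    "A ** (- B) = - (A ** B)" "(- A) ** B = - (A ** B)"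
    "A ** (B + C) = A ** B + A ** C" "(A + B) ** C = A ** C + B ** C"
    "A ** (B - C) = A ** B - A ** C" "(A - B) ** C = A ** C - B ** C"
    "0 ** A = 0" "A ** 0 = 0"
proof -
  have "(\<chi> i j. c * A $ i $ j) ** B = (\<chi> i j. c * (A ** B) $ i $ j)"
       "A ** (\<chi> i j. c * B $ i $ j) = (\<chi> i j. c * (A ** B) $ i $ j)"
    by (simp_all add: matrix_matrix_mult_def vec_eq_iff sum_distrib_left mult_ac)
  then show "(mat c ** A) ** B = mat c ** (A ** B)" "A ** (mat c ** B) = mat c ** (A ** B)"
    by (simp_all only: mat_mult_eq)
  show "mat c ** (mat d ** A) = mat (c * d) ** A"
    unfolding mat_mult_eq by (simp add: vec_eq_iff mult_ac)
qed (simp_all add: matrix_matrix_mult_def vec_eq_iff sum_negf algebra_simps sum.distrib sum_subtractf)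

lemma matrix_unit_scalar:
  "matrix_unit i j ** (mat c ** (B :: K ^ 7 ^ 7)) = mat c ** (matrix_unit i j ** B)"
  by (rule matrix_calculus(2))

lemmas matrix_unit_calculus = matrix_unit_mult matrix_unit_scalar matrix_calculus(1,3-)

lemma five_eq_0_K: "(5 :: K) = 0"
proof -
  have "(of_nat 5 :: F5) = 0" using of_nat_CHAR[where 'a=F5] by (simp add: card_five)
  then have "to_ac (of_nat 5 :: F5) = 0" by simp
  then show ?thesis by simp
qed

lemma two_neq_0_K: "(2 :: K) \<noteq> 0"
proof
  assume "(2 :: K) = 0"
  then have "(5 :: K) - 2 * 2 = 0" using five_eq_0_K by simp
  then show False by simp
qed

text \<open>The representation has Cartan matrix entries \<open>\<langle>\<beta>, \<alpha>\<^sup>\<or>\<rangle> = -3\<close> and \<open>\<langle>\<alpha>, \<beta>\<^sup>\<or>\<rangle> = -1\<close>.\<close>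

lemma chevalley_relations:
  defines "h_alpha \<equiv> bracket e_alpha f_alpha" and "h_beta \<equiv> bracket e_beta f_beta"
  shows "bracket e_alpha f_beta = 0" "bracket e_beta f_alpha = 0" "bracket h_alpha h_beta = 0"
    "bracket h_alpha e_alpha = mat 2 ** e_alpha" "bracket h_alpha e_beta = mat (-3) ** e_beta"
    "bracket h_beta e_alpha = mat (-1) ** e_alpha" "bracket h_beta e_beta = mat 2 ** e_beta"
    "bracket h_alpha f_alpha = mat (-2) ** f_alpha" "bracket h_alpha f_beta = mat 3 ** f_beta"
    "bracket h_beta f_alpha = mat 1 ** f_alpha" "bracket h_beta f_beta = mat (-2) ** f_beta"
  unfolding h_alpha_def h_beta_def bracket_def e_alpha_def e_beta_def f_alpha_def f_beta_def
  by (simp_all add: matrix_unit_calculus)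
     (simp_all add: mat_mult_eq vec_eq_iff algebra_simps)

lemma bracket_table:
  "bracket e_alpha e_beta =
      matrix_unit 1 3 + matrix_unit 4 6 - matrix_unit 5 7 - mat 2 ** matrix_unit 2 4"
  "bracket e_alpha (matrix_unit 1 3 + matrix_unit 4 6 - matrix_unit 5 7 - mat 2 ** matrix_unit 2 4) =
      mat 2 ** matrix_unit 2 5 + mat 2 ** matrix_unit 3 6 - mat 2 ** matrix_unit 4 7 - mat 4 ** matrix_unit 1 4"
  "bracket e_alpha (mat 2 ** matrix_unit 2 5 + mat 2 ** matrix_unit 3 6 - mat 2 ** matrix_unit 4 7 - mat 4 ** matrix_unit 1 4) =
      mat 6 ** matrix_unit 1 5 - mat 6 ** matrix_unit 3 7"
  "bracket e_beta (mat 6 ** matrix_unit 1 5 - mat 6 ** matrix_unit 3 7) =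
      - mat 6 ** matrix_unit 1 6 - mat 6 ** matrix_unit 2 7"
  "bracket f_alpha f_beta =
      matrix_unit 4 2 + matrix_unit 7 5 - matrix_unit 3 1 - mat 2 ** matrix_unit 6 4"
  "bracket f_alpha (matrix_unit 4 2 + matrix_unit 7 5 - matrix_unit 3 1 - mat 2 ** matrix_unit 6 4) =
      mat 2 ** matrix_unit 5 2 + mat 2 ** matrix_unit 6 3 - mat 2 ** matrix_unit 4 1 - mat 4 ** matrix_unit 7 4"
  "bracket f_alpha (mat 2 ** matrix_unit 5 2 + mat 2 ** matrix_unit 6 3 - mat 2 ** matrix_unit 4 1 - mat 4 ** matrix_unit 7 4) =
      mat 6 ** matrix_unit 7 3 - mat 6 ** matrix_unit 5 1"
  "bracket f_beta (mat 6 ** matrix_unit 7 3 - mat 6 ** matrix_unit 5 1) =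
      - mat 6 ** matrix_unit 6 1 - mat 6 ** matrix_unit 7 2"
  unfolding bracket_def e_alpha_def e_beta_def f_alpha_def f_beta_def
  by (simp_all add: matrix_unit_calculus)
     (simp_all add: mat_mult_eq vec_eq_iff algebra_simps)

lemma root_vector_cube:
  assumes "\<gamma> \<in> roots"
  shows "root_vector \<gamma> ** (root_vector \<gamma> ** root_vector \<gamma>) = 0"
proof -
  have "\<gamma> \<in> {(1, 0), (0, 1), (1, 1), (2, 1), (3, 1), (3, 2)} \<or>
      - \<gamma> \<in> {(1, 0), (0, 1), (1, 1), (2, 1), (3, 1), (3, 2)} \<and>
      \<gamma> \<notin> pos_long_roots \<union> pos_short_roots"
    using assms unfolding roots_def long_roots_def short_roots_def pos_long_roots_def pos_short_roots_def
    by auto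
  then show ?thesis
    by (elim disjE conjE insertE emptyE)
       (simp_all add: root_vector_def chevalley_vector_def pos_long_roots_def pos_short_roots_def
          bracket_table,
        simp_all add: e_alpha_def e_beta_def f_alpha_def f_beta_def matrix_unit_calculus)
qed

lemma root_element_add:
  assumes "\<gamma> \<in> roots"
  shows "root_element \<gamma> c ** root_element \<gamma> d = root_element \<gamma> (c + d)"
proof -
  define E where "E = root_vector \<gamma>"
  have E3: "E ** (E ** E) = 0"
    using root_vector_cube[OF assms] by (simp add: E_def)
  have E_scalar: "E ** (mat a ** B) = mat a ** (E ** B)" for a and B :: "K ^ 7 ^ 7"
    by (rule matrix_calculus(2))
  have "root_element \<gamma> c ** root_element \<gamma> d =
      mat 1 + mat c ** E + mat d ** E +
      (mat (c\<^sup>2 / 2) ** (E ** E) + mat (d\<^sup>2 / 2) ** (E ** E) + mat (c * d) ** (E ** E))"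
    unfolding root_element_def E_def[symmetric]
    by (simp add: matrix_calculus(1,3-) matrix_mul_assoc[symmetric, of E] E_scalar E3)
  also have "\<dots> = root_element \<gamma> (c + d)"
  proof -
    have "(c + d)\<^sup>2 / 2 = c\<^sup>2 / 2 + d\<^sup>2 / 2 + (2 * (c * d)) / 2"
      by (simp add: power2_sum add_divide_distrib mult.assoc)
    also have "(2 * (c * d)) / 2 = c * d"
      by (rule nonzero_mult_div_cancel_left[OF two_neq_0_K])
    finally have "(c + d)\<^sup>2 / 2 = c\<^sup>2 / 2 + d\<^sup>2 / 2 + c * d" .
    then show ?thesis
      unfolding root_element_def E_def[symmetric]
      by (simp only: mat_mult_eq vec_eq_iff vec_lambda_beta vector_add_component distrib_right
          add.assoc simp_thms)
  qed
  finally show ?thesis .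
qed

lemma group_GL: "group (GL :: ('k::field ^ 'n ^ 'n) monoid)"
proof (rule groupI)
  fix A :: "'k ^ 'n ^ 'n" assume "A \<in> carrier GL"
  then obtain B where "A ** B = mat 1" "B ** A = mat 1" by (auto simp: GL_def invertible_def)
  then show "\<exists>B \<in> carrier GL. B \<otimes>\<^bsub>GL\<^esub> A = \<one>\<^bsub>GL\<^esub>" by (auto simp: GL_def invertible_def)
next
  have "invertible (mat 1 :: 'k ^ 'n ^ 'n)"
    unfolding invertible_def by (rule exI[of _ "mat 1"]) simp
  then show "\<one>\<^bsub>GL\<^esub> \<in> carrier (GL :: ('k ^ 'n ^ 'n) monoid)" by (simp add: GL_def)
qed (auto simp: GL_def invertible_mult matrix_mul_assoc)

lemma group_G2: "group G2"
proof -
  have "root_element \<gamma> c \<in> carrier GL" if "\<gamma> \<in> roots" for \<gamma> c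
  proof -
    have "root_element \<gamma> 0 = mat 1" by (simp add: root_element_def mat_mult_eq vec_eq_iff)
    then show ?thesis
      using root_element_add[OF that, of c "- c"] root_element_add[OF that, of "- c" c]
      by (auto simp: GL_def invertible_def)
  qed
  then have "subgroup (generate GL (\<Union>\<gamma> \<in> roots. range (root_element \<gamma>))) GL"
    by (intro group.generate_is_subgroup[OF group_GL]) auto
  then show ?thesis
    unfolding G2_def by (rule group.subgroup_imp_group[OF group_GL])
qed

text \<open>Root subgroups with respect to arbitrary maximal tori.\<close>

definition long_root_subgroups :: "(K ^ 7 ^ 7) set set"
  where "long_root_subgroups =
    {conjugate G2 g ` range (root_element \<gamma>) | g \<gamma>. g \<in> carrier G2 \<and> \<gamma> \<in> long_roots}"

definition short_root_subgroups :: "(K ^ 7 ^ 7) set set"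
  where "short_root_subgroups =
    {conjugate G2 g ` range (root_element \<gamma>) | g \<gamma>. g \<in> carrier G2 \<and> \<gamma> \<in> short_roots}"

definition SL2_generated_by :: "(K ^ 7 ^ 7) set set \<Rightarrow> (K ^ 7 ^ 7) set \<Rightarrow> bool"
  where "SL2_generated_by \<X> A \<longleftrightarrow>
    alg_group_isomorphic (SL :: (K ^ 2 ^ 2) set) A \<and>
    (\<exists>\<S> \<subseteq> \<X>. A = generate G2 (\<Union>\<S>))"


section \<open>The finite groups\<close>

definition frobenius :: "K ^ 'n ^ 'n \<Rightarrow> K ^ 'n ^ 'n"
  where "frobenius A = (\<chi> i j. (A $ i $ j) ^ 5)"

definition G2_fin :: "nat \<Rightarrow> (K ^ 7 ^ 7) monoid"
  where "G2_fin n = G2\<lparr>carrier := {g \<in> carrier G2. (frobenius ^^ n) g = g}\<rparr>"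

text \<open>The subfield of \<open>K\<close> with \<open>q\<close> elements, for \<open>q\<close> a power of \<open>5\<close>.\<close>

definition subfield_of_order :: "nat \<Rightarrow> K set"
  where "subfield_of_order q = {x. x ^ q = x}"

definition SL3_fin :: "nat \<Rightarrow> (K ^ 3 ^ 3) monoid"
  where "SL3_fin q = GL\<lparr>carrier := {A \<in> SL. \<forall>i j. A $ i $ j \<in> subfield_of_order q}\<rparr>"

text \<open>
  \<open>SU\<^sub>3(q)\<close> is the special unitary group of the standard Hermitian form over the field with \<open>q\<^sup>2\<close>
  elements, with respect to the involution \<open>x \<mapsto> x\<^sup>q\<close>.
\<close>

definition SU3_fin :: "nat \<Rightarrow> (K ^ 3 ^ 3) monoid"
  where "SU3_fin q = GL\<lparr>carrier :=
    {A \<in> SL. (\<forall>i j. A $ i $ j \<in> subfield_of_order (q\<^sup>2)) \<and>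
       transpose (\<chi> i j. (A $ i $ j) ^ q) ** A = mat 1}\<rparr>"

end

theory Submission
  imports Defs
begin

text \<open>
  Everything takes place in the seven-dimensional module \<open>V = K\<^sup>7\<close>, which carries a symmetric bilinear
  form and an octonion cross product \<open>\<star>\<close>. The root elements are exponentials of derivations of \<open>\<star>\<close>,
  and conversely every automorphism of \<open>\<star>\<close> can be reduced to the identity by root elements; so
  \<open>G\<^sub>2(K)\<close> is the whole automorphism group (\<open>carrier_G2\<close>). Such automorphisms can be prescribed freely
  on orthonormal triples of octonions (\<open>basic_triple_transitive\<close>). This gives transitivity on
  vectors of equal nonzero norm, a single class of involutions, and exactly two classes of elements of
  order four: in one of them \<open>-1\<close> is an eigenvalue, in the other (the predicate
  \<open>fixes_square_fixed\<close>) it is not.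

  Let \<open>t\<close>, \<open>s\<close>, \<open>u\<close> have orders 2, 4, 5 and product one, and put \<open>z = t s\<close>. In characteristic 5 the
  element \<open>z\<close> is unipotent with at least two Jordan blocks on \<open>V\<close>, while \<open>t\<close> and \<open>s\<close> have known
  eigenspaces. Scott's dimension count (\<open>common_fixed_vector\<close>), applied to \<open>t\<close>, \<open>s\<close> or to \<open>-t\<close>, \<open>-s\<close>
  according to the class of \<open>s\<close>, yields a common eigenvector of \<open>t\<close> and \<open>s\<close> with eigenvalue \<open>1\<close> or
  \<open>-1\<close>. The groups \<open>G\<^sub>2(5\<^sup>n)\<close> preserve no line of \<open>V\<close>, so they are not \<open>(2,4,5)\<close>-groups.

  The common eigenvector is nonsingular (\<open>common_eigenvector_nonsingular\<close>), because traces on a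
  two-dimensional section would otherwise contradict that \<open>z\<close> is unipotent. It may therefore be taken to be
  \<open>e\<^sub>4\<close>, and \<open>V\<close> decomposes under the stabiliser of the line of \<open>e\<^sub>4\<close> into this line and two dual
  three-dimensional spaces; the elements that fix \<open>e\<^sub>4\<close> form \<open>SL\<^sub>3(K)\<close>, the others interchange the two
  spaces. In both cases there is a basis of one of the spaces in which \<open>t\<close> and \<open>z\<close> are given by explicit
  formulas (\<open>fixing_triple_basis\<close>, \<open>moving_triple_basis\<close>), so all pairs \<open>(t, s)\<close> with \<open>s\<close> in a given
  class are conjugate (\<open>triples_conjugate\<close>). That is the uniqueness half of rigidity.

  The existence half comes from \<open>Sym\<^sub>5\<close>. In characteristic 5 the vectors of coordinate sum zero in
  \<open>K\<^sup>5\<close> modulo the constants form a three-dimensional module, and twisting it by the sign character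
  embeds \<open>Sym\<^sub>5\<close> in \<open>SL\<^sub>3(K)\<close>. An involution of \<open>G\<^sub>2(K)\<close> centralises the image and negates \<open>e\<^sub>4\<close>;
  multiplying the odd permutations by it gives a second embedding, and the two embeddings meet the two
  classes of elements of order four. As all triples of one kind are conjugate and the reference triple
  generates \<open>Sym\<^sub>5\<close>, so does every triple. In the reference triple the 5-cycle acts with a single
  Jordan block on the three-dimensional space, and so does \<open>x\<^sub>\<beta>(1) x\<^bsub>3\<alpha>+\<beta>\<^esub>(1)\<close>; this makes
  them conjugate (\<open>cyclic_unipotents_conjugate\<close>).

  Finally \<open>SL\<^sub>3(q)\<close> and \<open>SU\<^sub>3(q)\<close> lie in the stabiliser of \<open>e\<^sub>4\<close>. If one of them were a
  \<open>(2,4,5)\<close>-group, then either its generators would be conjugate to those of \<open>Sym\<^sub>5\<close> and it would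
  preserve a nonzero bilinear form on \<open>K\<^sup>3\<close>, or the common eigenvector with eigenvalue \<open>-1\<close> would give
  an invariant line in \<open>K\<^sup>3\<close> or its dual. A diagonal matrix \<open>diag(\<zeta>, 1, 1/\<zeta>)\<close> with \<open>\<zeta>\<^sup>2 \<noteq> 1\<close>
  and a cyclic permutation matrix exclude both.
\<close>

(* The symbol $ is reserved for the components of vectors. *)
no_notation fps_nth (infixl \<open>$\<close> 75)

section \<open>The octonion cross product\<close>

lemma UNIV_7: "(UNIV :: 7 set) = {1, 2, 3, 4, 5, 6, 7}"
proof -
  have "card {1, 2, 3, 4, 5, 6, 7 :: 7} = CARD(7)" by simp
  then show ?thesis by (intro card_eq_UNIV_imp_eq_UNIV[symmetric]) auto
qed

lemma forall_7: "(\<forall>i :: 7. P i) \<longleftrightarrow> P 1 \<and> P 2 \<and> P 3 \<and> P 4 \<and> P 5 \<and> P 6 \<and> P 7"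
proof -
  have "(\<forall>i. P i) \<longleftrightarrow> (\<forall>i \<in> UNIV. P i)" by simp
  then show ?thesis unfolding UNIV_7 by auto
qed

lemma sum_7: "(\<Sum>i \<in> (UNIV :: 7 set). f i) = f 1 + f 2 + f 3 + f 4 + f 5 + f 6 + f 7"
  unfolding UNIV_7 by (simp add: add.assoc)

definition vec7 :: "'a \<Rightarrow> 'a \<Rightarrow> 'a \<Rightarrow> 'a \<Rightarrow> 'a \<Rightarrow> 'a \<Rightarrow> 'a \<Rightarrow> 'a ^ 7"
  where "vec7 a b c d e f g = (\<chi> i. if i = 1 then a else if i = 2 then b else if i = 3 then c
    else if i = 4 then d else if i = 5 then e else if i = 6 then f else g)"

lemma vec7_nth [simp]:
  "vec7 a b c d e f g $ 1 = a" "vec7 a b c d e f g $ 2 = b" "vec7 a b c d e f g $ 3 = c"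
  "vec7 a b c d e f g $ 4 = d" "vec7 a b c d e f g $ 5 = e" "vec7 a b c d e f g $ 6 = f"
  "vec7 a b c d e f g $ 7 = g"
  by (simp_all add: vec7_def)

lemma vec7_eqI:
  fixes x y :: "'a ^ 7"
  assumes "x $ 1 = y $ 1" "x $ 2 = y $ 2" "x $ 3 = y $ 3" "x $ 4 = y $ 4" "x $ 5 = y $ 5"
    "x $ 6 = y $ 6" "x $ 7 = y $ 7"
  shows "x = y"
  using assms by (simp add: vec_eq_iff forall_7)

text \<open>
  The product of imaginary octonions in the weight basis of the module, normalised so that the weights
  \<open>e\<^sub>1, \<dots>, e\<^sub>7\<close> have integral structure constants. With this scaling \<open>x \<star> (x \<star> y)\<close> is
  \<open>form x y *s x - form x x *s y\<close>, so that unit vectors behave like the imaginary units.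
\<close>

definition cross :: "K ^ 7 \<Rightarrow> K ^ 7 \<Rightarrow> K ^ 7" (infixl \<open>\<star>\<close> 75)
  where "x \<star> y = vec7
    (2 * (x$2 * y$3 - x$3 * y$2 - x$1 * y$4 + x$4 * y$1))
    (2 * (x$2 * y$4 - x$4 * y$2 - x$1 * y$5 + x$5 * y$1))
    (2 * (x$3 * y$4 - x$4 * y$3 - x$1 * y$6 + x$6 * y$1))
    (x$7 * y$1 - x$1 * y$7 + x$6 * y$2 - x$2 * y$6 + x$3 * y$5 - x$5 * y$3)
    (2 * (x$4 * y$5 - x$5 * y$4 - x$2 * y$7 + x$7 * y$2))
    (2 * (x$4 * y$6 - x$6 * y$4 - x$3 * y$7 + x$7 * y$3))
    (2 * (x$5 * y$6 - x$6 * y$5 - x$4 * y$7 + x$7 * y$4))"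

definition form :: "K ^ 7 \<Rightarrow> K ^ 7 \<Rightarrow> K"
  where "form x y = 2 * (x$1 * y$7 + x$7 * y$1 - x$2 * y$6 - x$6 * y$2 + x$3 * y$5 + x$5 * y$3
    - 2 * (x$4 * y$4))"

lemma form_sym: "form x y = form y x"
  by (simp add: form_def algebra_simps)

lemma form_simps [simp]:
  "form (x + y) z = form x z + form y z" "form z (x + y) = form z x + form z y"
  "form (x - y) z = form x z - form y z" "form z (x - y) = form z x - form z y"
  "form (- x) z = - form x z" "form z (- x) = - form z x"
  "form (c *s x) z = c * form x z" "form z (c *s x) = c * form z x"
  "form 0 z = 0" "form z 0 = 0"
  by (simp_all add: form_def algebra_simps)

lemma cross_simps [simp]:
  "(x + y) \<star> z = x \<star> z + y \<star> z" "z \<star> (x + y) = z \<star> x + z \<star> y"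
  "(x - y) \<star> z = x \<star> z - y \<star> z" "z \<star> (x - y) = z \<star> x - z \<star> y"
  "(- x) \<star> z = - (x \<star> z)" "z \<star> (- x) = - (z \<star> x)"
  "(c *s x) \<star> z = c *s (x \<star> z)" "z \<star> (c *s x) = c *s (z \<star> x)"
  "0 \<star> z = 0" "z \<star> 0 = 0" "x \<star> x = 0"
  by (auto intro!: vec7_eqI simp: cross_def algebra_simps)

lemma cross_anticomm: "x \<star> y = - (y \<star> x)"
  by (auto intro!: vec7_eqI simp: cross_def algebra_simps)

lemma cross_cross_same: "x \<star> (x \<star> y) = form x y *s x - form x x *s y"
  by (rule vec7_eqI; simp add: cross_def form_def algebra_simps)

lemma form_cross: "form (x \<star> y) z = form x (y \<star> z)"
  by (simp add: cross_def form_def algebra_simps)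

lemma form_cross_self [simp]: "form (x \<star> y) x = 0" "form (x \<star> y) y = 0"
  "form x (x \<star> y) = 0" "form y (x \<star> y) = 0"
  by (simp_all add: cross_def form_def algebra_simps)

text \<open>
  Polarisation of \<open>cross_cross_same\<close> in its repeated argument.
\<close>

lemma cross_cross_linear:
  "x \<star> (y \<star> z) = - (y \<star> (x \<star> z)) + form x z *s y + form y z *s x - (2 * form x y) *s z"
proof -
  have "(x + y) \<star> ((x + y) \<star> z) = form (x + y) z *s (x + y) - form (x + y) (x + y) *s z"
    by (rule cross_cross_same)
  then show ?thesis
    by (simp add: cross_cross_same form_sym[of y x] vec_eq_iff algebra_simps)
qed

lemma form_cross_cross: "form (x \<star> y) (x \<star> z) = form x x * form y z - form x y * form x z"
proof -
  have "form (x \<star> y) (x \<star> z) = - form (y \<star> x) (x \<star> z)" by (simp add: cross_anticomm[of x y])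
  also have "\<dots> = - form y (x \<star> (x \<star> z))" by (simp add: form_cross)
  finally show ?thesis by (simp add: cross_cross_same form_sym[of y x] mult.commute)
qed

text \<open>
  Numerals that occur in the computations below, reduced modulo 5 to representatives of small absolute value.
\<close>

lemma char_5: "(5 :: K) = 0" "(6 :: K) = 1" "(7 :: K) = 2" "(8 :: K) = -2" "(9 :: K) = -1"
  "(10 :: K) = 0" "(12 :: K) = 2" "(3 :: K) = -2" "(4 :: K) = -1" "(16 :: K) = 1" "(24 :: K) = -1"
  "(36 :: K) = 1" "(20 :: K) = 0" "(18 :: K) = -2" "(32 :: K) = 2"
proof -
  show 5: "(5 :: K) = 0" by (rule five_eq_0_K)
  have shift: "(x :: K) = y" if "x - y = 5 * z" for x y z using that 5 by simp
  show "(6 :: K) = 1" by (rule shift[of _ _ 1]) simp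
  show "(7 :: K) = 2" by (rule shift[of _ _ 1]) simp
  show "(8 :: K) = -2" by (rule shift[of _ _ 2]) simp
  show "(9 :: K) = -1" by (rule shift[of _ _ 2]) simp
  show "(10 :: K) = 0" by (rule shift[of _ _ 2]) simp
  show "(12 :: K) = 2" by (rule shift[of _ _ 2]) simp
  show "(3 :: K) = -2" by (rule shift[of _ _ 1]) simp
  show "(4 :: K) = -1" by (rule shift[of _ _ 1]) simp
  show "(16 :: K) = 1" by (rule shift[of _ _ 3]) simp
  show "(24 :: K) = -1" by (rule shift[of _ _ 5]) simp
  show "(36 :: K) = 1" by (rule shift[of _ _ 7]) simp
  show "(20 :: K) = 0" by (rule shift[of _ _ 4]) simp
  show "(18 :: K) = -2" by (rule shift[of _ _ 4]) simp
  show "(32 :: K) = 2" by (rule shift[of _ _ 6]) simp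
qed

declare two_neq_0_K [simp]

lemma form_nondegenerate:
  assumes "\<And>y. form x y = 0"
  shows "x = 0"
proof (rule vec7_eqI)
  show "x $ 1 = 0 $ 1" "x $ 2 = 0 $ 2" "x $ 3 = 0 $ 3" "x $ 4 = 0 $ 4" "x $ 5 = 0 $ 5"
    "x $ 6 = 0 $ 6" "x $ 7 = 0 $ 7"
    using assms[of "axis 1 1"] assms[of "axis 2 1"] assms[of "axis 3 1"] assms[of "axis 4 1"]
      assms[of "axis 5 1"] assms[of "axis 6 1"] assms[of "axis 7 1"] two_neq_0_K
    by (simp_all add: form_def axis_def char_5)
qed


section \<open>Automorphisms of the cross product\<close>

definition oct_aut :: "(K ^ 7 ^ 7) set"
  where "oct_aut = {A. (\<forall>x y. form (A *v x) (A *v y) = form x y) \<and>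
    (\<forall>x y. A *v (x \<star> y) = (A *v x) \<star> (A *v y))}"

lemma oct_aut_form: "A \<in> oct_aut \<Longrightarrow> form (A *v x) (A *v y) = form x y"
  and oct_aut_cross: "A \<in> oct_aut \<Longrightarrow> A *v (x \<star> y) = (A *v x) \<star> (A *v y)"
  by (auto simp: oct_aut_def)

lemma matrix_vector_eq: "A = B \<longleftrightarrow> (\<forall>x. A *v x = B *v (x :: 'a::comm_semiring_1 ^ 'n))"
proof
  assume *: "\<forall>x. A *v x = B *v x"
  have "A $ i $ j = B $ i $ j" for i j
  proof -
    have "(A *v axis j 1) $ i = (B *v axis j 1) $ i" using * by simp
    then show ?thesis
      by (simp add: matrix_vector_mult_def axis_def if_distrib[of "\<lambda>z. _ * z"] cong: if_cong)
  qed
  then show "A = B" by (simp add: vec_eq_iff)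
qed simp

text \<open>
  The form is nondegenerate, so an automorphism is injective and hence, in finite dimension, invertible.
\<close>

lemma oct_aut_inverse:
  assumes "A \<in> oct_aut"
  obtains B where "B \<in> oct_aut" "A ** B = mat 1" "B ** A = mat 1"
    "\<And>x. A *v (B *v x) = x" "\<And>x. B *v (A *v x) = x"
proof -
  have "x = 0" if "A *v x = 0" for x
    by (rule form_nondegenerate) (metis assms form_simps(9) oct_aut_form that)
  then obtain B where BA: "B ** A = mat 1"
    using matrix_left_invertible_ker by blast
  then have AB: "A ** B = mat 1" using matrix_left_right_inverse by blast
  have inv: "A *v (B *v x) = x" "B *v (A *v x) = x" for x
    by (simp_all add: AB BA matrix_vector_mul_assoc)
  have "B \<in> oct_aut"
    unfolding oct_aut_def
  proof (intro CollectI conjI allI)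
    fix x y
    show "form (B *v x) (B *v y) = form x y"
      using oct_aut_form[OF assms, of "B *v x" "B *v y"] by (simp add: inv)
    show "B *v (x \<star> y) = (B *v x) \<star> (B *v y)"
      using oct_aut_cross[OF assms, of "B *v x" "B *v y"] by (metis inv)
  qed
  with that AB BA inv show thesis by blast
qed

lemma oct_aut_mult: "A \<in> oct_aut \<Longrightarrow> B \<in> oct_aut \<Longrightarrow> A ** B \<in> oct_aut"
  by (simp add: oct_aut_def flip: matrix_vector_mul_assoc)

lemma oct_aut_one: "mat 1 \<in> oct_aut"
  by (simp add: oct_aut_def)

lemma oct_aut_GL: "oct_aut \<subseteq> carrier GL"
proof
  fix A assume "A \<in> oct_aut"
  then obtain B where "A ** B = mat 1" "B ** A = mat 1" by (rule oct_aut_inverse)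
  then show "A \<in> carrier GL" by (auto simp: GL_def invertible_def)
qed

lemma inv_GL_eq:
  assumes "A ** B = mat 1" "B ** A = mat 1"
  shows "inv\<^bsub>GL\<^esub> A = B"
proof (rule group.inv_equality[OF group_GL])
  show "B \<otimes>\<^bsub>GL\<^esub> A = \<one>\<^bsub>GL\<^esub>" using assms by (simp add: GL_def)
  show "A \<in> carrier GL" "B \<in> carrier GL" using assms by (auto simp: GL_def invertible_def)
qed

lemma subgroup_oct_aut: "subgroup oct_aut GL"
proof (rule group.subgroupI[OF group_GL oct_aut_GL])
  show "oct_aut \<noteq> {}" using oct_aut_one by blast
  show "inv\<^bsub>GL\<^esub> A \<in> oct_aut" if "A \<in> oct_aut" for A
    using that by (metis inv_GL_eq oct_aut_inverse)
  show "A \<otimes>\<^bsub>GL\<^esub> B \<in> oct_aut" if "A \<in> oct_aut" "B \<in> oct_aut" for A B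
    using oct_aut_mult that by (simp add: GL_def)
qed

text \<open>
  The Lie algebra of \<open>oct_aut\<close>: infinitesimal isometries that satisfy the Leibniz rule.
\<close>

definition derivation :: "K ^ 7 ^ 7 \<Rightarrow> bool"
  where "derivation E \<longleftrightarrow> (\<forall>x y. form (E *v x) y + form x (E *v y) = 0) \<and>
    (\<forall>x y. E *v (x \<star> y) = (E *v x) \<star> y + x \<star> (E *v y))"

lemma mat_mult_vec:
  fixes A :: "K ^ 7 ^ 7"
  shows "(mat c ** A) *v x = c *s (A *v x)"
proof -
  have "mat c *v y = c *s y" for y :: "K ^ 7"
    by (simp add: vec_eq_iff mat_def matrix_vector_mult_def if_distrib[of "\<lambda>z. z * _"] cong: if_cong)
  then show ?thesis by (simp flip: matrix_vector_mul_assoc)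
qed

lemma derivation_bracket:
  assumes "derivation D" "derivation E"
  shows "derivation (bracket D E)"
  unfolding derivation_def
proof (intro conjI allI)
  fix x y
  have D: "form (D *v u) w = - form u (D *v w)" for u w
    using assms(1) by (auto simp: derivation_def add_eq_0_iff2)
  have E: "form (E *v u) w = - form u (E *v w)" for u w
    using assms(2) by (auto simp: derivation_def add_eq_0_iff2)
  show "form (bracket D E *v x) y + form x (bracket D E *v y) = 0"
    by (simp add: bracket_def matrix_vector_mult_diff_rdistrib D E flip: matrix_vector_mul_assoc)
  have D': "D *v (u \<star> w) = (D *v u) \<star> w + u \<star> (D *v w)" and E': "E *v (u \<star> w) = (E *v u) \<star> w + u \<star> (E *v w)" for u w
    using assms by (auto simp: derivation_def)
  show "bracket D E *v (x \<star> y) = (bracket D E *v x) \<star> y + x \<star> (bracket D E *v y)"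
    by (simp add: bracket_def matrix_vector_mult_diff_rdistrib D' E' matrix_vector_right_distrib algebra_simps flip: matrix_vector_mul_assoc)
qed

lemma derivation_scale: "derivation E \<Longrightarrow> derivation (mat c ** E)"
  by (simp add: derivation_def mat_mult_vec vector_add_ldistrib flip: distrib_left)

lemma matrix_unit_vec: "matrix_unit i j *v x = axis i (x $ j)"
  by (simp add: vec_eq_iff matrix_unit_def matrix_vector_mult_def axis_def
      if_distrib[of "\<lambda>z. z * _"] if_bool_eq_conj sum.delta' cong: if_cong)

lemma simple_vec:
  "e_alpha *v x = vec7 (x$2) 0 (2 * x$4) (x$5) 0 (x$7) 0"
  "e_beta *v x = vec7 0 (x$3) 0 0 (x$6) 0 0"
  "f_alpha *v x = vec7 0 (x$1) 0 (x$3) (2 * x$4) 0 (x$6)"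
  "f_beta *v x = vec7 0 0 (x$2) 0 0 (x$5) 0"
  by (rule vec7_eqI; simp add: e_alpha_def e_beta_def f_alpha_def f_beta_def
      matrix_vector_mult_add_rdistrib mat_mult_vec matrix_unit_vec axis_def)+

lemma derivation_simple:
  "derivation e_alpha" "derivation e_beta" "derivation f_alpha" "derivation f_beta"
  unfolding derivation_def
  by (intro conjI allI; (rule vec7_eqI)?; simp add: simple_vec cross_def form_def algebra_simps)+

lemma derivation_root_vector: "derivation (root_vector \<gamma>)"
proof -
  have "derivation 0" by (simp add: derivation_def)
  moreover have "derivation x \<Longrightarrow> derivation y \<Longrightarrow> derivation (chevalley_vector x y \<delta>)" for x y \<delta>
    using \<open>derivation 0\<close>
    by (auto simp: chevalley_vector_def intro!: derivation_bracket derivation_scale)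
  ultimately show ?thesis
    by (auto simp: root_vector_def derivation_simple)
qed

lemma exp_vec:
  fixes E :: "K ^ 7 ^ 7"
  shows "(mat 1 + mat c ** E + mat (c\<^sup>2 / 2) ** (E ** E)) *v x =
    x + c *s (E *v x) + (c\<^sup>2 / 2) *s (E *v (E *v x))"
  by (simp add: matrix_vector_mult_add_rdistrib mat_mult_vec matrix_vector_mul_assoc)

text \<open>
  The exponential of a nilpotent derivation is an automorphism. It is truncated after the quadratic term,
  so the terms of degree three and four in the expansion of a product have to vanish. The former do because
  \<open>E\<^sup>3 (x \<star> y) = 0\<close> is three times their sum, and applying \<open>E\<close> once more gives twice the latter.
\<close>

lemma exp_derivation_oct_aut:
  assumes E: "derivation E" and E3: "E ** (E ** E) = 0"
  shows "mat 1 + mat c ** E + mat (c\<^sup>2 / 2) ** (E ** E) \<in> oct_aut"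
  unfolding oct_aut_def
proof (intro CollectI conjI allI)
  fix x y
  have E3': "E *v (E *v (E *v u)) = 0" for u
    using E3 by (metis matrix_vector_mul_assoc matrix_vector_mult_0)
  have F: "form (E *v u) w = - form u (E *v w)" for u w
    using E by (auto simp: derivation_def add_eq_0_iff2)
  have D: "E *v (u \<star> w) = (E *v u) \<star> w + u \<star> (E *v w)" for u w
    using E by (auto simp: derivation_def)
  define h where "h = c\<^sup>2 / 2"
  have h: "c * c = h + h"
    by (simp add: h_def power2_eq_square flip: mult_2)
  show "form ((mat 1 + mat c ** E + mat (c\<^sup>2 / 2) ** (E ** E)) *v x)
      ((mat 1 + mat c ** E + mat (c\<^sup>2 / 2) ** (E ** E)) *v y) = form x y"
    unfolding exp_vec unfolding h_def[symmetric] by (simp add: F E3' algebra_simps h)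
  have s3: "(E *v (E *v x)) \<star> (E *v y) + (E *v x) \<star> (E *v (E *v y)) = 0"
  proof -
    have "E *v (E *v (E *v (x \<star> y))) = 3 *s ((E *v (E *v x)) \<star> (E *v y) + (E *v x) \<star> (E *v (E *v y)))"
      by (simp only: D matrix_vector_right_distrib E3' cross_simps) (simp add: vec_eq_iff algebra_simps)
    then show ?thesis using two_neq_0_K by (simp add: E3' char_5)
  qed
  have s4: "(E *v (E *v x)) \<star> (E *v (E *v y)) = 0"
  proof -
    have "E *v ((E *v (E *v x)) \<star> (E *v y) + (E *v x) \<star> (E *v (E *v y))) = 2 *s ((E *v (E *v x)) \<star> (E *v (E *v y)))"
      by (simp only: D matrix_vector_right_distrib E3' cross_simps) (simp add: vec_eq_iff algebra_simps)
    then show ?thesis using two_neq_0_K by (simp add: s3)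
  qed
  have s3': "(E *v (E *v x)) \<star> (E *v y) = - ((E *v x) \<star> (E *v (E *v y)))" using s3 by (simp add: add_eq_0_iff2)
  show "(mat 1 + mat c ** E + mat (c\<^sup>2 / 2) ** (E ** E)) *v (x \<star> y) =
      ((mat 1 + mat c ** E + mat (c\<^sup>2 / 2) ** (E ** E)) *v x) \<star>
      ((mat 1 + mat c ** E + mat (c\<^sup>2 / 2) ** (E ** E)) *v y)"
    unfolding exp_vec unfolding h_def[symmetric]
    by (simp add: D s3' s4 matrix_vector_right_distrib vector_add_ldistrib vector_smult_assoc)
       (simp add: vec_eq_iff algebra_simps h)
qed

lemma root_element_oct_aut: "\<gamma> \<in> roots \<Longrightarrow> root_element \<gamma> c \<in> oct_aut"
  unfolding root_element_def
  by (rule exp_derivation_oct_aut[OF derivation_root_vector root_vector_cube])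

lemma carrier_G2_subset: "carrier G2 \<subseteq> oct_aut"
  unfolding G2_def
  by (auto dest!: group.generate_subgroup_incl[OF group_GL _ subgroup_oct_aut, THEN subsetD, rotated]
      simp: root_element_oct_aut)

section \<open>Root elements generate all automorphisms\<close>

lemma bracket_vec: "bracket D E *v x = D *v (E *v x) - E *v (D *v x)"
  by (simp add: bracket_def matrix_vector_mult_diff_rdistrib matrix_vector_mul_assoc)

lemma axis_nth: "(axis k c :: 'a::zero ^ 'n) $ j = (if j = k then c else 0)"
  by (simp add: axis_def)

lemma four_neq_0_K [simp]: "(4 :: K) \<noteq> 0"
  by (simp add: char_5)

lemma root_vector_vec:
  "root_vector (1, 0) *v x = vec7 (x$2) 0 (2 * x$4) (x$5) 0 (x$7) 0"
  "root_vector (0, 1) *v x = vec7 0 (x$3) 0 0 (x$6) 0 0"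
  "root_vector (1, 1) *v x = vec7 (x$3) (- 2 * x$4) 0 (x$6) (- x$7) 0 0"
  "root_vector (2, 1) *v x = vec7 (- 2 * x$4) (x$5) (x$6) (- x$7) 0 0 0"
  "root_vector (3, 1) *v x = vec7 (x$5) 0 (- x$7) 0 0 0 0"
  "root_vector (3, 2) *v x = vec7 (- x$6) (- x$7) 0 0 0 0 0"
  "root_vector (-1, 0) *v x = vec7 0 (x$1) 0 (x$3) (2 * x$4) 0 (x$6)"
  "root_vector (0, -1) *v x = vec7 0 0 (x$2) 0 0 (x$5) 0"
  "root_vector (-1, -1) *v x = vec7 0 0 (- x$1) (x$2) 0 (- 2 * x$4) (x$5)"
  "root_vector (-2, -1) *v x = vec7 0 0 0 (- x$1) (x$2) (x$3) (- 2 * x$4)"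
  "root_vector (-3, -1) *v x = vec7 0 0 0 0 (- x$1) 0 (x$3)"
  "root_vector (-3, -2) *v x = vec7 0 0 0 0 0 (- x$1) (- x$2)"
  by (rule vec7_eqI; simp add: root_vector_def chevalley_vector_def pos_long_roots_def
      pos_short_roots_def bracket_vec mat_mult_vec simple_vec char_5)+

lemma root_element_vec:
  "root_element (1, 0) c *v x = vec7 (x$1 + (c * x$2)) (x$2) (x$3 + 2 * (c * x$4) + (c\<^sup>2 * x$5)) (x$4 + (c * x$5)) (x$5) (x$6 + (c * x$7)) (x$7)"
  "root_element (0, 1) c *v x = vec7 (x$1) (x$2 + (c * x$3)) (x$3) (x$4) (x$5 + (c * x$6)) (x$6) (x$7)"
  "root_element (1, 1) c *v x = vec7 (x$1 + (c * x$3)) (x$2 - 2 * (c * x$4) - (c\<^sup>2 * x$6)) (x$3) (x$4 + (c * x$6)) (x$5 - (c * x$7)) (x$6) (x$7)"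
  "root_element (2, 1) c *v x = vec7 (x$1 - 2 * (c * x$4) + (c\<^sup>2 * x$7)) (x$2 + (c * x$5)) (x$3 + (c * x$6)) (x$4 - (c * x$7)) (x$5) (x$6) (x$7)"
  "root_element (3, 1) c *v x = vec7 (x$1 + (c * x$5)) (x$2) (x$3 - (c * x$7)) (x$4) (x$5) (x$6) (x$7)"
  "root_element (3, 2) c *v x = vec7 (x$1 - (c * x$6)) (x$2 - (c * x$7)) (x$3) (x$4) (x$5) (x$6) (x$7)"
  "root_element (-1, 0) c *v x = vec7 (x$1) (x$2 + (c * x$1)) (x$3) (x$4 + (c * x$3)) (x$5 + 2 * (c * x$4) + (c\<^sup>2 * x$3)) (x$6) (x$7 + (c * x$6))"
  "root_element (0, -1) c *v x = vec7 (x$1) (x$2) (x$3 + (c * x$2)) (x$4) (x$5) (x$6 + (c * x$5)) (x$7)"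
  "root_element (-1, -1) c *v x = vec7 (x$1) (x$2) (x$3 - (c * x$1)) (x$4 + (c * x$2)) (x$5) (x$6 - 2 * (c * x$4) - (c\<^sup>2 * x$2)) (x$7 + (c * x$5))"
  "root_element (-2, -1) c *v x = vec7 (x$1) (x$2) (x$3) (x$4 - (c * x$1)) (x$5 + (c * x$2)) (x$6 + (c * x$3)) (x$7 - 2 * (c * x$4) + (c\<^sup>2 * x$1))"
  "root_element (-3, -1) c *v x = vec7 (x$1) (x$2) (x$3) (x$4) (x$5 - (c * x$1)) (x$6) (x$7 + (c * x$3))"
  "root_element (-3, -2) c *v x = vec7 (x$1) (x$2) (x$3) (x$4) (x$5) (x$6 - (c * x$1)) (x$7 - (c * x$2))"
  by (rule vec7_eqI; simp add: root_element_def exp_vec root_vector_vec)+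

lemma root_cases:
  "(1, 0) \<in> roots" "(0, 1) \<in> roots" "(1, 1) \<in> roots" "(2, 1) \<in> roots" "(3, 1) \<in> roots"
  "(3, 2) \<in> roots" "(-1, 0) \<in> roots" "(0, -1) \<in> roots" "(-1, -1) \<in> roots" "(-2, -1) \<in> roots"
  "(-3, -1) \<in> roots" "(-3, -2) \<in> roots"
  by (auto simp: roots_def long_roots_def short_roots_def pos_long_roots_def pos_short_roots_def)

lemma subgroup_G2: "subgroup (carrier G2) GL"
proof -
  have "(\<Union>\<gamma> \<in> roots. range (root_element \<gamma>)) \<subseteq> carrier GL"
    using root_element_oct_aut oct_aut_GL by blast
  then show ?thesis
    unfolding G2_def using group.generate_is_subgroup[OF group_GL] by simp
qed

lemma root_element_G2: "\<gamma> \<in> roots \<Longrightarrow> root_element \<gamma> c \<in> carrier G2"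
  unfolding G2_def by (auto intro: generate.incl)

lemma G2_mult: "g \<in> carrier G2 \<Longrightarrow> h \<in> carrier G2 \<Longrightarrow> g ** h \<in> carrier G2"
  using subgroup.m_closed[OF subgroup_G2] by (simp add: GL_def)

lemma G2_one: "mat 1 \<in> carrier G2"
  using subgroup.one_closed[OF subgroup_G2] by (simp add: GL_def)

lemma G2_cancel:
  assumes "h \<in> carrier G2" "h ** g \<in> carrier G2"
  shows "g \<in> carrier G2"
proof -
  have "h \<in> oct_aut" using assms(1) carrier_G2_subset by blast
  then obtain k where k: "h ** k = mat 1" "k ** h = mat 1" by (rule oct_aut_inverse)
  have "inv\<^bsub>GL\<^esub> h \<in> carrier G2" by (rule subgroup.m_inv_closed[OF subgroup_G2 assms(1)])
  then have "k \<in> carrier G2" by (simp add: inv_GL_eq[OF k])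
  then have "k ** (h ** g) \<in> carrier G2" using assms(2) by (rule G2_mult)
  then show ?thesis by (simp add: matrix_mul_assoc k)
qed

text \<open>
  Orbits of the group generated by root elements, stated before this group is known to be \<open>oct_aut\<close>.
\<close>

definition G2_moves :: "K ^ 7 \<Rightarrow> K ^ 7 \<Rightarrow> bool"
  where "G2_moves v w \<longleftrightarrow> (\<exists>h \<in> carrier G2. h *v v = w)"

lemma G2_moves_trans [trans]: "G2_moves u v \<Longrightarrow> G2_moves v w \<Longrightarrow> G2_moves u w"
  unfolding G2_moves_def by (metis G2_mult matrix_vector_mul_assoc)

lemma G2_moves_root: "\<gamma> \<in> roots \<Longrightarrow> G2_moves v (root_element \<gamma> c *v v)"
  unfolding G2_moves_def using root_element_G2 by blast

lemma G2_moves_root': "\<gamma> \<in> roots \<Longrightarrow> G2_moves (root_element \<gamma> c *v v) w \<Longrightarrow> G2_moves v w"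
  using G2_moves_root G2_moves_trans by blast

text \<open>
  The negative root elements whose roots have nonzero coefficient at \<open>\<alpha>\<close> clear the coordinates
  \<open>2, \<dots>, 6\<close> one after the other without disturbing those already cleared. The last coordinate then
  vanishes because the vector is singular.
\<close>

lemma G2_moves_singular_1:
  assumes "v $ 1 = 1" "form v v = 0"
  shows "G2_moves v (axis 1 1)"
proof (rule G2_moves_root'[OF root_cases(7), of "- v$2"], rule G2_moves_root'[OF root_cases(9)],
    rule G2_moves_root'[OF root_cases(10)], rule G2_moves_root'[OF root_cases(11)],
    rule G2_moves_root'[OF root_cases(12)])
  define v1 where "v1 = root_element (-1, 0) (- v$2) *v v"
  define v2 where "v2 = root_element (-1, -1) (v1$3) *v v1"
  define v3 where "v3 = root_element (-2, -1) (v2$4) *v v2"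
  define v4 where "v4 = root_element (-3, -1) (v3$5) *v v3"
  define v5 where "v5 = root_element (-3, -2) (v4$6) *v v4"
  have "form v5 v5 = 0"
    unfolding v5_def v4_def v3_def v2_def v1_def
    using assms(2) root_element_oct_aut root_cases by (simp add: oct_aut_form)
  moreover have 1: "v1$1 = 1" "v1$2 = 0" using assms by (simp_all add: v1_def root_element_vec)
  moreover have 2: "v2$1 = 1" "v2$2 = 0" "v2$3 = 0" using 1 by (simp_all add: v2_def root_element_vec)
  moreover have 3: "v3$1 = 1" "v3$2 = 0" "v3$3 = 0" "v3$4 = 0"
    using 2 by (simp_all add: v3_def root_element_vec)
  moreover have 4: "v4$1 = 1" "v4$2 = 0" "v4$3 = 0" "v4$4 = 0" "v4$5 = 0"
    using 3 by (simp_all add: v4_def root_element_vec)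
  moreover have 5: "v5$1 = 1" "v5$2 = 0" "v5$3 = 0" "v5$4 = 0" "v5$5 = 0" "v5$6 = 0"
    using 4 by (simp_all add: v5_def root_element_vec)
  ultimately have "v5 = axis 1 1"
    by (intro vec7_eqI) (simp_all add: axis_nth form_def)
  then show "G2_moves (root_element (-3, -2) (v4$6) *v (root_element (-3, -1) (v3$5) *v
      (root_element (-2, -1) (v2$4) *v (root_element (-1, -1) (v1$3) *v
      (root_element (-1, 0) (- v$2) *v v))))) (axis 1 1)"
    unfolding v1_def[symmetric] v2_def[symmetric] v3_def[symmetric] v4_def[symmetric] v5_def[symmetric]
    using G2_one by (auto simp: G2_moves_def intro!: bexI[of _ "mat 1"])
qed

lemma G2_moves_singular_2:
  assumes "v $ 2 \<noteq> 0" "form v v = 0"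
  shows "G2_moves v (axis 1 1)"
proof (rule G2_moves_root'[OF root_cases(1)], rule G2_moves_singular_1)
  show "(root_element (1, 0) ((1 - v$1) / v$2) *v v) $ 1 = 1"
    using assms(1) by (simp add: root_element_vec)
  show "form (root_element (1, 0) ((1 - v$1) / v$2) *v v) (root_element (1, 0) ((1 - v$1) / v$2) *v v) = 0"
    using assms(2) by (simp add: oct_aut_form root_element_oct_aut root_cases)
qed

text \<open>
  Starting from any nonzero coordinate, root elements for \<open>\<alpha>\<close>, \<open>-\<alpha>\<close> and \<open>\<beta>\<close> make the coordinate of weight
  \<open>\<alpha> + \<beta>\<close> nonzero, and then \<open>x\<^sub>\<alpha>\<close> can make the first coordinate equal to one.
\<close>

lemma G2_moves_singular:
  assumes "v \<noteq> 0" "form v v = 0"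
  shows "G2_moves v (axis 1 1)"
proof -
  have s: "form (root_element \<gamma> c *v w) (root_element \<gamma> c *v w) = 0"
    if "form w w = 0" "\<gamma> \<in> roots" for \<gamma> c and w :: "K ^ 7"
    using that by (simp add: oct_aut_form root_element_oct_aut)
  have 3: "G2_moves w (axis 1 1)" if "form w w = 0" "w $ 3 \<noteq> 0" for w :: "K ^ 7"
  proof (cases "w $ 2 = 0")
    case True
    show ?thesis
      by (rule G2_moves_root'[OF root_cases(2), of 1], rule G2_moves_singular_2)
         (use that True in \<open>simp_all add: s root_cases\<close>, simp_all add: root_element_vec)
  qed (use that G2_moves_singular_2 in blast)
  have 1: "G2_moves w (axis 1 1)" if "form w w = 0" "w $ 1 \<noteq> 0" for w :: "K ^ 7"
  proof (cases "w $ 2 = 0")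
    case True
    show ?thesis
      by (rule G2_moves_root'[OF root_cases(7), of 1], rule G2_moves_singular_2)
         (use that True in \<open>simp_all add: s root_cases\<close>, simp_all add: root_element_vec)
  qed (use that G2_moves_singular_2 in blast)
  have 5: "G2_moves w (axis 1 1)" if "form w w = 0" "w $ 5 \<noteq> 0" for w :: "K ^ 7"
  proof (cases "w $ 1 = 0 \<and> w $ 2 = 0 \<and> w $ 3 = 0")
    case True
    then have "w $ 4 = 0" using that by (simp add: form_def)
    show ?thesis
      by (rule G2_moves_root'[OF root_cases(1), of 1], rule 3)
         (use that True \<open>w $ 4 = 0\<close> in \<open>simp_all add: s root_cases\<close>, simp_all add: root_element_vec)
  qed (use that 1 3 G2_moves_singular_2 in blast)
  have 6: "G2_moves w (axis 1 1)" if "form w w = 0" "w $ 6 \<noteq> 0" for w :: "K ^ 7"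
  proof (cases "w $ 5 = 0")
    case True
    show ?thesis
      by (rule G2_moves_root'[OF root_cases(2), of 1], rule 5)
         (use that True in \<open>simp_all add: s root_cases\<close>, simp_all add: root_element_vec)
  qed (use that 5 in blast)
  show ?thesis
  proof (cases "v$1 = 0 \<and> v$2 = 0 \<and> v$3 = 0 \<and> v$5 = 0 \<and> v$6 = 0")
    case True
    then have "v $ 4 = 0" using assms(2) by (simp add: form_def)
    then have "v $ 7 \<noteq> 0" using True assms(1) by (metis vec7_eqI zero_index)
    show ?thesis
      by (rule G2_moves_root'[OF root_cases(1), of 1], rule 6)
         (use True \<open>v $ 7 \<noteq> 0\<close> assms(2) in \<open>simp_all add: s root_cases\<close>, simp_all add: root_element_vec)
  qed (use assms(2) 1 3 5 6 G2_moves_singular_2 in blast)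
qed

text \<open>
  The same elimination with positive root elements, all of which fix the highest weight vector.
\<close>

lemma G2_moves_opposite:
  assumes "w $ 7 = 1" "form w w = 0"
  shows "\<exists>h \<in> carrier G2. h *v axis 1 1 = axis 1 1 \<and> h *v w = axis 7 1"
proof -
  define w1 where "w1 = root_element (1, 0) (- w$6) *v w"
  define w2 where "w2 = root_element (1, 1) (w1$5) *v w1"
  define w3 where "w3 = root_element (2, 1) (w2$4) *v w2"
  define w4 where "w4 = root_element (3, 1) (w3$3) *v w3"
  define w5 where "w5 = root_element (3, 2) (w4$2) *v w4"
  define h where "h = root_element (3, 2) (w4$2) ** (root_element (3, 1) (w3$3) **
    (root_element (2, 1) (w2$4) ** (root_element (1, 1) (w1$5) ** root_element (1, 0) (- w$6))))"
  have "form w5 w5 = 0"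
    unfolding w5_def w4_def w3_def w2_def w1_def
    using assms(2) root_element_oct_aut root_cases by (simp add: oct_aut_form)
  moreover have 1: "w1$7 = 1" "w1$6 = 0" using assms by (simp_all add: w1_def root_element_vec)
  moreover have 2: "w2$7 = 1" "w2$6 = 0" "w2$5 = 0" using 1 by (simp_all add: w2_def root_element_vec)
  moreover have 3: "w3$7 = 1" "w3$6 = 0" "w3$5 = 0" "w3$4 = 0"
    using 2 by (simp_all add: w3_def root_element_vec)
  moreover have 4: "w4$7 = 1" "w4$6 = 0" "w4$5 = 0" "w4$4 = 0" "w4$3 = 0"
    using 3 by (simp_all add: w4_def root_element_vec)
  moreover have 5: "w5$7 = 1" "w5$6 = 0" "w5$5 = 0" "w5$4 = 0" "w5$3 = 0" "w5$2 = 0"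
    using 4 by (simp_all add: w5_def root_element_vec)
  ultimately have "w5 = axis 7 1"
    by (intro vec7_eqI) (simp_all add: axis_nth form_def)
  then have "h *v w = axis 7 1"
    by (simp add: h_def w1_def w2_def w3_def w4_def w5_def flip: matrix_vector_mul_assoc)
  moreover have "root_element \<gamma> c *v axis 1 1 = axis 1 1" if "\<gamma> \<in> {(1,0), (1,1), (2,1), (3,1), (3,2)}" for \<gamma> c
    using that by (auto intro!: vec7_eqI simp: root_element_vec axis_nth)
  then have "h *v axis 1 1 = axis 1 1"
    by (simp add: h_def flip: matrix_vector_mul_assoc)
  moreover have "h \<in> carrier G2"
    unfolding h_def by (intro G2_mult root_element_G2 root_cases)
  ultimately show ?thesis by blast
qed

lemma cross_axis:
  "axis 1 1 \<star> axis 7 1 = - axis 4 1" "axis 4 1 \<star> axis 5 1 = 2 *s axis 5 1"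
  "axis 4 1 \<star> axis 6 1 = 2 *s axis 6 1" "axis 1 1 \<star> axis 5 1 = - 2 *s axis 2 1"
  "axis 1 1 \<star> axis 6 1 = - 2 *s axis 3 1" "axis 5 1 \<star> axis 6 1 = 2 *s axis 7 1"
  "axis 2 1 \<star> axis 3 1 = 2 *s axis 1 1" "axis 3 1 \<star> axis 7 1 = - 2 *s axis 6 1"
  "axis 2 1 \<star> axis 7 1 = - 2 *s axis 5 1" "axis 3 1 \<star> axis 5 1 = axis 4 1"
  by (rule vec7_eqI; simp add: cross_def axis_nth)+

lemma vec7_axis: "x = x$1 *s axis 1 1 + x$2 *s axis 2 1 + x$3 *s axis 3 1 + x$4 *s axis 4 1
    + x$5 *s axis 5 1 + x$6 *s axis 6 1 + x$7 *s (axis 7 1 :: K ^ 7)"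
  by (rule vec7_eqI; simp add: axis_nth)

lemma matrix_eq_on_axes:
  fixes A B :: "K ^ 7 ^ 7"
  assumes "\<And>i. A *v axis i 1 = B *v axis i 1"
  shows "A = B"
  unfolding matrix_vector_eq
proof
  fix x
  show "A *v x = B *v x"
    by (subst (1 2) vec7_axis) (simp add: assms matrix_vector_right_distrib vector_scalar_commute)
qed

text \<open>
  An automorphism that fixes \<open>e\<^sub>1\<close> and \<open>e\<^sub>7\<close> fixes \<open>e\<^sub>1 \<star> e\<^sub>7 = -e\<^sub>4\<close>, and the eigenspaces of \<open>e\<^sub>4\<close> show that
  it acts on \<open>\<langle>e\<^sub>5, e\<^sub>6\<rangle>\<close> by a matrix of determinant one, which determines it. Elements of \<open>SL\<^sub>2(K)\<close> are
  products of elementary matrices, and these are the root elements for \<open>\<beta>\<close> and \<open>-\<beta>\<close>.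
\<close>

lemma stabiliser_of_opposite_vectors_subset_G2:
  assumes g: "g \<in> oct_aut" and fx: "g *v axis 1 1 = axis 1 1" "g *v axis 7 1 = axis 7 1"
  shows "g \<in> carrier G2"
proof -
  have img: "h *v axis 4 1 = axis 4 1" "(h *v axis 5 1) $ 1 = 0" "(h *v axis 6 1) $ 1 = 0"
    "2 *s (h *v axis 5 1) = axis 4 1 \<star> (h *v axis 5 1)"
    "2 *s (h *v axis 6 1) = axis 4 1 \<star> (h *v axis 6 1)"
    "(h *v axis 5 1) \<star> (h *v axis 6 1) = 2 *s axis 7 1"
    if h: "h \<in> oct_aut" "h *v axis 1 1 = axis 1 1" "h *v axis 7 1 = axis 7 1" for h
  proof -
    note c = oct_aut_cross[OF h(1)]
    have "h *v (axis 1 1 \<star> axis 7 1) = axis 1 1 \<star> axis 7 1" by (simp only: c h)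
    then show 4: "h *v axis 4 1 = axis 4 1"
      by (simp add: cross_axis vec.neg)
    show "2 *s (h *v axis 5 1) = axis 4 1 \<star> (h *v axis 5 1)"
      "2 *s (h *v axis 6 1) = axis 4 1 \<star> (h *v axis 6 1)"
      using c[of "axis 4 1" "axis 5 1"] c[of "axis 4 1" "axis 6 1"]
      by (simp_all add: cross_axis 4 vector_scalar_commute)
    show "(h *v axis 5 1) \<star> (h *v axis 6 1) = 2 *s axis 7 1"
      using c[of "axis 5 1" "axis 6 1"] by (simp add: cross_axis h vector_scalar_commute)
    show "(h *v axis 5 1) $ 1 = 0" "(h *v axis 6 1) $ 1 = 0"
      using oct_aut_form[OF h(1), of "axis 7 1" "axis 5 1"] oct_aut_form[OF h(1), of "axis 7 1" "axis 6 1"]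
      by (simp_all add: h form_def axis_nth)
  qed
  have shape: "h *v axis 5 1 = vec7 0 0 0 0 ((h *v axis 5 1)$5) ((h *v axis 5 1)$6) 0"
    "h *v axis 6 1 = vec7 0 0 0 0 ((h *v axis 6 1)$5) ((h *v axis 6 1)$6) 0"
    "(h *v axis 5 1)$5 * (h *v axis 6 1)$6 - (h *v axis 5 1)$6 * (h *v axis 6 1)$5 = 1"
    if h: "h \<in> oct_aut" "h *v axis 1 1 = axis 1 1" "h *v axis 7 1 = axis 7 1" for h
  proof -
    note i = img[OF h]
    show 5: "h *v axis 5 1 = vec7 0 0 0 0 ((h *v axis 5 1)$5) ((h *v axis 5 1)$6) 0"
      using i(2,4) by (intro vec7_eqI) (auto simp: cross_def vec_eq_iff forall_7 axis_nth char_5)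
    show 6: "h *v axis 6 1 = vec7 0 0 0 0 ((h *v axis 6 1)$5) ((h *v axis 6 1)$6) 0"
      using i(3,5) by (intro vec7_eqI) (auto simp: cross_def vec_eq_iff forall_7 axis_nth char_5)
    have "((h *v axis 5 1) \<star> (h *v axis 6 1)) $ 7 = 2" by (simp add: i(6) axis_nth)
    then have "2 * ((h *v axis 5 1)$5 * (h *v axis 6 1)$6 - (h *v axis 5 1)$6 * (h *v axis 6 1)$5) = 2 * 1"
      using arg_cong[OF 5, of "\<lambda>v. v $ 4"] arg_cong[OF 5, of "\<lambda>v. v $ 7"] by (simp add: cross_def)
    then show "(h *v axis 5 1)$5 * (h *v axis 6 1)$6 - (h *v axis 5 1)$6 * (h *v axis 6 1)$5 = 1"
      by (simp only: mult_left_cancel[OF two_neq_0_K])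
  qed
  have fixes17: "root_element \<gamma> c *v axis 1 1 = axis 1 1" "root_element \<gamma> c *v axis 7 1 = axis 7 1"
    if "\<gamma> = (0, 1) \<or> \<gamma> = (0, -1)" for \<gamma> c
    using that by (auto intro!: vec7_eqI simp: root_element_vec axis_nth)
  have step: "root_element \<gamma> c ** h \<in> oct_aut" "(root_element \<gamma> c ** h) *v axis 1 1 = axis 1 1"
    "(root_element \<gamma> c ** h) *v axis 7 1 = axis 7 1"
    if "\<gamma> = (0, 1) \<or> \<gamma> = (0, -1)" and h: "h \<in> oct_aut" "h *v axis 1 1 = axis 1 1" "h *v axis 7 1 = axis 7 1"
    for h \<gamma> c
    using that fixes17 root_cases
    by (auto simp: oct_aut_mult root_element_oct_aut simp flip: matrix_vector_mul_assoc)
  \<comment> \<open>Elimination in reverse order: nothing left to do, the column of \<open>e\<^sub>5\<close> done, its pivot equal to one, a pivot available.\<close>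
  have done3: "h \<in> carrier G2" if h: "h \<in> oct_aut" "h *v axis 1 1 = axis 1 1" "h *v axis 7 1 = axis 7 1"
    and 5: "h *v axis 5 1 = axis 5 1" and 6: "h *v axis 6 1 = axis 6 1" for h
  proof -
    note c = oct_aut_cross[OF h(1)]
    have "h *v axis 2 1 = axis 2 1" "h *v axis 3 1 = axis 3 1"
      using c[of "axis 1 1" "axis 5 1"] c[of "axis 1 1" "axis 6 1"]
      by (simp_all add: h 5 6 cross_axis vector_scalar_commute vec.neg)
    then have "h *v axis i 1 = mat 1 *v axis i 1" for i
      using h 5 6 img(1)[OF h] forall_7[of "\<lambda>i. h *v axis i 1 = axis i 1"] by simp
    then have "h = mat 1" by (rule matrix_eq_on_axes)
    then show ?thesis using G2_one by simp
  qed
  have done2: "h \<in> carrier G2" if h: "h \<in> oct_aut" "h *v axis 1 1 = axis 1 1" "h *v axis 7 1 = axis 7 1"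
    and 5: "h *v axis 5 1 = axis 5 1" for h
  proof -
    define b where "b = (h *v axis 6 1)$5"
    have 6: "h *v axis 6 1 = vec7 0 0 0 0 b 1 0" using shape[OF h] 5 by (simp add: b_def axis_nth)
    show ?thesis
      by (rule G2_cancel[OF root_element_G2[OF root_cases(2), of "- b"]], rule done3)
         (use step[OF _ h, of "(0, 1)" "- b"] in
          \<open>auto intro!: vec7_eqI simp: 5 6 root_element_vec axis_nth simp flip: matrix_vector_mul_assoc\<close>)
  qed
  have done1: "h \<in> carrier G2" if h: "h \<in> oct_aut" "h *v axis 1 1 = axis 1 1" "h *v axis 7 1 = axis 7 1"
    and 5: "(h *v axis 5 1)$5 = 1" for h
  proof -
    define b where "b = (h *v axis 5 1)$6"
    have 5: "h *v axis 5 1 = vec7 0 0 0 0 1 b 0" using shape(1)[OF h] 5 by (simp add: b_def)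
    show ?thesis
      by (rule G2_cancel[OF root_element_G2[OF root_cases(8), of "- b"]], rule done2)
         (use step[OF _ h, of "(0, -1)" "- b"] in
          \<open>auto intro!: vec7_eqI simp: 5 root_element_vec axis_nth simp flip: matrix_vector_mul_assoc\<close>)
  qed
  have done0: "h \<in> carrier G2" if h: "h \<in> oct_aut" "h *v axis 1 1 = axis 1 1" "h *v axis 7 1 = axis 7 1"
    and 5: "(h *v axis 5 1)$6 \<noteq> 0" for h
  proof -
    define c where "c = (1 - (h *v axis 5 1)$5) / (h *v axis 5 1)$6"
    show ?thesis
      by (rule G2_cancel[OF root_element_G2[OF root_cases(2), of c]], rule done1)
         (use step[OF _ h, of "(0, 1)" c] 5 in
          \<open>auto simp: c_def root_element_vec simp flip: matrix_vector_mul_assoc\<close>)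
  qed
  show ?thesis
  proof (cases "(g *v axis 5 1)$6 = 0")
    case True
    then have "(g *v axis 5 1)$5 \<noteq> 0" using shape(3)[OF g fx] by auto
    with True show ?thesis
      by (intro G2_cancel[OF root_element_G2[OF root_cases(8), of 1] done0])
         (use step[OF _ g fx, of "(0, -1)" 1] in
          \<open>auto simp: root_element_vec simp flip: matrix_vector_mul_assoc\<close>)
  qed (use done0 g fx in blast)
qed

text \<open>
  The opposite singular vectors \<open>e\<^sub>1\<close>, \<open>e\<^sub>7\<close> and their images under an automorphism can be matched by root
  elements, which leaves an element of the stabiliser of both vectors.
\<close>

theorem carrier_G2: "carrier G2 = oct_aut"
proof
  show "oct_aut \<subseteq> carrier G2"
  proof
    fix g assume g: "g \<in> oct_aut"
    have "g *v axis 1 1 \<noteq> 0"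
    proof
      assume "g *v axis 1 1 = 0"
      then have "form (axis 1 1) (axis 7 1) = 0"
        using oct_aut_form[OF g, of "axis 1 1" "axis 7 1"] by simp
      then show False by (simp add: form_def axis_nth)
    qed
    moreover have "form (g *v axis 1 1) (g *v axis 1 1) = 0"
      using g by (simp add: oct_aut_form) (simp add: form_def axis_nth)
    ultimately obtain h where h: "h \<in> carrier G2" "h *v (g *v axis 1 1) = axis 1 1"
      using G2_moves_singular unfolding G2_moves_def by blast
    have hg: "h ** g \<in> oct_aut" using h g carrier_G2_subset oct_aut_mult by blast
    have "form (axis 1 1) ((h ** g) *v axis 7 1) = form (axis 1 1) (axis 7 1)"
      using oct_aut_form[OF hg, of "axis 1 1" "axis 7 1"] h(2) by (simp flip: matrix_vector_mul_assoc)
    then have "((h ** g) *v axis 7 1) $ 7 = 1" by (simp add: form_def axis_nth)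
    moreover have "form ((h ** g) *v axis 7 1) ((h ** g) *v axis 7 1) = 0"
      unfolding oct_aut_form[OF hg] by (simp add: form_def axis_nth)
    ultimately obtain k where k: "k \<in> carrier G2" "k *v axis 1 1 = axis 1 1"
      "k *v ((h ** g) *v axis 7 1) = axis 7 1"
      using G2_moves_opposite by blast
    have "k ** (h ** g) \<in> carrier G2"
    proof (rule stabiliser_of_opposite_vectors_subset_G2)
      show "k ** (h ** g) \<in> oct_aut" using k hg carrier_G2_subset oct_aut_mult by blast
      show "k ** (h ** g) *v axis 1 1 = axis 1 1" "k ** (h ** g) *v axis 7 1 = axis 7 1"
        using k h by (simp_all flip: matrix_vector_mul_assoc)
    qed
    then show "g \<in> carrier G2" using G2_cancel h(1) k(1) by blast
  qed
qed (rule carrier_G2_subset)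

section \<open>Basic triples\<close>

text \<open>
  By the doubling process, three such vectors generate the octonions: \<open>i\<close>, \<open>j\<close> generate a quaternion
  algebra, and \<open>l\<close> is a unit orthogonal to it.
\<close>

definition basic_triple :: "K ^ 7 \<Rightarrow> K ^ 7 \<Rightarrow> K ^ 7 \<Rightarrow> bool"
  where "basic_triple i j l \<longleftrightarrow> form i i = 1 \<and> form j j = 1 \<and> form l l = 1 \<and>
    form i j = 0 \<and> form i l = 0 \<and> form j l = 0 \<and> form (i \<star> j) l = 0"

text \<open>
  The columns form an orthonormal basis of \<open>V\<close> attached to a basic triple.
\<close>

definition frame_matrix :: "K ^ 7 \<Rightarrow> K ^ 7 \<Rightarrow> K ^ 7 \<Rightarrow> K ^ 7 ^ 7"
  where "frame_matrix i j l = transpose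
    (vec7 i j (i \<star> j) l (i \<star> l) (j \<star> l) ((i \<star> j) \<star> l))"

lemma frame_matrix_vec: "frame_matrix i j l *v x = x$1 *s i + x$2 *s j + x$3 *s (i \<star> j) + x$4 *s l
    + x$5 *s (i \<star> l) + x$6 *s (j \<star> l) + x$7 *s ((i \<star> j) \<star> l)"
  by (simp add: vec_eq_iff frame_matrix_def matrix_vector_mult_def transpose_def sum_7 mult.commute)

lemma cross_cross_orth:
  assumes "form x y = 0" "form x z = 0" "form y z = 0"
  shows "x \<star> (y \<star> z) = - ((x \<star> y) \<star> z)"
proof -
  have "x \<star> (y \<star> z) = - (x \<star> (z \<star> y))" by (simp add: cross_anticomm[of y z])
  also have "x \<star> (z \<star> y) = - (z \<star> (x \<star> y))"
    using cross_cross_linear[of x z y] assms by (simp add: form_sym)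
  finally show ?thesis by (simp add: cross_anticomm[of z])
qed

text \<open>
  The multiplication table with respect to the basis given by a basic triple.
\<close>

definition octonion_cross :: "K ^ 7 \<Rightarrow> K ^ 7 \<Rightarrow> K ^ 7"
  where "octonion_cross x y = vec7
    ((x$2 * y$3 - x$3 * y$2) + (x$4 * y$5 - x$5 * y$4) - (x$6 * y$7 - x$7 * y$6))
    (- (x$1 * y$3 - x$3 * y$1) + (x$4 * y$6 - x$6 * y$4) + (x$5 * y$7 - x$7 * y$5))
    ((x$1 * y$2 - x$2 * y$1) + (x$4 * y$7 - x$7 * y$4) - (x$5 * y$6 - x$6 * y$5))
    (- (x$1 * y$5 - x$5 * y$1) - (x$2 * y$6 - x$6 * y$2) - (x$3 * y$7 - x$7 * y$3))
    ((x$1 * y$4 - x$4 * y$1) - (x$2 * y$7 - x$7 * y$2) + (x$3 * y$6 - x$6 * y$3))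
    ((x$1 * y$7 - x$7 * y$1) + (x$2 * y$4 - x$4 * y$2) - (x$3 * y$5 - x$5 * y$3))
    (- (x$1 * y$6 - x$6 * y$1) + (x$2 * y$5 - x$5 * y$2) + (x$3 * y$4 - x$4 * y$3))"

text \<open>
  All products and inner products of the seven basis vectors follow from the identities
  \<open>cross_cross_same\<close> and \<open>cross_cross_linear\<close>.
\<close>

lemma basic_triple_table:
  assumes "basic_triple i j l"
  defines "k \<equiv> i \<star> j" and "a \<equiv> i \<star> l" and "b \<equiv> j \<star> l" and "c \<equiv> (i \<star> j) \<star> l"
  shows "form k k = 1" "form a a = 1" "form b b = 1" "form c c = 1" "form i k = 0" "form j k = 0"
    "form k l = 0" "form i a = 0" "form i b = 0" "form i c = 0" "form j a = 0" "form j b = 0"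
    "form j c = 0" "form k a = 0" "form k b = 0" "form k c = 0" "form l a = 0" "form l b = 0"
    "form l c = 0" "form a b = 0" "form a c = 0" "form b c = 0"
    "i \<star> k = - j" "j \<star> k = i" "i \<star> a = - l" "j \<star> b = - l" "k \<star> c = - l" "l \<star> a = i"
    "l \<star> b = j" "l \<star> c = k" "i \<star> b = - c" "j \<star> a = c" "i \<star> c = b" "k \<star> a = - b"
    "j \<star> c = - a" "k \<star> b = a" "a \<star> b = - k" "a \<star> c = j" "b \<star> c = - i"
proof -
  have u: "form i i = 1" "form j j = 1" "form l l = 1" "form i j = 0" "form i l = 0" "form j l = 0"
    "form k l = 0"
    using assms(1) by (simp_all add: basic_triple_def k_def)
  have u': "form j i = 0" "form l i = 0" "form l j = 0" "form l k = 0"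
    using u by (simp_all add: form_sym[of l i] form_sym[of l j] form_sym[of l k] form_sym[of j i])
  show kk: "form k k = 1" by (simp add: k_def form_cross_cross u)
  show ik: "form i k = 0" "form j k = 0" by (simp_all add: k_def)
  show "form k l = 0" by (fact u)
  have c_eq: "c = k \<star> l" by (simp add: c_def k_def)
  note l_swap = cross_anticomm[of _ l]
  have ll: "form (x \<star> l) (y \<star> l) = form x y - form x l * form y l" for x y
    by (simp add: l_swap[of x] l_swap[of y] form_cross_cross u form_sym[of l x] form_sym[of l y] mult.commute)
  show "form a a = 1" "form b b = 1" "form c c = 1" "form a b = 0" "form a c = 0" "form b c = 0"
    by (simp_all add: a_def b_def c_eq ll u kk ik)
  show "form i a = 0" "form j b = 0" "form k c = 0" "form l a = 0" "form l b = 0" "form l c = 0"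
    by (simp_all add: a_def b_def c_eq)
  show ki: "i \<star> k = - j" by (simp add: k_def cross_cross_same u)
  have "j \<star> k = - (j \<star> (j \<star> i))" by (simp add: k_def cross_anticomm[of i])
  then show jk: "j \<star> k = i" by (simp add: cross_cross_same u u')
  show "form i b = 0" "form i c = 0" "form j a = 0" "form j c = 0" "form k a = 0" "form k b = 0"
    using u by (simp_all add: a_def b_def c_eq form_cross[symmetric] ki jk k_def[symmetric]
        cross_anticomm[of j i] cross_anticomm[of k i] cross_anticomm[of k j])
  show "i \<star> a = - l" "j \<star> b = - l" "k \<star> c = - l"
    by (simp_all add: a_def b_def c_eq cross_cross_same u kk)
  show "l \<star> a = i" "l \<star> b = j" "l \<star> c = k"
    by (simp_all add: a_def b_def c_eq l_swap[of i] l_swap[of j] l_swap[of k] cross_cross_same u u')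
  show "i \<star> b = - c" "j \<star> a = c" "i \<star> c = b" "k \<star> a = - b" "j \<star> c = - a" "k \<star> b = a"
    by (simp_all add: a_def b_def c_eq cross_cross_orth u u' ik form_sym[of k i] form_sym[of k j] ki jk k_def[symmetric]
        cross_anticomm[of j i] cross_anticomm[of k i] cross_anticomm[of k j])
  have m: "(x \<star> l) \<star> (y \<star> l) = - (x \<star> y)" if "form x l = 0" "form y l = 0" "form (x \<star> y) l = 0" for x y
  proof -
    have "(x \<star> l) \<star> (y \<star> l) = (l \<star> x) \<star> (l \<star> y)" by (simp add: l_swap[of x] l_swap[of y])
    also have "\<dots> = - (((l \<star> x) \<star> l) \<star> y)"
      using that by (intro cross_cross_orth) (simp_all add: form_cross form_sym[of l x] form_sym[of l y] form_sym[of l "x \<star> y"])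
    also have "(l \<star> x) \<star> l = x"
      using that by (simp add: cross_anticomm[of _ l] cross_cross_same u form_sym[of l x])
    finally show ?thesis .
  qed
  show "a \<star> b = - k" "a \<star> c = j" "b \<star> c = - i"
    by (simp_all add: a_def b_def c_eq m u ki jk k_def[symmetric])
qed

lemma frame_matrix_form:
  assumes "basic_triple i j l"
  shows "form (frame_matrix i j l *v x) (frame_matrix i j l *v y) = (\<Sum>p \<in> UNIV. x$p * y$p)"
proof -
  note t = basic_triple_table[OF assms]
  have u: "form i i = 1" "form j j = 1" "form l l = 1" "form i j = 0" "form i l = 0" "form j l = 0"
    using assms by (simp_all add: basic_triple_def)
  note s = t(5-22) u(4-6)
  show ?thesis
    by (simp add: frame_matrix_vec sum_7 t(1-22) u s[unfolded form_sym[of i]] s[THEN trans[OF form_sym]])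
qed

lemma frame_matrix_cross:
  assumes "basic_triple i j l"
  shows "(frame_matrix i j l *v x) \<star> (frame_matrix i j l *v y) = frame_matrix i j l *v (octonion_cross x y)"
proof -
  note t = basic_triple_table(23-39)[OF assms]
  note t' = t[THEN arg_cong[of _ _ uminus], unfolded cross_anticomm[symmetric]]
  have r: "j \<star> i = - (i \<star> j)" "l \<star> i = - (i \<star> l)" "l \<star> j = - (j \<star> l)" "l \<star> (i \<star> j) = - ((i \<star> j) \<star> l)"
    by (rule cross_anticomm)+
  show ?thesis
    unfolding frame_matrix_vec
    by (simp add: t t' r octonion_cross_def) (simp add: vec_eq_iff algebra_simps)
qed

lemma frame_matrix_invertible:
  assumes "basic_triple i j l"
  obtains N where "N ** frame_matrix i j l = mat 1" "frame_matrix i j l ** N = mat 1"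
proof -
  have "x = 0" if "frame_matrix i j l *v x = 0" for x
  proof -
    have "(\<Sum>p \<in> UNIV. x$p * y$p) = 0" for y
      using frame_matrix_form[OF assms, of x y] that by simp
    then have "x $ p = 0" for p
      using \<open>\<And>y. (\<Sum>p \<in> UNIV. x$p * y$p) = 0\<close>[of "axis p 1"]
      by (simp add: axis_nth if_distrib[of "\<lambda>z. _ * z"] cong: if_cong)
    then show "x = 0" by (simp add: vec_eq_iff)
  qed
  then show thesis
    using that matrix_left_invertible_ker matrix_left_right_inverse by blast
qed

text \<open>
  Two basic triples have the same multiplication table, so the change of basis between their frames is an automorphism.
\<close>

lemma basic_triple_transitive:
  assumes "basic_triple i j l" "basic_triple i' j' l'"
  obtains g where "g \<in> oct_aut" "g *v i = i'" "g *v j = j'" "g *v l = l'"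
proof -
  define M where "M = frame_matrix i j l"
  define M' where "M' = frame_matrix i' j' l'"
  obtain N where N: "N ** M = mat 1" "M ** N = mat 1"
    using frame_matrix_invertible[OF assms(1)] unfolding M_def by blast
  have MN: "M *v (N *v x) = x" and NM: "N *v (M *v x) = x" for x
    by (simp_all add: N matrix_vector_mul_assoc)
  define g where "g = M' ** N"
  have gM: "g *v (M *v x) = M' *v x" for x
    by (simp add: g_def NM flip: matrix_vector_mul_assoc)
  have "g \<in> oct_aut"
    unfolding oct_aut_def
  proof (intro CollectI conjI allI)
    fix x y
    obtain x0 y0 where xy: "x = M *v x0" "y = M *v y0" by (metis MN)
    show "form (g *v x) (g *v y) = form x y"
      unfolding xy gM by (simp only: M_def M'_def frame_matrix_form assms)
    have "g *v (x \<star> y) = g *v (M *v (octonion_cross x0 y0))"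
      unfolding xy by (simp only: M_def frame_matrix_cross assms)
    then show "g *v (x \<star> y) = (g *v x) \<star> (g *v y)"
      unfolding xy gM by (simp only: M'_def frame_matrix_cross assms)
  qed
  moreover have "M *v axis 1 1 = i" "M *v axis 2 1 = j" "M *v axis 4 1 = l"
    "M' *v axis 1 1 = i'" "M' *v axis 2 1 = j'" "M' *v axis 4 1 = l'"
    by (simp_all add: M_def M'_def frame_matrix_vec axis_nth)
  then have "g *v i = i'" "g *v j = j'" "g *v l = l'" using gM by metis+
  ultimately show thesis by (rule that)
qed

lemma basic_triple_ext:
  assumes t: "basic_triple i j l" and A: "A \<in> oct_aut" and B: "B \<in> oct_aut"
    and eq: "A *v i = B *v i" "A *v j = B *v j" "A *v l = B *v l"
  shows "A = B"
proof -
  obtain N where N: "frame_matrix i j l ** N = mat 1" using frame_matrix_invertible[OF t] by blast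
  have "A *v (frame_matrix i j l *v x) = B *v (frame_matrix i j l *v x)" for x
    unfolding frame_matrix_vec
    by (simp add: matrix_vector_right_distrib vector_scalar_commute oct_aut_cross A B eq)
  then have "A ** frame_matrix i j l = B ** frame_matrix i j l"
    by (simp add: matrix_vector_eq flip: matrix_vector_mul_assoc)
  then have "A ** (frame_matrix i j l ** N) = B ** (frame_matrix i j l ** N)"
    by (simp add: matrix_mul_assoc)
  then show ?thesis by (simp add: N)
qed

lemma orthogonal_to_few_vectors:
  fixes S :: "(K ^ 7) set"
  assumes "finite S" "card S < 7"
  obtains x where "x \<noteq> 0" "\<And>y. y \<in> S \<Longrightarrow> form y x = 0"
proof -
  have "card S \<le> card (UNIV - {7 :: 7})" using assms(2) by simp
  then obtain f :: "K ^ 7 \<Rightarrow> 7" where f: "f ` S \<subseteq> UNIV - {7}" "inj_on f S"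
    using card_le_inj[OF assms(1)] by (meson finite)
  define b where "b r = (if r \<in> f ` S then the_inv_into S f r else 0)" for r
  define A :: "K ^ 7 ^ 7" where "A = (\<chi> r c. form (b r) (axis c 1))"
  have form_sum: "form y x = (\<Sum>c \<in> UNIV. form y (axis c 1) * x $ c)" for x y
    by (subst vec7_axis[of x]) (simp add: sum_7 mult.commute)
  have Ax: "(A *v x) $ r = form (b r) x" for x r
    by (simp add: A_def matrix_vector_mult_def form_sum[symmetric])
  have "\<not> (\<forall>x. A *v x = 0 \<longrightarrow> x = 0)"
  proof
    assume "\<forall>x. A *v x = 0 \<longrightarrow> x = 0"
    then obtain B where "A ** B = mat 1"
      using matrix_left_invertible_ker[of A] matrix_left_right_inverse[of _ A] by blast
    then have "A *v (B *v axis 7 1) = axis 7 1" by (simp add: matrix_vector_mul_assoc)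
    then have "(A *v (B *v axis 7 1)) $ 7 = 1" by (simp add: axis_nth)
    moreover have "b 7 = 0" using f(1) by (auto simp: b_def)
    ultimately show False by (simp add: Ax)
  qed
  then obtain x where x: "x \<noteq> 0" "A *v x = 0" by blast
  have "form y x = 0" if "y \<in> S" for y
    using that Ax[of x "f y"] x(2) f(2) by (simp add: b_def the_inv_into_f_f)
  with x(1) show thesis by (rule that)
qed

lemma nonzero_orthogonal:
  obtains x where "x \<noteq> 0" "form u x = 0" "form v x = 0" "form w x = 0"
  by (rule orthogonal_to_few_vectors[of "{u, v, w}"]) (auto simp: card_insert_if)

lemma unit_multiple:
  assumes "form v v \<noteq> 0"
  obtains c where "form (c *s v) (c *s v) = 1"
proof -
  obtain c where "c ^ 2 = 1 / form v v" using nth_root_exists[of 2 "1 / form v v"] by auto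
  then have "form (c *s v) (c *s v) = 1"
    using assms by (simp add: power2_eq_square field_simps)
  then show thesis by (rule that)
qed

text \<open>
  One of \<open>y\<close>, \<open>z\<close>, \<open>y + z\<close> is nonsingular.
\<close>

lemma unit_vector_exists:
  assumes W: "vec.subspace W" "y \<in> W" "z \<in> W" and yz: "form y z \<noteq> 0"
  obtains u where "u \<in> W" "form u u = 1"
proof -
  have "form (y + z) (y + z) = form y y + form z z + 2 * form y z" by (simp add: form_sym[of z y])
  then have "\<exists>v \<in> W. form v v \<noteq> 0"
    using assms vec.subspace_add[OF W] two_neq_0_K
    by (metis add.right_neutral add_cancel_right_left mult_eq_0_iff)
  then obtain v c where "v \<in> W" "form (c *s v) (c *s v) = 1" using unit_multiple by metis
  with that W(1) vec.subspace_scale show thesis by blast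
qed

lemma form_witness:
  assumes "y \<noteq> 0"
  obtains z where "form y z \<noteq> 0"
  using assms form_nondegenerate by blast

lemma basic_triple_extend:
  assumes i: "form i i = 1"
  obtains j l where "basic_triple i j l"
proof -
  have ex: "\<exists>v. form v v = 1 \<and> form u v = 0 \<and> form w v = 0 \<and> form u' v = 0"
    if u: "form u u = 1 \<or> u = 0" "form w w = 1 \<or> w = 0" "form u' u' = 1 \<or> u' = 0"
      "form u w = 0" "form u u' = 0" "form w u' = 0" for u w u'
  proof -
    obtain y where y: "y \<noteq> 0" "form u y = 0" "form w y = 0" "form u' y = 0" by (rule nonzero_orthogonal)
    obtain z where z: "form y z \<noteq> 0" using y(1) by (rule form_witness)
    define z' where "z' = z - form u z *s u - form w z *s w - form u' z *s u'"
    have "form u z' = 0" "form w z' = 0" "form u' z' = 0"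
      using u by (auto simp: z'_def form_sym[of w u] form_sym[of u' u] form_sym[of u' w])
    moreover have "form y z' = form y z" using y by (simp add: z'_def form_sym[of y u] form_sym[of y w] form_sym[of y u'])
    moreover have "vec.subspace {v. form u v = 0 \<and> form w v = 0 \<and> form u' v = 0}"
      by (auto simp: vec.subspace_def)
    ultimately show ?thesis
      using unit_vector_exists[of "{v. form u v = 0 \<and> form w v = 0 \<and> form u' v = 0}" y z'] y z by auto
  qed
  obtain j where j: "form j j = 1" "form i j = 0" using ex[of i 0 0] i by auto
  obtain l where "form l l = 1" "form i l = 0" "form j l = 0" "form (i \<star> j) l = 0"
    using ex[of i j "i \<star> j"] i j by (auto simp: form_cross_cross)
  then have "basic_triple i j l" using i j by (simp add: basic_triple_def)
  then show thesis by (rule that)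
qed

lemma oct_aut_transitive_nonsingular:
  assumes "form v v = form w w" "form v v \<noteq> 0"
  obtains g where "g \<in> oct_aut" "g *v v = w"
proof -
  obtain c where c: "form (c *s v) (c *s v) = 1" using unit_multiple[OF assms(2)] .
  then have "form (c *s w) (c *s w) = 1" by (simp add: assms(1))
  with c obtain g where g: "g \<in> oct_aut" "g *v (c *s v) = c *s w"
    by (metis basic_triple_extend basic_triple_transitive)
  have "c \<noteq> 0" using c by auto
  with g(2) have "g *v v = w" by (simp add: vector_scalar_commute)
  with g(1) show thesis by (rule that)
qed


section \<open>Elements of order two and four\<close>

lemma eigenspaces_orthogonal:
  assumes "x \<in> oct_aut" "x *v u = u" "x *v w = - w"
  shows "form u w = 0"
proof -
  have "form u w = - form u w" using oct_aut_form[OF assms(1), of u w] assms by simp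
  then have "2 * form u w = 0" by (metis add.right_inverse mult_2)
  then show ?thesis by simp
qed

text \<open>
  The fixed space of an involution is more than the line of \<open>i\<close>: a vector orthogonal to \<open>i\<close>, \<open>l\<close> and
  \<open>i \<star> l\<close> either has a nonzero fixed part, or it is negated, and then multiplication by \<open>l\<close> moves it
  into the fixed space. The form is nondegenerate on the fixed space, which provides a unit vector.
\<close>

lemma involution_complement:
  assumes x: "x \<in> oct_aut" and xx: "\<And>v. x *v (x *v v) = v"
    and i: "x *v i = i" "form i i = 1" and l: "x *v l = - l" "form l l = 1"
  obtains j where "x *v j = j" "basic_triple i j l"
proof -
  have il: "form i l = 0" using x i(1) l(1) by (rule eigenspaces_orthogonal)
  obtain w where w: "w \<noteq> 0" "form i w = 0" "form l w = 0" "form (i \<star> l) w = 0"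
    by (rule nonzero_orthogonal)
  have "\<exists>y. y \<noteq> 0 \<and> x *v y = y \<and> form i y = 0"
  proof (cases "w + x *v w = 0")
    case True
    then have xw: "x *v w = - w" by (simp add: add_eq_0_iff)
    have "l \<star> (l \<star> w) = - w" using w l by (simp add: cross_cross_same)
    then have "l \<star> w \<noteq> 0" using w(1) by auto
    moreover have "x *v (l \<star> w) = l \<star> w" using x l xw by (simp add: oct_aut_cross)
    moreover have "form i (l \<star> w) = 0" using w by (simp flip: form_cross)
    ultimately show ?thesis by blast
  next
    case False
    moreover have "form i (x *v w) = form i w" using oct_aut_form[OF x, of i w] i(1) by simp
    ultimately show ?thesis using w(2) xx
      by (intro exI[of _ "w + x *v w"]) (simp add: matrix_vector_right_distrib add.commute)
  qed
  then obtain y where y: "y \<noteq> 0" "x *v y = y" "form i y = 0" by blast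
  obtain z where z: "form y z \<noteq> 0" using y(1) by (rule form_witness)
  define z' where "z' = (z + x *v z) - form i (z + x *v z) *s i"
  have "x *v z' = z'" "form i z' = 0"
    using i xx by (simp_all add: z'_def matrix_vector_right_distrib vec.diff vector_scalar_commute add.commute)
  moreover have "form y z' = 2 * form y z"
    using y oct_aut_form[OF x, of y z] by (simp add: z'_def form_sym[of y i])
  moreover have "vec.subspace {v. x *v v = v \<and> form i v = 0}"
    by (auto simp: vec.subspace_def matrix_vector_right_distrib vector_scalar_commute)
  ultimately obtain j where j: "x *v j = j" "form i j = 0" "form j j = 1"
    using unit_vector_exists[of "{v. x *v v = v \<and> form i v = 0}" y z'] y z by auto
  have "x *v (i \<star> j) = i \<star> j" using x i(1) j(1) by (simp add: oct_aut_cross)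
  then have "basic_triple i j l"
    using i l il j eigenspaces_orthogonal[OF x _ l(1)] by (simp add: basic_triple_def)
  with j(1) show thesis by (rule that)
qed

lemma involution_minus:
  assumes x: "x \<in> oct_aut" and xx: "\<And>v. x *v (x *v v) = v" and ne: "x \<noteq> mat 1"
  obtains l where "x *v l = - l" "form l l = 1"
proof -
  obtain v where v: "x *v v \<noteq> v" using ne by (auto simp: matrix_vector_eq)
  define y where "y = v - x *v v"
  have y: "y \<noteq> 0" "x *v y = - y" using v xx by (auto simp: y_def vec.diff)
  obtain z where z: "form y z \<noteq> 0" using y(1) by (rule form_witness)
  have "form y (x *v z) = - form y z" using oct_aut_form[OF x, of y z] y(2) by (simp add: minus_equation_iff)
  then have "form y (z - x *v z) \<noteq> 0" using z two_neq_0_K by (simp flip: mult_2)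
  moreover have "z - x *v z \<in> {v. x *v v = - v}" "y \<in> {v. x *v v = - v}"
    using xx y(2) by (simp_all add: vec.diff)
  moreover have "vec.subspace {v. x *v v = - v}"
    by (auto simp: vec.subspace_def matrix_vector_right_distrib vector_scalar_commute)
  ultimately obtain l where "l \<in> {v. x *v v = - v}" "form l l = 1"
    using unit_vector_exists by blast
  then show thesis using that by blast
qed

text \<open>
  If everything were negated, the product of two vectors would have to be both fixed and negated.
\<close>

lemma involution_plus:
  assumes x: "x \<in> oct_aut" and xx: "\<And>v. x *v (x *v v) = v"
  obtains i where "x *v i = i" "form i i = 1"
proof -
  have "\<exists>v. v + x *v v \<noteq> 0"
  proof (rule ccontr)
    assume "\<nexists>v. v + x *v v \<noteq> 0"
    then have m: "x *v v = - v" for v by (metis add_eq_0_iff)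
    have "axis 4 1 \<star> axis 5 1 = - (axis 4 1 \<star> axis 5 1 :: K ^ 7)"
      using oct_aut_cross[OF x, of "axis 4 1" "axis 5 1"] by (simp add: m)
    then have "(axis 4 1 \<star> axis 5 1 :: K ^ 7) $ 5 = - (axis 4 1 \<star> axis 5 1 :: K ^ 7) $ 5"
      by (simp only: vector_uminus_component[symmetric])
    then show False by (simp add: cross_axis axis_nth char_5 eq_neg_iff_add_eq_0)
  qed
  then obtain v where v: "v + x *v v \<noteq> 0" by blast
  define y where "y = v + x *v v"
  have y: "y \<noteq> 0" "x *v y = y" using v xx by (auto simp: y_def matrix_vector_right_distrib add.commute)
  obtain z where z: "form y z \<noteq> 0" using y(1) by (rule form_witness)
  have "form y (x *v z) = form y z" using oct_aut_form[OF x, of y z] y(2) by simp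
  then have "form y (z + x *v z) = 2 * form y z" by simp
  moreover have "x *v (z + x *v z) = z + x *v z" using xx by (simp add: matrix_vector_right_distrib add.commute)
  moreover have "vec.subspace {v. x *v v = v}"
    by (auto simp: vec.subspace_def matrix_vector_right_distrib vector_scalar_commute)
  ultimately show thesis
    using unit_vector_exists[of "{v. x *v v = v}" y "z + x *v z"] y z that by auto
qed

lemma involution_frame:
  assumes "x \<in> oct_aut" "\<And>v. x *v (x *v v) = v" "x \<noteq> mat 1"
  obtains i j l where "basic_triple i j l" "x *v i = i" "x *v j = j" "x *v l = - l"
  using assms by (metis involution_minus involution_plus involution_complement)

text \<open>
  Automorphisms are determined by their values on a basic triple, so two of them with the same action on
  corresponding triples are conjugate.
\<close>

lemma conjugate_of_frames:
  assumes "basic_triple i j l" "basic_triple i' j' l'" and x: "x \<in> oct_aut" "x' \<in> oct_aut"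
    and "\<And>g. g \<in> oct_aut \<Longrightarrow> g *v i = i' \<Longrightarrow> g *v j = j' \<Longrightarrow> g *v l = l' \<Longrightarrow>
      g *v (x *v i) = x' *v i' \<and> g *v (x *v j) = x' *v j' \<and> g *v (x *v l) = x' *v l'"
  obtains g where "g \<in> oct_aut" "g ** x = x' ** g"
proof -
  obtain g where g: "g \<in> oct_aut" "g *v i = i'" "g *v j = j'" "g *v l = l'"
    using basic_triple_transitive[OF assms(1,2)] .
  have "g ** x = x' ** g"
    by (rule basic_triple_ext[OF assms(1)])
       (use assms(5)[OF g] g x in \<open>simp_all add: oct_aut_mult flip: matrix_vector_mul_assoc\<close>)
  with g(1) show thesis by (rule that)
qed

lemma involutions_conjugate:
  assumes "x \<in> oct_aut" "\<And>v. x *v (x *v v) = v" "x \<noteq> mat 1"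
    and "x' \<in> oct_aut" "\<And>v. x' *v (x' *v v) = v" "x' \<noteq> mat 1"
  obtains g where "g \<in> oct_aut" "g ** x = x' ** g"
proof -
  obtain i j l where f: "basic_triple i j l" "x *v i = i" "x *v j = j" "x *v l = - l"
    using involution_frame[OF assms(1-3)] .
  obtain i' j' l' where f': "basic_triple i' j' l'" "x' *v i' = i'" "x' *v j' = j'" "x' *v l' = - l'"
    using involution_frame[OF assms(4-6)] .
  show thesis
    by (rule conjugate_of_frames[OF f(1) f'(1) assms(1,4)])
       (use f f' that in \<open>auto simp: vec.neg\<close>)
qed

text \<open>
  This distinguishes the two classes of elements of order four: it says that \<open>-1\<close> is not an eigenvalue
  of \<open>s\<close>. The eigenvalues are \<open>1\<close> (three times) and \<open>\<plusminus>\<iota>\<close> (twice each) if it holds, and \<open>1\<close> (once), \<open>-1\<close>,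
  \<open>\<iota>\<close> and \<open>-\<iota>\<close> (twice each) otherwise, where \<open>\<iota>\<^sup>2 = -1\<close>.
\<close>

definition fixes_square_fixed :: "K ^ 7 ^ 7 \<Rightarrow> bool"
  where "fixes_square_fixed s \<longleftrightarrow> (\<forall>v. s *v (s *v v) = v \<longrightarrow> s *v v = v)"

text \<open>
  The square of \<open>s\<close> is an involution. If it negates the unit vector \<open>l\<close> then \<open>l\<close> and \<open>s l\<close> are
  orthogonal, their product \<open>i\<close> is fixed by \<open>s\<close>, and \<open>s\<close> acts on \<open>l\<close> as multiplication by \<open>i\<close>. The
  third vector \<open>j\<close> is taken in the eigenspace of \<open>s\<close> for \<open>1\<close> or \<open>-1\<close>, according to the class.
\<close>

lemma order_4_frame:
  assumes s: "s \<in> oct_aut" and s4: "\<And>v. s *v (s *v (s *v (s *v v))) = v" and ne: "s ** s \<noteq> mat 1"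
  obtains i j l where "basic_triple i j l" "s *v i = i" "s *v l = i \<star> l"
    "s *v j = (if fixes_square_fixed s then j else - j)" "s *v (s *v l) = - l"
proof -
  define x where "x = s ** s"
  have xv: "x *v v = s *v (s *v v)" for v by (simp add: x_def flip: matrix_vector_mul_assoc)
  have x: "x \<in> oct_aut" using s by (simp add: x_def oct_aut_mult)
  have xx: "x *v (x *v v) = v" for v by (simp add: xv s4)
  obtain l where l: "x *v l = - l" "form l l = 1"
    using involution_minus[OF x xx] ne unfolding x_def by blast
  have "form l (s *v l) = form (s *v l) (s *v (s *v l))" using oct_aut_form[OF s] by simp
  also have "\<dots> = - form l (s *v l)" using l(1) by (simp add: xv form_sym)
  finally have lsl: "form l (s *v l) = 0" by (simp add: eq_neg_iff_add_eq_0 flip: mult_2)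
  define i where "i = l \<star> (s *v l)"
  have "s *v i = (s *v l) \<star> (s *v (s *v l))" by (simp add: i_def oct_aut_cross s)
  also have "\<dots> = i" using l(1) by (simp add: xv i_def cross_anticomm[of "s *v l" l])
  finally have si: "s *v i = i" .
  have i1: "form i i = 1" by (simp add: i_def form_cross_cross lsl l oct_aut_form s)
  have "i \<star> l = - (l \<star> (l \<star> (s *v l)))" unfolding i_def by (rule cross_anticomm)
  then have sl: "s *v l = i \<star> l" by (simp add: cross_cross_same lsl l)
  have xi: "x *v i = i" by (simp add: xv si)
  have "\<exists>j. basic_triple i j l \<and> s *v j = (if fixes_square_fixed s then j else - j)"
  proof (cases "fixes_square_fixed s")
    case True
    obtain j where "x *v j = j" "basic_triple i j l"
      using involution_complement[OF x xx xi i1 l] .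
    with True show ?thesis by (auto simp: fixes_square_fixed_def xv)
  next
    case False
    then obtain v where v: "s *v (s *v v) = v" "s *v v \<noteq> v" by (auto simp: fixes_square_fixed_def)
    define y where "y = v - s *v v"
    have y: "y \<noteq> 0" "s *v y = - y" using v by (auto simp: y_def vec.diff)
    obtain z where z: "form y z \<noteq> 0" using y(1) by (rule form_witness)
    have ys: "form y (s *v w) = - form y w" for w
      using oct_aut_form[OF s, of y w] y(2) by (simp add: minus_equation_iff)
    \<comment> \<open>Four times the projection of \<open>z\<close> to the eigenspace of \<open>s\<close> for \<open>-1\<close>.\<close>
    define z' where "z' = z - s *v z + s *v (s *v z) - s *v (s *v (s *v z))"
    have "form y z' = 4 * form y z" by (simp add: z'_def ys)
    moreover have "s *v z' = - z'"
      by (simp add: z'_def vec.diff matrix_vector_right_distrib s4)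
    moreover have "vec.subspace {v. s *v v = - v}"
      by (auto simp: vec.subspace_def matrix_vector_right_distrib vector_scalar_commute)
    ultimately obtain j where j: "s *v j = - j" "form j j = 1"
      using unit_vector_exists[of "{v. s *v v = - v}" y z'] y z by auto
    have xj: "x *v j = j" by (simp add: xv j vec.neg)
    have "x *v (i \<star> j) = i \<star> j" by (simp add: oct_aut_cross x xi xj)
    then have "basic_triple i j l"
      using i1 l j eigenspaces_orthogonal[OF x _ l(1)] xi xj eigenspaces_orthogonal[OF s si j(1)]
      by (simp add: basic_triple_def)
    with j(1) False show ?thesis by auto
  qed
  then show thesis using that si sl l(1) xv by metis
qed

lemma order_4_conjugate:
  assumes "s \<in> oct_aut" "\<And>v. s *v (s *v (s *v (s *v v))) = v" "s ** s \<noteq> mat 1"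
    and "s' \<in> oct_aut" "\<And>v. s' *v (s' *v (s' *v (s' *v v))) = v" "s' ** s' \<noteq> mat 1"
    and eq: "fixes_square_fixed s \<longleftrightarrow> fixes_square_fixed s'"
  obtains g where "g \<in> oct_aut" "g ** s = s' ** g"
proof -
  obtain i j l where f: "basic_triple i j l" "s *v i = i" "s *v l = i \<star> l"
    "s *v j = (if fixes_square_fixed s then j else - j)"
    using order_4_frame[OF assms(1-3)] .
  obtain i' j' l' where f': "basic_triple i' j' l'" "s' *v i' = i'" "s' *v l' = i' \<star> l'"
    "s' *v j' = (if fixes_square_fixed s' then j' else - j')"
    using order_4_frame[OF assms(4-6)] .
  show thesis
    by (rule conjugate_of_frames[OF f(1) f'(1) assms(1,4)])
       (use f f' that eq in \<open>auto simp: vec.neg oct_aut_cross\<close>)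
qed

lemma neg_eq_self_K [simp]: "- x = x \<longleftrightarrow> x = 0" "x = - x \<longleftrightarrow> x = 0" for x :: K
proof -
  have "2 * x = 0 \<longleftrightarrow> x = 0" by simp
  then show "- x = x \<longleftrightarrow> x = 0" "x = - x \<longleftrightarrow> x = 0"
    unfolding mult_2 by (metis add.inverse_unique add.right_inverse)+
qed

lemma K_distinct [simp]: "(-1 :: K) \<noteq> 1" "(1 :: K) \<noteq> -1" "(-2 :: K) \<noteq> 1" "(1 :: K) \<noteq> -2"
  "(2 :: K) \<noteq> -1" "(-1 :: K) \<noteq> 2" "(-2 :: K) \<noteq> 2" "(2 :: K) \<noteq> -2"
  "(2 :: K) \<noteq> 1" "(1 :: K) \<noteq> 2"
proof -
  show "(2 :: K) \<noteq> 1" "(1 :: K) \<noteq> 2" by (metis add_cancel_right_right one_add_one zero_neq_one)+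
  show m: "(-1 :: K) \<noteq> 1" "(1 :: K) \<noteq> -1" "(-2 :: K) \<noteq> 2" "(2 :: K) \<noteq> -2"
    using neg_eq_self_K(1)[of 1] neg_eq_self_K(1)[of 2] by simp_all
  have "(-2 :: K) - 1 = 2" by (simp add: char_5)
  then show "(-2 :: K) \<noteq> 1" by (metis diff_self two_neq_0_K)
  then show "(1 :: K) \<noteq> -2" "(2 :: K) \<noteq> -1" "(-1 :: K) \<noteq> 2" by (metis minus_minus)+
qed

section \<open>A common eigenvector\<close>

lemma dim_le_kernel_image:
  fixes A :: "'a::field ^ 'n ^ 'n"
  assumes V: "vec.subspace V"
  shows "vec.dim V \<le> vec.dim {v. A *v v = 0} + vec.dim ((*v) A ` V)"
proof -
  define Ker where "Ker = {v. A *v v = 0}"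
  have Ker: "vec.subspace Ker"
    by (auto simp: Ker_def vec.subspace_def matrix_vector_right_distrib vector_scalar_commute)
  have img: "vec.subspace ((*v) A ` V)" using V by (rule vec.subspace_image)
  obtain g where g: "Vector_Spaces.linear (*s) (*s) g" "\<And>v. v \<in> (*v) A ` V \<Longrightarrow> A *v g v = v"
    using vec.linear_exists_right_inverse_on[OF matrix_vector_mul_linear_gen V, of A] by blast
  interpret g: Vector_Spaces.linear "(*s)" "(*s)" g by (fact g(1))
  define T where "T = g ` (*v) A ` V"
  have T: "vec.subspace T" unfolding T_def using img by (rule g.subspace_image)
  have "V \<subseteq> {x + y | x y. x \<in> T \<and> y \<in> Ker}"
  proof
    fix v assume "v \<in> V"
    then have "A *v (v - g (A *v v)) = 0" using g(2) by (simp add: vec.diff)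
    then have "v = g (A *v v) + (v - g (A *v v)) \<and> g (A *v v) \<in> T \<and> v - g (A *v v) \<in> Ker"
      using \<open>v \<in> V\<close> by (auto simp: T_def Ker_def)
    then show "v \<in> {x + y | x y. x \<in> T \<and> y \<in> Ker}" by blast
  qed
  then have "vec.dim V \<le> vec.dim {x + y | x y. x \<in> T \<and> y \<in> Ker}" by (rule vec.dim_subset)
  also have "\<dots> \<le> vec.dim T + vec.dim Ker"
    using vec.dim_sums_Int[OF T Ker] by linarith
  also have "vec.dim T \<le> vec.dim ((*v) A ` V)"
    unfolding T_def by (rule vec.dim_image_le[OF g(1)])
  finally show ?thesis by (simp add: Ker_def add.commute)
qed

text \<open>
  With a one-dimensional kernel the images of the powers of \<open>N\<close> would drop in dimension by at most one at each
  of the five steps, too slowly to get from 7 to 0.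
\<close>

lemma nilpotent_kernel:
  fixes N :: "K ^ 7 ^ 7"
  assumes "\<And>v. N *v (N *v (N *v (N *v (N *v v)))) = 0"
  shows "2 \<le> vec.dim {v. N *v v = 0}"
proof (rule ccontr)
  assume "\<not> ?thesis"
  then have step: "vec.dim V \<le> 1 + vec.dim ((*v) N ` V)" if "vec.subspace V" for V
    using dim_le_kernel_image[OF that, of N] by linarith
  define R where "R k = ((`) ((*v) N) ^^ k) UNIV" for k
  have sub: "vec.subspace (R k)" for k
    by (induction k) (auto simp: R_def intro: vec.subspace_image)
  have R: "vec.dim (R k) \<le> 1 + vec.dim (R (Suc k))" for k
    using step[OF sub[of k]] by (simp add: R_def)
  have "R 5 = {0}"
    using assms by (auto simp: R_def eval_nat_numeral image_image)
  moreover have "vec.dim (R 0) = 7" by (simp add: R_def vec_dim_card card_cart_basis)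
  ultimately show False
    using R[of 0] R[of 1] R[of 2] R[of 3] R[of 4] by (simp add: eval_nat_numeral)
qed

lemma orthogonal_to_proper_subspace:
  fixes W :: "(K ^ 7) set"
  assumes W: "vec.subspace W" "W \<noteq> UNIV"
  obtains n where "n \<noteq> 0" "\<And>w. w \<in> W \<Longrightarrow> form n w = 0"
proof -
  obtain B where B: "B \<subseteq> W" "vec.independent B" "W \<subseteq> vec.span B" "card B = vec.dim W"
    using vec.basis_exists by blast
  have "vec.span W \<subset> vec.span UNIV"
    using W by (simp add: vec.span_eq_iff[THEN iffD2] psubset_eq)
  then have "vec.dim W < 7" using vec.dim_psubset[of W UNIV] by (simp add: card_cart_basis)
  then obtain n where n: "n \<noteq> 0" "\<And>b. b \<in> B \<Longrightarrow> form b n = 0"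
    using orthogonal_to_few_vectors[of B] B(2,4) vec.finiteI_independent by metis
  have "W \<subseteq> {w. form n w = 0}"
  proof -
    have "vec.span B \<subseteq> {w. form n w = 0}"
      using n(2) by (intro vec.span_minimal) (auto simp: vec.subspace_def form_sym)
    with B(3) show ?thesis by blast
  qed
  with n(1) that show thesis by blast
qed

lemma isometry_surj:
  fixes x :: "K ^ 7 ^ 7"
  assumes "\<And>u v. form (x *v u) (x *v v) = form u v"
  obtains u where "x *v u = v"
proof -
  have "u = 0" if "x *v u = 0" for u
    by (rule form_nondegenerate) (metis assms form_simps(9) that)
  then obtain y where "x ** y = mat 1"
    using matrix_left_invertible_ker[of x] matrix_left_right_inverse[of _ x] by blast
  then have "x *v (y *v v) = v" by (simp add: matrix_vector_mul_assoc)
  then show thesis by (rule that)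
qed

text \<open>
  Scott's lemma for isometries of a space of dimension seven. If there is no common fixed vector, then the
  images of \<open>1 - x\<close> and \<open>1 - y\<close> span \<open>V\<close>, because a vector orthogonal to both is fixed by \<open>x\<close> and \<open>y\<close>.
  Moreover \<open>1 - y\<close> embeds the fixed space of \<open>x y\<close> into the intersection of the two images. Counting
  dimensions contradicts the hypothesis.
\<close>

lemma common_fixed_vector:
  fixes x y :: "K ^ 7 ^ 7"
  assumes x: "\<And>u v. form (x *v u) (x *v v) = form u v"
    and y: "\<And>u v. form (y *v u) (y *v v) = form u v"
    and dims: "vec.dim (range (\<lambda>v. v - x *v v)) + vec.dim (range (\<lambda>v. v - y *v v)) <
      7 + vec.dim {v. x *v (y *v v) = v}"
  shows "\<exists>v. v \<noteq> 0 \<and> x *v v = v \<and> y *v v = v"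
proof (rule ccontr)
  assume no: "\<not> ?thesis"
  have none: "v = 0" if "x *v v = v" "y *v v = v" for v
    using no that by blast
  define Ix where "Ix = range (\<lambda>v. v - x *v v)"
  define Iy where "Iy = range (\<lambda>v. v - y *v v)"
  define Z where "Z = {v. x *v (y *v v) = v}"
  have sub: "vec.subspace (range (\<lambda>v. v - a *v v))" for a :: "K ^ 7 ^ 7"
  proof -
    have "range (\<lambda>v. v - a *v v) = (*v) (mat 1 - a) ` UNIV"
      by (simp add: matrix_vector_mult_diff_rdistrib)
    then show ?thesis by (metis vec.subspace_UNIV vec.subspace_image)
  qed
  have orth: "a *v n = n" if a: "\<And>u v. form (a *v u) (a *v v) = form u v"
    and n: "\<And>v. form n (v - a *v v) = 0" for a n
  proof -
    have "form (a *v n - n) w = 0" for w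
    proof -
      obtain v where "a *v v = w" using isometry_surj[OF a] .
      then show ?thesis using a[of n v] n[of v] by simp
    qed
    then show ?thesis using form_nondegenerate by (metis right_minus_eq)
  qed
  have sum: "{a + b | a b. a \<in> Ix \<and> b \<in> Iy} = UNIV"
  proof (rule ccontr)
    assume "\<not> ?thesis"
    moreover have "vec.subspace {a + b | a b. a \<in> Ix \<and> b \<in> Iy}"
      unfolding Ix_def Iy_def by (intro vec.subspace_sums sub)
    ultimately obtain n where n: "n \<noteq> 0" "\<And>w. w \<in> {a + b | a b. a \<in> Ix \<and> b \<in> Iy} \<Longrightarrow> form n w = 0"
      using orthogonal_to_proper_subspace by blast
    have 0: "0 \<in> Ix" "0 \<in> Iy" using sub vec.subspace_0 unfolding Ix_def Iy_def by blast+
    have "w \<in> {a + b | a b. a \<in> Ix \<and> b \<in> Iy}" if "w \<in> Ix \<or> w \<in> Iy" for w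
      using that 0 by (metis (mono_tags, lifting) add.left_neutral add.right_neutral mem_Collect_eq)
    then have "form n w = 0" if "w \<in> Ix \<or> w \<in> Iy" for w using n(2) that by blast
    then have "form n (v - x *v v) = 0" and "form n (v - y *v v) = 0" for v
      unfolding Ix_def Iy_def by blast+
    then show False using none[of n] orth[OF x, of n] orth[OF y, of n] n(1) by blast
  qed
  have "vec.dim {a + b | a b. a \<in> Ix \<and> b \<in> Iy} + vec.dim (Ix \<inter> Iy) = vec.dim Ix + vec.dim Iy"
    unfolding Ix_def Iy_def by (rule vec.dim_sums_Int[OF sub sub])
  then have dim_Int: "vec.dim (Ix \<inter> Iy) + 7 = vec.dim Ix + vec.dim Iy"
    by (simp add: sum vec_dim_card card_cart_basis)
  have Z: "vec.subspace Z"
    by (auto simp: Z_def vec.subspace_def matrix_vector_right_distrib vector_scalar_commute)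
  have inj: "inj_on ((*v) (mat 1 - y)) (vec.span Z)"
  proof (rule inj_onI)
    fix u v assume uv: "u \<in> vec.span Z" "v \<in> vec.span Z" "(mat 1 - y) *v u = (mat 1 - y) *v v"
    have "u \<in> Z" "v \<in> Z" using uv Z by (simp_all add: vec.span_eq_iff[THEN iffD2])
    then have "x *v (y *v (u - v)) = u - v" by (simp add: Z_def vec.diff)
    moreover have "y *v (u - v) = u - v"
      using uv(3) by (simp add: matrix_vector_mult_diff_rdistrib vec.diff algebra_simps)
    ultimately show "u = v" using none[of "u - v"] by simp
  qed
  have "(*v) (mat 1 - y) ` Z \<subseteq> Ix \<inter> Iy"
  proof
    fix w assume "w \<in> (*v) (mat 1 - y) ` Z"
    then obtain m where m: "x *v (y *v m) = m" "w = m - y *v m"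
      by (auto simp: Z_def matrix_vector_mult_diff_rdistrib)
    have "w = (- (y *v m)) - x *v (- (y *v m))" by (simp add: m vec.neg)
    then have "w \<in> Ix" unfolding Ix_def by (rule range_eqI)
    moreover have "w \<in> Iy" unfolding Iy_def by (rule range_eqI) (fact m(2))
    ultimately show "w \<in> Ix \<inter> Iy" by simp
  qed
  then have "vec.dim ((*v) (mat 1 - y) ` Z) \<le> vec.dim (Ix \<inter> Iy)" by (rule vec.dim_subset)
  moreover have "vec.dim ((*v) (mat 1 - y) ` Z) = vec.dim Z"
    by (rule vec.dim_image_eq[OF matrix_vector_mul_linear_gen inj])
  ultimately show False using dims dim_Int by (simp add: Ix_def Iy_def Z_def)
qed

text \<open>
  Diagonal representatives make the dimensions of eigenspaces visible.
\<close>

definition diag7 :: "K ^ 7 \<Rightarrow> K ^ 7 ^ 7"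
  where "diag7 d = (\<chi> i j. if i = j then d $ i else 0)"

lemma diag7_vec: "(diag7 d *v x) $ i = d $ i * x $ i"
  by (simp add: diag7_def matrix_vector_mult_def if_distrib[of "\<lambda>z. z * _"] cong: if_cong)

definition torus_2 :: "K ^ 7 ^ 7"
  where "torus_2 = diag7 (vec7 (-1) (-1) 1 1 1 (-1) (-1))"

text \<open>
  Here \<open>2\<close> is a square root of \<open>-1\<close> in \<open>K\<close>.
\<close>

definition torus_4 :: "bool \<Rightarrow> K ^ 7 ^ 7"
  where "torus_4 b = diag7 (if b then vec7 2 2 1 1 1 (-2) (-2) else vec7 (-1) 2 2 1 (-2) (-2) (-1))"

lemma torus_oct_aut: "torus_2 \<in> oct_aut" "torus_4 b \<in> oct_aut"
  by (auto intro!: vec7_eqI simp: oct_aut_def torus_2_def torus_4_def diag7_vec cross_def form_def algebra_simps char_5)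

lemma torus_2_square: "torus_2 *v (torus_2 *v v) = v" and torus_2_neq: "torus_2 \<noteq> mat 1"
proof -
  show "torus_2 *v (torus_2 *v v) = v"
    by (rule vec7_eqI; simp add: torus_2_def diag7_vec)
  have "(torus_2 *v axis 1 1) $ 1 \<noteq> (mat 1 *v axis 1 1) $ 1"
    by (simp add: torus_2_def diag7_vec axis_nth)
  then show "torus_2 \<noteq> mat 1" by metis
qed

lemma torus_4_power: "torus_4 b *v (torus_4 b *v (torus_4 b *v (torus_4 b *v v))) = v"
  and torus_4_square: "torus_4 b ** torus_4 b \<noteq> mat 1"
  and torus_4_type: "fixes_square_fixed (torus_4 b) \<longleftrightarrow> b"
proof -
  show "torus_4 b *v (torus_4 b *v (torus_4 b *v (torus_4 b *v v))) = v"
    by (rule vec7_eqI; simp add: torus_4_def diag7_vec char_5)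
  have "((torus_4 b ** torus_4 b) *v axis 6 1) $ 6 \<noteq> (mat 1 *v axis 6 1) $ 6"
    by (simp add: torus_4_def diag7_vec axis_nth char_5 flip: matrix_vector_mul_assoc)
  then show "torus_4 b ** torus_4 b \<noteq> mat 1" by metis
  show "fixes_square_fixed (torus_4 b) \<longleftrightarrow> b"
  proof (cases b)
    case True
    have "torus_4 b *v v = v" if "torus_4 b *v (torus_4 b *v v) = v" for v
    proof -
      have "(torus_4 b *v (torus_4 b *v v)) $ i = v $ i" for i using that by simp
      from this[of 1] this[of 2] this[of 6] this[of 7]
      have "v $ 1 = 0 \<and> v $ 2 = 0 \<and> v $ 6 = 0 \<and> v $ 7 = 0"
        using True by (simp add: torus_4_def diag7_vec char_5)
      then show ?thesis
        using True by (intro vec7_eqI) (simp_all add: torus_4_def diag7_vec)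
    qed
    with True show ?thesis by (simp add: fixes_square_fixed_def)
  next
    case False
    then have "torus_4 b *v axis 1 1 = - axis 1 1"
      by (intro vec7_eqI) (simp_all add: torus_4_def diag7_vec axis_nth)
    moreover have "- axis 1 1 \<noteq> (axis 1 1 :: K ^ 7)"
    proof
      assume "- axis 1 1 = (axis 1 1 :: K ^ 7)"
      from arg_cong[OF this, of "\<lambda>v. v $ 1"] show False by (simp add: axis_nth)
    qed
    ultimately show ?thesis
      using False unfolding fixes_square_fixed_def by (metis minus_minus vec.neg)
  qed
qed

lemma oct_aut_inj: "g \<in> oct_aut \<Longrightarrow> g *v x = g *v y \<Longrightarrow> x = y"
  by (metis oct_aut_inverse)

lemma dim_range_conj:
  assumes g: "g \<in> oct_aut" and eq: "g ** x = y ** g"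
  shows "vec.dim (range (\<lambda>v. v - c *s (y *v v))) = vec.dim (range (\<lambda>v. v - c *s (x *v v)))"
proof -
  obtain h where h: "\<And>v. g *v (h *v v) = v" using oct_aut_inverse[OF g] by metis
  have gx: "g *v (x *v v) = y *v (g *v v)" for v using eq by (simp add: matrix_vector_mul_assoc)
  have "range (\<lambda>v. v - c *s (y *v v)) = (*v) g ` range (\<lambda>v. v - c *s (x *v v))"
  proof (intro equalityI subsetI)
    fix w assume "w \<in> range (\<lambda>v. v - c *s (y *v v))"
    then obtain v where "w = v - c *s (y *v v)" by blast
    then have "w = g *v (h *v v - c *s (x *v (h *v v)))"
      by (simp add: vec.diff vector_scalar_commute gx h)
    then show "w \<in> (*v) g ` range (\<lambda>v. v - c *s (x *v v))" by blast
  next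
    fix w assume "w \<in> (*v) g ` range (\<lambda>v. v - c *s (x *v v))"
    then obtain v where "w = g *v (v - c *s (x *v v))" by blast
    then have "w = g *v v - c *s (y *v (g *v v))" by (simp add: vec.diff vector_scalar_commute gx)
    then show "w \<in> range (\<lambda>v. v - c *s (y *v v))" by blast
  qed
  then show ?thesis
    using vec.dim_image_eq[OF matrix_vector_mul_linear_gen[of g]] oct_aut_inj[OF g]
    by (simp add: inj_on_def)
qed

lemma dim_range_diag: "vec.dim (range (\<lambda>v. v - c *s (diag7 d *v v))) = card {i. c * d $ i \<noteq> 1}"
proof -
  have eq: "range (\<lambda>v. v - c *s (diag7 d *v v)) = {x. \<forall>i. i \<notin> {i. c * d $ i \<noteq> 1} \<longrightarrow> x $ i = 0}"
  proof (intro equalityI subsetI)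
    fix x :: "K ^ 7" assume x: "x \<in> {x. \<forall>i. i \<notin> {i. c * d $ i \<noteq> 1} \<longrightarrow> x $ i = 0}"
    define v where "v = (\<chi> i. if c * d $ i = 1 then 0 else x $ i / (1 - c * d $ i))"
    have "x = v - c *s (diag7 d *v v)"
      using x by (auto simp: vec_eq_iff v_def diag7_vec field_simps)
    then show "x \<in> range (\<lambda>v. v - c *s (diag7 d *v v))" by blast
  qed (auto simp: diag7_vec mult.assoc[symmetric])
  show ?thesis unfolding eq by (rule dim_substandard_cart)
qed

text \<open>
  A pair \<open>t\<close>, \<open>s\<close> of elements of orders 2 and 4 whose product has order dividing 5, with the relations written
  for vectors.
\<close>

definition triple_2_4_5 :: "K ^ 7 ^ 7 \<Rightarrow> K ^ 7 ^ 7 \<Rightarrow> bool"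
  where "triple_2_4_5 t s \<longleftrightarrow> t \<in> oct_aut \<and> s \<in> oct_aut \<and>
    t \<noteq> mat 1 \<and> s ** s \<noteq> mat 1 \<and> (\<forall>v. t *v (t *v v) = v) \<and>
    (\<forall>v. s *v (s *v (s *v (s *v v))) = v) \<and>
    (\<forall>v. ((*v) (t ** s) ^^ 5) v = v)"

lemma involution_conj_torus:
  assumes "x \<in> oct_aut" "\<And>v. x *v (x *v v) = v" "x \<noteq> mat 1"
  obtains g where "g \<in> oct_aut" "g ** x = torus_2 ** g"
  using involutions_conjugate[OF assms torus_oct_aut(1) torus_2_square torus_2_neq] .

lemma order_4_conj_torus:
  assumes "s \<in> oct_aut" "\<And>v. s *v (s *v (s *v (s *v v))) = v" "s ** s \<noteq> mat 1"
  obtains g where "g \<in> oct_aut" "g ** s = torus_4 (fixes_square_fixed s) ** g"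
  by (rule order_4_conjugate[OF assms torus_oct_aut(2) torus_4_power torus_4_square])
     (simp add: torus_4_type, rule that)

text \<open>
  The identity \<open>(z - 1)\<^sup>5 = z\<^sup>5 - 1\<close> of characteristic 5.
\<close>

lemma unipotent_power_5:
  fixes z :: "K ^ 7 ^ 7"
  assumes "\<And>v. ((*v) z ^^ 5) v = v"
  shows "((*v) (z - mat 1) ^^ 5) v = 0"
proof -
  define w1 where "w1 = z *v v"
  define w2 where "w2 = z *v w1"
  define w3 where "w3 = z *v w2"
  define w4 where "w4 = z *v w3"
  have z: "z *v v = w1" "z *v w1 = w2" "z *v w2 = w3" "z *v w3 = w4" "z *v w4 = v"
    using assms[of v] by (simp_all add: w1_def w2_def w3_def w4_def eval_nat_numeral)
  define N where "N = z - mat 1"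
  have N: "N *v a = z *v a - a" for a by (simp add: N_def matrix_vector_mult_diff_rdistrib)
  note r = N vec.diff matrix_vector_right_distrib vector_scalar_commute z
  have "N *v (w1 - v) = w2 - 2 *s w1 + v"
    by (simp only: r) (simp add: vec_eq_iff algebra_simps)
  moreover have "N *v (w2 - 2 *s w1 + v) = w3 - 3 *s w2 + 3 *s w1 - v"
    by (simp only: r) (simp add: vec_eq_iff algebra_simps)
  moreover have "N *v (w3 - 3 *s w2 + 3 *s w1 - v) = w4 - 4 *s w3 + 6 *s w2 - 4 *s w1 + v"
    by (simp only: r) (simp add: vec_eq_iff algebra_simps)
  moreover have "N *v (w4 - 4 *s w3 + 6 *s w2 - 4 *s w1 + v) = 5 *s (w1 - 2 *s w2 + 2 *s w3 - w4)"
    by (simp only: r) (simp add: vec_eq_iff algebra_simps)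
  ultimately have "(((*v) N) ^^ 5) v = 5 *s (w1 - 2 *s w2 + 2 *s w3 - w4)"
    by (simp add: eval_nat_numeral r(1)[of v] z)
  then show ?thesis by (simp add: five_eq_0_K N_def)
qed

text \<open>
  Let \<open>c = 1\<close> if \<open>-1\<close> is not an eigenvalue of \<open>s\<close> and \<open>c = -1\<close> otherwise. The ranks of \<open>1 - c t\<close> and \<open>1 - c s\<close> are
  \<open>4 + 4\<close> in the first case and \<open>3 + 5\<close> in the second, and the fixed space of \<open>t s\<close> has dimension at
  least 2. As \<open>8 < 7 + 2\<close>, Scott's lemma applies to \<open>c t\<close> and \<open>c s\<close>.
\<close>

theorem triple_common_eigenvector:
  assumes "triple_2_4_5 t s"
  obtains v where "v \<noteq> 0" "t *v v = (if fixes_square_fixed s then v else - v)"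
    "s *v v = (if fixes_square_fixed s then v else - v)"
proof -
  have t: "t \<in> oct_aut" "\<And>v. t *v (t *v v) = v" "t \<noteq> mat 1"
    and s: "s \<in> oct_aut" "\<And>v. s *v (s *v (s *v (s *v v))) = v" "s ** s \<noteq> mat 1"
    and z: "\<And>v. ((*v) (t ** s) ^^ 5) v = v"
    using assms by (auto simp: triple_2_4_5_def)
  define c :: K where "c = (if fixes_square_fixed s then 1 else -1)"
  obtain g where g: "g \<in> oct_aut" "g ** t = torus_2 ** g" using involution_conj_torus[OF t] .
  obtain h where h: "h \<in> oct_aut" "h ** s = torus_4 (fixes_square_fixed s) ** h"
    using order_4_conj_torus[OF s] .
  have card_Collect_7: "card {i :: 7. P i} = (\<Sum>i \<in> UNIV. if P i then 1 else 0)" for P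
    by (simp flip: sum.inter_filter)
  have "vec.dim (range (\<lambda>v. v - c *s (t *v v))) =
      card {i. c * vec7 (-1) (-1) 1 1 1 (-1) (-1) $ i \<noteq> 1}"
    using dim_range_conj[OF g, of c] unfolding torus_2_def dim_range_diag by (rule sym)
  then have "vec.dim (range (\<lambda>v. v - c *s (t *v v))) = (if fixes_square_fixed s then 4 else 3)"
    by (cases "fixes_square_fixed s") (simp_all add: card_Collect_7 sum_7 c_def)
  moreover have "vec.dim (range (\<lambda>v. v - c *s (s *v v))) = card {i. c * (if fixes_square_fixed s
      then vec7 2 2 1 1 1 (-2) (-2) else vec7 (-1) 2 2 1 (-2) (-2) (-1)) $ i \<noteq> 1}"
    using dim_range_conj[OF h, of c] unfolding torus_4_def dim_range_diag by (rule sym)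
  then have "vec.dim (range (\<lambda>v. v - c *s (s *v v))) = (if fixes_square_fixed s then 4 else 5)"
    by (cases "fixes_square_fixed s") (simp_all add: card_Collect_7 sum_7 c_def)
  moreover have "2 \<le> vec.dim {v. t *v (s *v v) = v}"
  proof -
    have "2 \<le> vec.dim {v. (t ** s - mat 1) *v v = 0}"
      using unipotent_power_5[OF z] by (intro nilpotent_kernel) (simp add: eval_nat_numeral)
    then show ?thesis by (simp add: matrix_vector_mult_diff_rdistrib flip: matrix_vector_mul_assoc)
  qed
  moreover have cc: "c * c = 1" by (simp add: c_def)
  moreover have ct: "(mat c ** t) *v v = c *s (t *v v)" "(mat c ** s) *v v = c *s (s *v v)" for v
    by (simp_all add: mat_mult_vec)
  ultimately have "\<exists>v. v \<noteq> 0 \<and> (mat c ** t) *v v = v \<and> (mat c ** s) *v v = v"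
    by (intro common_fixed_vector)
       (simp_all add: t(1) s(1) oct_aut_form mult.assoc[symmetric] vector_scalar_commute vector_smult_assoc)
  then obtain v where v: "v \<noteq> 0" "c *s (t *v v) = v" "c *s (s *v v) = v" unfolding ct by blast
  have "t *v v = c *s v" "s *v v = c *s v"
    using arg_cong[OF v(2), of "(*s) c"] arg_cong[OF v(3), of "(*s) c"] cc by (simp_all add: vector_smult_assoc)
  then show thesis using v(1) that by (auto simp: c_def split: if_splits)
qed


section \<open>Conjugation in \<open>G\<^sub>2\<close>\<close>

lemma minus_one_vec: "(g - mat 1) *v v = g *v v - (v :: 'a::comm_ring_1 ^ 'n)"
  by (simp add: matrix_vector_mult_diff_rdistrib)

lemma G2_simps: "x \<otimes>\<^bsub>G2\<^esub> y = x ** y" "\<one>\<^bsub>G2\<^esub> = mat 1"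
  by (simp_all add: G2_def GL_def)

lemma G2_inv: "g \<in> oct_aut \<Longrightarrow> inv\<^bsub>G2\<^esub> g \<in> oct_aut"
  "g \<in> oct_aut \<Longrightarrow> g ** inv\<^bsub>G2\<^esub> g = mat 1" "g \<in> oct_aut \<Longrightarrow> inv\<^bsub>G2\<^esub> g ** g = mat 1"
  using group.inv_closed[OF group_G2, of g] group.r_inv[OF group_G2, of g] group.l_inv[OF group_G2, of g]
  unfolding carrier_G2 G2_simps by blast+

lemma conjugate_G2: "g \<in> oct_aut \<Longrightarrow> y = conjugate G2 g x \<longleftrightarrow> g ** x = y ** g"
proof -
  assume g: "g \<in> oct_aut"
  have "g ** x ** inv\<^bsub>G2\<^esub> g ** g = g ** x" "y ** g ** inv\<^bsub>G2\<^esub> g = y"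
    using G2_inv[OF g] by (simp_all flip: matrix_mul_assoc)
  then show ?thesis unfolding conjugate_def G2_simps by metis
qed

lemma nilpotent_conj:
  assumes "g ** x = y ** g"
  shows "(y - mat 1) *v (g *v v) = g *v ((x - mat 1) *v (v :: 'a::comm_ring_1 ^ 'n))"
proof -
  have "y *v (g *v v) = g *v (x *v v)" using assms by (simp add: matrix_vector_mul_assoc)
  then show ?thesis by (simp add: minus_one_vec matrix_vector_mult_diff_distrib)
qed

lemma oct_aut_surj: "g \<in> oct_aut \<Longrightarrow> \<exists>w. g *v w = v"
  by (metis oct_aut_inverse)

lemma oct_aut_eq_0: "g \<in> oct_aut \<Longrightarrow> g *v x = 0 \<longleftrightarrow> x = 0"
  using oct_aut_inj[of g x 0] by auto

lemma fixes_square_fixed_conj: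
  assumes g: "g \<in> oct_aut" and eq: "g ** s = s' ** g"
  shows "fixes_square_fixed s' \<longleftrightarrow> fixes_square_fixed s"
proof -
  have 1: "s' *v (g *v v) = g *v (s *v v)" for v by (simp add: eq matrix_vector_mul_assoc)
  have "fixes_square_fixed s' \<longleftrightarrow> (\<forall>v. s' *v (s' *v (g *v v)) = g *v v \<longrightarrow> s' *v (g *v v) = g *v v)"
    unfolding fixes_square_fixed_def using oct_aut_surj[OF g] by metis
  then show ?thesis unfolding 1 fixes_square_fixed_def using oct_aut_inj[OF g] by metis
qed

section \<open>The common eigenvector is nonsingular\<close>

text \<open>
  Used to read off the traces of elements of order 2 and 4 from their diagonal representatives.
\<close>

lemma trace_conj:
  assumes "g \<in> oct_aut" "g ** x = y ** g"
  shows "trace x = trace y"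
proof -
  define h where "h = inv\<^bsub>G2\<^esub> g"
  have h: "g ** h = mat 1" "h ** g = mat 1" using assms(1) by (simp_all add: h_def G2_inv)
  have "x = h ** (y ** g)" by (simp add: h matrix_mul_assoc flip: assms(2))
  also have "trace (h ** (y ** g)) = trace ((y ** g) ** h)" by (rule trace_mul_sym)
  also have "(y ** g) ** h = y" by (simp add: h flip: matrix_mul_assoc)
  finally show ?thesis .
qed

lemma trace_involution:
  assumes "x \<in> oct_aut" "\<And>v. x *v (x *v v) = v" "x \<noteq> mat 1"
  shows "trace x = -1"
proof -
  obtain g where "g \<in> oct_aut" "g ** x = torus_2 ** g" using involution_conj_torus[OF assms] .
  then have "trace x = trace torus_2" by (rule trace_conj)
  then show ?thesis by (simp add: trace_def sum_7 torus_2_def diag7_def)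
qed

lemma trace_order_4:
  assumes "s \<in> oct_aut" "\<And>v. s *v (s *v (s *v (s *v v))) = v" "s ** s \<noteq> mat 1"
    "fixes_square_fixed s"
  shows "trace s = 3"
proof -
  obtain g where "g \<in> oct_aut" "g ** s = torus_4 True ** g"
    using order_4_conj_torus[OF assms(1-3)] assms(4) by metis
  then have "trace s = trace (torus_4 True)" by (rule trace_conj)
  then show ?thesis by (simp add: trace_def sum_7 torus_4_def diag7_def)
qed

text \<open>
  The matrix of \<open>x\<close> on the quotient of \<open>{y. e\<^sub>1 \<star> y = 0}\<close>, which is spanned by \<open>e\<^sub>1\<close>, \<open>e\<^sub>2\<close>, \<open>e\<^sub>3\<close>, by the
  invariant line of \<open>e\<^sub>1\<close>. On this two-dimensional section the stabiliser of the line acts through \<open>GL\<^sub>2\<close>.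
\<close>

definition line_block :: "K ^ 7 ^ 7 \<Rightarrow> K \<Rightarrow> K \<Rightarrow> K \<Rightarrow> K \<Rightarrow> K \<Rightarrow> bool"
  where "line_block x \<epsilon> a b c d \<longleftrightarrow> x *v axis 1 1 = \<epsilon> *s axis 1 1 \<and>
    (\<exists>m. x *v axis 2 1 = m *s axis 1 1 + a *s axis 2 1 + c *s axis 3 1) \<and>
    (\<exists>m. x *v axis 3 1 = m *s axis 1 1 + b *s axis 2 1 + d *s axis 3 1)"

text \<open>
  The remaining sections of \<open>V\<close> are determined by this block: \<open>x\<close> acts on \<open>e\<^sub>5\<close>, \<open>e\<^sub>6\<close> modulo the span of \<open>e\<^sub>1, \<dots>, e\<^sub>4\<close>
  through \<open>\<epsilon>\<close> times the block, and on the sections of \<open>e\<^sub>1\<close>, \<open>e\<^sub>4\<close>, \<open>e\<^sub>7\<close> by \<open>\<epsilon>\<close>, \<open>1\<close>, \<open>\<epsilon>\<close>. This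
  gives the formula for the trace.
\<close>

lemma line_block_exists:
  assumes x: "x \<in> oct_aut" and e: "x *v axis 1 1 = \<epsilon> *s axis 1 1" "\<epsilon> * \<epsilon> = 1"
  obtains a b c d where "line_block x \<epsilon> a b c d" "a * d - b * c = \<epsilon>"
    "trace x = 1 + 2 * \<epsilon> + (1 + \<epsilon>) * (a + d)"
proof -
  define M where "M j i = (x *v axis j 1) $ i" for i j
  note c = oct_aut_cross[OF x]
  have \<epsilon>: "\<epsilon> \<noteq> 0" using e(2) by auto
  have t: "axis 1 1 \<star> axis 2 1 = (0 :: K ^ 7)" "axis 1 1 \<star> axis 3 1 = (0 :: K ^ 7)"
    "axis 1 1 \<star> axis 4 1 = (- 2 :: K) *s axis 1 1"
    by (rule vec7_eqI; simp add: cross_def axis_nth)+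
  have e1: "axis 1 1 \<star> y = vec7 (- 2 * y$4) (- 2 * y$5) (- 2 * y$6) (- y$7) 0 0 0" for y :: "K ^ 7"
    by (rule vec7_eqI; simp add: cross_def axis_nth)
  have z: "(x *v axis j 1) $ i = 0" if "j \<in> {2, 3}" "i \<in> {4, 5, 6, 7}" for i j
  proof -
    have "\<epsilon> *s (axis 1 1 \<star> (x *v axis j 1)) = 0"
      using c[of "axis 1 1" "axis j 1"] that t by (auto simp: e)
    then show ?thesis using that(2) \<epsilon> by (auto simp: e1 vec_eq_iff forall_7)
  qed
  have 2: "x *v axis 2 1 = M 2 1 *s axis 1 1 + M 2 2 *s axis 2 1 + M 2 3 *s axis 3 1"
    by (rule vec7_eqI) (simp_all add: M_def z axis_nth)
  have 3: "x *v axis 3 1 = M 3 1 *s axis 1 1 + M 3 2 *s axis 2 1 + M 3 3 *s axis 3 1"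
    by (rule vec7_eqI) (simp_all add: M_def z axis_nth)
  have "(x *v axis 2 1) \<star> (x *v axis 3 1) = (2 * \<epsilon>) *s axis 1 1"
    using c[of "axis 2 1" "axis 3 1"] by (simp add: cross_axis vector_scalar_commute e mult.commute)
  then have "((x *v axis 2 1) \<star> (x *v axis 3 1)) $ 1 = 2 * \<epsilon>" by (simp add: axis_nth)
  then have "2 * (M 2 2 * M 3 3 - M 3 2 * M 2 3) = 2 * \<epsilon>"
    using z by (simp add: cross_def M_def algebra_simps)
  then have det: "M 2 2 * M 3 3 - M 3 2 * M 2 3 = \<epsilon>"
    by (simp only: mult_left_cancel[OF two_neq_0_K])
  have "\<epsilon> *s (axis 1 1 \<star> (x *v axis 7 1)) = - (x *v axis 4 1)"
    using c[of "axis 1 1" "axis 7 1"] by (simp add: cross_axis vec.neg e)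
  then have m4: "\<epsilon> * M 7 7 = M 4 4" by (simp add: e1 vec_eq_iff forall_7 M_def)
  have "\<epsilon> *s (axis 1 1 \<star> (x *v axis 5 1)) = - (2 *s (x *v axis 2 1))"
    "\<epsilon> *s (axis 1 1 \<star> (x *v axis 6 1)) = - (2 *s (x *v axis 3 1))"
    using c[of "axis 1 1" "axis 5 1"] c[of "axis 1 1" "axis 6 1"]
    by (simp_all add: cross_axis vec.neg vector_scalar_commute e)
  then have "2 * (\<epsilon> * M 5 5) = 2 * M 2 2" "2 * (\<epsilon> * M 6 6) = 2 * M 3 3"
    by (simp_all add: e1 vec_eq_iff forall_7 M_def)
  then have m56: "\<epsilon> * M 5 5 = M 2 2" "\<epsilon> * M 6 6 = M 3 3"
    by (simp_all only: mult_left_cancel[OF two_neq_0_K])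
  have "form (x *v axis 1 1) (x *v axis 7 1) = 2" using x by (simp add: oct_aut_form) (simp add: form_def axis_nth)
  then have "2 * (\<epsilon> * M 7 7) = 2 * 1" by (simp add: e) (simp add: form_def axis_nth M_def)
  then have m7: "\<epsilon> * M 7 7 = 1" by (simp only: mult_left_cancel[OF two_neq_0_K])
  have inv: "\<epsilon> * (\<epsilon> * y) = y" for y using e(2) by (simp flip: mult.assoc)
  have "M 7 7 = \<epsilon>" using inv[of "M 7 7"] m7 by simp
  moreover have "M 5 5 = \<epsilon> * M 2 2" "M 6 6 = \<epsilon> * M 3 3"
    using inv[of "M 5 5"] inv[of "M 6 6"] m56 by simp_all
  moreover have "M 1 1 = \<epsilon>" by (simp add: M_def e axis_nth)
  moreover have "x $ i $ i = M i i" for i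
    by (simp add: M_def matrix_vector_mult_def axis_def if_distrib[of "\<lambda>z. _ * z"] cong: if_cong)
  ultimately have "trace x = 1 + 2 * \<epsilon> + (1 + \<epsilon>) * (M 2 2 + M 3 3)"
    using m4 m7 by (simp add: trace_def sum_7 algebra_simps)
  moreover have "line_block x \<epsilon> (M 2 2) (M 3 2) (M 2 3) (M 3 3)"
    using e(1) 2 3 unfolding line_block_def by blast
  ultimately show thesis using det that by blast
qed

lemma line_block_mult:
  assumes "line_block x \<epsilon> a b c d" "line_block y \<delta> a' b' c' d'"
  shows "line_block (x ** y) (\<epsilon> * \<delta>) (a * a' + b * c') (a * b' + b * d') (c * a' + d * c') (c * b' + d * d')"
proof -
  obtain m n m' n' where e: "x *v axis 1 1 = \<epsilon> *s axis 1 1"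
    "x *v axis 2 1 = m *s axis 1 1 + a *s axis 2 1 + c *s axis 3 1"
    "x *v axis 3 1 = n *s axis 1 1 + b *s axis 2 1 + d *s axis 3 1"
    "y *v axis 1 1 = \<delta> *s axis 1 1"
    "y *v axis 2 1 = m' *s axis 1 1 + a' *s axis 2 1 + c' *s axis 3 1"
    "y *v axis 3 1 = n' *s axis 1 1 + b' *s axis 2 1 + d' *s axis 3 1"
    using assms unfolding line_block_def by blast
  have "(x ** y) *v axis 1 1 = (\<epsilon> * \<delta>) *s axis 1 1"
    by (simp add: e vector_scalar_commute vector_smult_assoc mult.commute flip: matrix_vector_mul_assoc)
  moreover have "(x ** y) *v axis 2 1 = (\<epsilon> * m' + m * a' + n * c') *s axis 1 1
      + (a * a' + b * c') *s axis 2 1 + (c * a' + d * c') *s axis 3 1"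
    by (simp add: e vector_scalar_commute matrix_vector_right_distrib flip: matrix_vector_mul_assoc)
       (simp add: vec_eq_iff algebra_simps)
  moreover have "(x ** y) *v axis 3 1 = (\<epsilon> * n' + m * b' + n * d') *s axis 1 1
      + (a * b' + b * d') *s axis 2 1 + (c * b' + d * d') *s axis 3 1"
    by (simp add: e vector_scalar_commute matrix_vector_right_distrib flip: matrix_vector_mul_assoc)
       (simp add: vec_eq_iff algebra_simps)
  ultimately show ?thesis unfolding line_block_def by blast
qed

lemma line_block_unique:
  assumes "line_block x \<epsilon> a b c d" "line_block x \<epsilon>' a' b' c' d'"
  shows "a = a'" "b = b'" "c = c'" "d = d'"
proof -
  have "(x *v axis 2 1) $ 2 = a" "(x *v axis 2 1) $ 3 = c" "(x *v axis 3 1) $ 2 = b" "(x *v axis 3 1) $ 3 = d"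
    if "line_block x \<epsilon> a b c d" for \<epsilon> a b c d
    using that unfolding line_block_def by (auto simp: axis_nth)
  with assms show "a = a'" "b = b'" "c = c'" "d = d'" by metis+
qed

lemma line_block_one: "line_block (mat 1) 1 1 0 0 1"
  by (auto simp: line_block_def)

text \<open>
  The trace is \<open>-1\<close> for every involution, so the block has trace \<open>-2\<close> and determinant one; as its square is
  the identity, it is scalar.
\<close>

lemma line_block_involution:
  assumes x: "x \<in> oct_aut" "\<And>v. x *v (x *v v) = v" "x \<noteq> mat 1" and e: "x *v axis 1 1 = axis 1 1"
  shows "line_block x 1 (-1) 0 0 (-1)"
proof -
  obtain a b c d where B: "line_block x 1 a b c d" and det: "a * d - b * c = 1"
    and tr: "trace x = 1 + 2 * 1 + (1 + 1) * (a + d)"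
  proof -
    have "x *v axis 1 1 = 1 *s axis 1 1" "(1 :: K) * 1 = 1" by (simp_all add: e)
    from line_block_exists[OF x(1) this] show thesis using that by blast
  qed
  have "2 * (a + d + 2) = 0" using tr trace_involution[OF x] by (simp add: char_5 algebra_simps)
  then have "a + d + 2 = 0" unfolding mult_eq_0_iff using two_neq_0_K by blast
  then have tr: "d = - 2 - a" by (simp add: eq_neg_iff_add_eq_0 algebra_simps)
  have "x ** x = mat 1" using x(2) by (simp add: matrix_vector_eq flip: matrix_vector_mul_assoc)
  note sq = line_block_unique[OF line_block_mult[OF B B, unfolded \<open>x ** x = mat 1\<close>] line_block_one]
  have bc: "b * c = a * d - 1" using det by (simp add: algebra_simps)
  have "2 * a = 2 * (-1)" using sq(1) unfolding bc tr by (simp add: algebra_simps eq_neg_iff_add_eq_0)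
  then have a: "a = -1" by (simp only: mult_left_cancel[OF two_neq_0_K])
  then have "d = -1" using tr by simp
  moreover have "b = 0" "c = 0" using sq(2,3) a \<open>d = -1\<close> by simp_all
  ultimately show ?thesis using B a by simp
qed

lemma triple_2_4_5D:
  assumes "triple_2_4_5 t s"
  shows "t \<in> oct_aut" "t *v (t *v v) = v" "t \<noteq> mat 1" "s \<in> oct_aut"
    "s *v (s *v (s *v (s *v v))) = v" "s ** s \<noteq> mat 1" "((*v) (t ** s) ^^ 5) v = v"
  using assms by (simp_all add: triple_2_4_5_def)

lemma triple_2_4_5_conj:
  assumes g: "g \<in> oct_aut" and tri: "triple_2_4_5 t s"
  obtains t' s' where "triple_2_4_5 t' s'" "g ** t = t' ** g" "g ** s = s' ** g"
    "fixes_square_fixed s' \<longleftrightarrow> fixes_square_fixed s"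
proof -
  define h where "h = inv\<^bsub>G2\<^esub> g"
  have h: "h \<in> oct_aut" "g ** h = mat 1" "h ** g = mat 1" using g by (simp_all add: h_def G2_inv)
  have gh: "g *v (h *v v) = v" "h *v (g *v v) = v" for v by (simp_all add: matrix_vector_mul_assoc h)
  define t' where "t' = g ** t ** h"
  define s' where "s' = g ** s ** h"
  have v: "t' *v v = g *v (t *v (h *v v))" "s' *v v = g *v (s *v (h *v v))" for v
    by (simp_all add: t'_def s'_def matrix_vector_mul_assoc matrix_mul_assoc)
  have eq: "g ** t = t' ** g" "g ** s = s' ** g"
    by (simp_all add: matrix_vector_eq v gh flip: matrix_vector_mul_assoc)
  have "t' \<noteq> mat 1"
  proof
    assume "t' = mat 1"
    then have "g *v (t *v v) = g *v v" for v using v(1)[of "g *v v"] by (simp add: gh)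
    then have "t = mat 1" using oct_aut_inj[OF g] by (simp add: matrix_vector_eq)
    then show False using triple_2_4_5D(3)[OF tri] by simp
  qed
  moreover have "s' ** s' \<noteq> mat 1"
  proof
    assume "s' ** s' = mat 1"
    then have "s' *v (s' *v (g *v v)) = g *v v" for v
      by (simp add: matrix_vector_mul_assoc[of s' s' "g *v v"])
    then have "g *v (s *v (s *v v)) = g *v v" for v by (simp add: v gh)
    then have "s ** s = mat 1"
      using oct_aut_inj[OF g] by (simp add: matrix_vector_eq flip: matrix_vector_mul_assoc)
    then show False using triple_2_4_5D(6)[OF tri] by simp
  qed
  moreover have "((*v) (t' ** s') ^^ n) v = g *v (((*v) (t ** s) ^^ n) (h *v v))" for n v
    by (induction n) (simp_all add: gh v flip: matrix_vector_mul_assoc)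
  ultimately have "triple_2_4_5 t' s'"
    using triple_2_4_5D[OF tri] g h(1)
    by (simp add: triple_2_4_5_def v gh) (simp add: t'_def s'_def oct_aut_mult)
  then show thesis using that eq fixes_square_fixed_conj[OF g eq(2)] by blast
qed

text \<open>
  Suppose the eigenvector is \<open>e\<^sub>1\<close>, and consider the blocks of \<open>t\<close>, \<open>s\<close> and \<open>z = t s\<close> on the two-dimensional
  section. Either \<open>t\<close> is the scalar \<open>-1\<close> and \<open>s\<close> has trace zero, or \<open>s\<close> is scalar and \<open>t\<close> has trace
  zero. In both cases the block of \<open>z\<close> has trace 0 and determinant 1, so its square is \<open>-1\<close> and its
  fifth power is itself, whereas \<open>z\<^sup>5 = 1\<close>.
\<close>

theorem common_eigenvector_nonsingular:
  assumes tri: "triple_2_4_5 t s" and v: "v \<noteq> 0"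
    and \<epsilon>: "\<epsilon> = (if fixes_square_fixed s then 1 else -1)"
    and tv: "t *v v = \<epsilon> *s v" and sv: "s *v v = \<epsilon> *s v"
  shows "form v v \<noteq> 0"
proof
  assume "form v v = 0"
  then obtain g where g: "g \<in> oct_aut" "g *v v = axis 1 1"
    using G2_moves_singular[OF v] by (auto simp: G2_moves_def carrier_G2)
  obtain t' s' where tri': "triple_2_4_5 t' s'" and eq: "g ** t = t' ** g" "g ** s = s' ** g"
    and type: "fixes_square_fixed s' \<longleftrightarrow> fixes_square_fixed s"
    using triple_2_4_5_conj[OF g(1) tri] .
  note D = triple_2_4_5D[OF tri']
  have ee: "\<epsilon> * \<epsilon> = 1" by (simp add: \<epsilon>)
  have e: "t' *v axis 1 1 = \<epsilon> *s axis 1 1" "s' *v axis 1 1 = \<epsilon> *s axis 1 1"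
    using arg_cong[OF eq(1), of "\<lambda>A. A *v v"] arg_cong[OF eq(2), of "\<lambda>A. A *v v"]
    by (simp_all add: g(2) tv sv vector_scalar_commute flip: matrix_vector_mul_assoc)
  obtain a b c d where T: "line_block t' \<epsilon> a b c d" and detT: "a * d - b * c = \<epsilon>"
    by (rule line_block_exists[OF D(1) e(1) ee])
  obtain p q r w where S: "line_block s' \<epsilon> p q r w" and detS: "p * w - q * r = \<epsilon>"
    and trS: "trace s' = 1 + 2 * \<epsilon> + (1 + \<epsilon>) * (p + w)"
    by (rule line_block_exists[OF D(4) e(2) ee])
  have "t' ** t' = mat 1" using D(2) by (simp add: matrix_vector_eq flip: matrix_vector_mul_assoc)
  note TT = line_block_unique[OF line_block_mult[OF T T, unfolded \<open>t' ** t' = mat 1\<close>] line_block_one]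
  have "(a * p + b * r) + (c * q + d * w) = 0"
  proof (cases "fixes_square_fixed s")
    case True
    then have 1: "\<epsilon> = 1" by (simp add: \<epsilon>)
    have "line_block t' 1 (-1) 0 0 (-1)"
      using line_block_involution[OF D(1-3)] e(1) by (simp add: 1)
    from line_block_unique[OF T this] have "a = -1" "b = 0" "c = 0" "d = -1" .
    moreover have "trace s' = 3" using trace_order_4[OF D(4-6)] type True by simp
    then have "2 * (p + w) = 2 * 0" using trS by (simp add: 1 algebra_simps)
    then have "p + w = 0" by (simp only: mult_left_cancel[OF two_neq_0_K])
    ultimately show ?thesis by (simp add: add_eq_0_iff)
  next
    case False
    then have 1: "\<epsilon> = -1" by (simp add: \<epsilon>)
    have "s' ** s' \<in> oct_aut" using D(4) by (simp add: oct_aut_mult)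
    moreover have "(s' ** s') *v ((s' ** s') *v v) = v" for v
      using D(5) by (simp flip: matrix_vector_mul_assoc)
    moreover have "(s' ** s') *v axis 1 1 = axis 1 1"
      using e(2) by (simp add: vector_scalar_commute vec.neg 1 flip: matrix_vector_mul_assoc)
    ultimately have "line_block (s' ** s') 1 (-1) 0 0 (-1)" using D(6) by (intro line_block_involution)
    note SS = line_block_unique[OF line_block_mult[OF S S] this]
    have bc: "b * c = a * d + 1" using detT by (simp add: 1 algebra_simps)
    have "a * (a + d) = 0" "b * (a + d) = 0" "c * (a + d) = 0" "d * (a + d) = 0"
      using TT unfolding mult.commute[of c b] bc by (simp_all add: algebra_simps)
    then have ad: "a + d = 0" using detT by (auto simp: 1)
    have qr: "q * r = p * w + 1" using detS by (simp add: 1 algebra_simps)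
    have "q * (p + w) = 0" "r * (p + w) = 0" "p * (p + w) = - 2"
      using SS(1-3) unfolding qr by (simp_all add: algebra_simps eq_neg_iff_add_eq_0)
    then have "p + w \<noteq> 0" by (metis mult_zero_right neg_equal_0_iff_equal two_neq_0_K)
    with \<open>q * (p + w) = 0\<close> \<open>r * (p + w) = 0\<close> have "q = 0" "r = 0" by simp_all
    have "(p + w) * (p - w) = 0" using SS(1,4) \<open>q = 0\<close> by (simp add: algebra_simps)
    then have "p = w" using \<open>p + w \<noteq> 0\<close> by simp
    then show ?thesis using ad \<open>q = 0\<close> \<open>r = 0\<close> by (simp flip: distrib_right)
  qed
  define A B C E where "A = a * p + b * r" and "B = a * q + b * w" and "C = c * p + d * r" and "E = c * q + d * w"
  \<comment> \<open>By Cayley-Hamilton the block of \<open>z\<close> has square \<open>-1\<close>.\<close>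
  have AE: "E = - A" using \<open>(a * p + b * r) + (c * q + d * w) = 0\<close> by (simp add: A_def E_def add_eq_0_iff)
  have "A * E - B * C = (a * d - b * c) * (p * w - q * r)"
    by (simp add: A_def B_def C_def E_def algebra_simps)
  then have "A * E - B * C = 1" by (simp add: detT detS ee)
  moreover have "A * E - B * C = - (A * A + B * C)" by (simp add: AE algebra_simps)
  ultimately have BC: "A * A + B * C = -1" by (metis minus_minus)
  define z where "z = t' ** s'"
  have Z: "line_block z 1 A B C E"
    using line_block_mult[OF T S] by (simp add: ee z_def A_def B_def C_def E_def)
  have ZZ: "line_block (z ** z) 1 (-1) 0 0 (-1)"
    using line_block_mult[OF Z Z] BC by (simp add: AE algebra_simps)
  have "line_block (z ** z ** (z ** z)) 1 1 0 0 1"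
    using line_block_mult[OF ZZ ZZ] by simp
  from line_block_mult[OF this Z] have "line_block (z ** z ** (z ** z) ** z) 1 A B C E" by simp
  moreover have "z ** z ** (z ** z) ** z = mat 1"
    using D(7) by (simp add: matrix_vector_eq z_def[symmetric] eval_nat_numeral flip: matrix_vector_mul_assoc)
  ultimately have "line_block (mat 1) 1 A B C E" by simp
  from line_block_unique[OF this line_block_one] have "A = 1" "E = 1" by simp_all
  with AE show False by simp
qed

text \<open>
  The group is transitive on the vectors of a given nonzero norm, so the common eigenvector can be moved to
  \<open>e\<^sub>4\<close>, which has norm \<open>-4\<close>.
\<close>

theorem triple_normal_form:
  assumes tri: "triple_2_4_5 t s"
  obtains g t' s' where "g \<in> oct_aut" "g ** t = t' ** g" "g ** s = s' ** g" "triple_2_4_5 t' s'"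
    "fixes_square_fixed s' \<longleftrightarrow> fixes_square_fixed s"
    "t' *v axis 4 1 = (if fixes_square_fixed s then axis 4 1 else - axis 4 1)"
    "s' *v axis 4 1 = (if fixes_square_fixed s then axis 4 1 else - axis 4 1)"
proof -
  define \<epsilon> :: K where "\<epsilon> = (if fixes_square_fixed s then 1 else -1)"
  obtain v where "v \<noteq> 0" "t *v v = (if fixes_square_fixed s then v else - v)"
    "s *v v = (if fixes_square_fixed s then v else - v)"
    by (rule triple_common_eigenvector[OF tri])
  then have v: "v \<noteq> 0" "t *v v = \<epsilon> *s v" "s *v v = \<epsilon> *s v" by (simp_all add: \<epsilon>_def)
  have "form v v \<noteq> 0" by (rule common_eigenvector_nonsingular[OF tri v(1) \<epsilon>_def v(2,3)])
  then obtain c where c: "form (c *s v) (c *s v) = 1" by (rule unit_multiple)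
  obtain i :: K where i: "i ^ 2 = -4" using nth_root_exists[of 2 "-4 :: K"] by auto
  define w where "w = (i * c) *s v"
  have "form w w = (i * i) * form (c *s v) (c *s v)" by (simp add: w_def algebra_simps)
  then have "form w w = -4" using i c by (simp add: power2_eq_square)
  then have "form w w = form (axis 4 1) (axis 4 1)" "form w w \<noteq> 0" by (simp_all add: form_def axis_nth)
  then obtain g where g: "g \<in> oct_aut" "g *v w = axis 4 1" by (rule oct_aut_transitive_nonsingular)
  obtain t' s' where tri': "triple_2_4_5 t' s'" and eq: "g ** t = t' ** g" "g ** s = s' ** g"
    and type: "fixes_square_fixed s' \<longleftrightarrow> fixes_square_fixed s"
    using triple_2_4_5_conj[OF g(1) tri] .
  have "t *v w = \<epsilon> *s w" "s *v w = \<epsilon> *s w"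
    using v(2,3) by (simp_all add: w_def vector_scalar_commute vector_smult_assoc mult.commute)
  then have "t' *v axis 4 1 = \<epsilon> *s axis 4 1" "s' *v axis 4 1 = \<epsilon> *s axis 4 1"
    using arg_cong[OF eq(1), of "\<lambda>A. A *v w"] arg_cong[OF eq(2), of "\<lambda>A. A *v w"]
    by (simp_all add: g(2) vector_scalar_commute flip: matrix_vector_mul_assoc)
  then show thesis using that g(1) eq tri' type by (auto simp: \<epsilon>_def)
qed

section \<open>The subgroup fixing a nonsingular vector\<close>

text \<open>
  Multiplication by \<open>e\<^sub>4\<close> has square 4 on the orthogonal complement of \<open>e\<^sub>4\<close>; the eigenspaces for \<open>2\<close> and \<open>-2\<close>
  are totally singular, dual to each other, and spanned by \<open>e\<^sub>1, e\<^sub>5, e\<^sub>6\<close> and \<open>e\<^sub>2, e\<^sub>3, e\<^sub>7\<close>.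
\<close>

definition plus_space :: "(K ^ 7) set"
  where "plus_space = {x. axis 4 1 \<star> x = 2 *s x}"

definition minus_space :: "(K ^ 7) set"
  where "minus_space = {x. axis 4 1 \<star> x = (- 2) *s x}"

lemma plus_space_iff: "x \<in> plus_space \<longleftrightarrow> x$2 = 0 \<and> x$3 = 0 \<and> x$4 = 0 \<and> x$7 = 0"
  by (auto simp: plus_space_def vec_eq_iff forall_7 cross_def axis_nth char_5 minus_equation_iff)

lemma minus_space_iff: "x \<in> minus_space \<longleftrightarrow> x$1 = 0 \<and> x$4 = 0 \<and> x$5 = 0 \<and> x$6 = 0"
  by (auto simp: minus_space_def vec_eq_iff forall_7 cross_def axis_nth char_5 minus_equation_iff)

lemma plus_minus_closed:
  "x \<in> plus_space \<Longrightarrow> y \<in> plus_space \<Longrightarrow> x + y \<in> plus_space"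
  "x \<in> plus_space \<Longrightarrow> y \<in> plus_space \<Longrightarrow> x - y \<in> plus_space"
  "x \<in> plus_space \<Longrightarrow> c *s x \<in> plus_space" "x \<in> plus_space \<Longrightarrow> - x \<in> plus_space"
  "x \<in> minus_space \<Longrightarrow> y \<in> minus_space \<Longrightarrow> x + y \<in> minus_space"
  "x \<in> minus_space \<Longrightarrow> y \<in> minus_space \<Longrightarrow> x - y \<in> minus_space"
  "x \<in> minus_space \<Longrightarrow> c *s x \<in> minus_space" "x \<in> minus_space \<Longrightarrow> - x \<in> minus_space"
  "0 \<in> plus_space" "0 \<in> minus_space"
  by (simp_all add: plus_space_iff minus_space_iff)

lemma cross_plus_minus:
  "x \<in> plus_space \<Longrightarrow> y \<in> plus_space \<Longrightarrow> x \<star> y \<in> minus_space"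
  "x \<in> minus_space \<Longrightarrow> y \<in> minus_space \<Longrightarrow> x \<star> y \<in> plus_space"
  by (simp_all add: plus_space_iff minus_space_iff cross_def)

lemma form_plus_minus:
  "x \<in> plus_space \<Longrightarrow> y \<in> plus_space \<Longrightarrow> form x y = 0"
  "x \<in> minus_space \<Longrightarrow> y \<in> minus_space \<Longrightarrow> form x y = 0"
  "x \<in> plus_space \<Longrightarrow> form (axis 4 1) x = 0" "x \<in> minus_space \<Longrightarrow> form (axis 4 1) x = 0"
  "x \<in> plus_space \<Longrightarrow> form x (axis 4 1) = 0" "x \<in> minus_space \<Longrightarrow> form x (axis 4 1) = 0"
  by (simp_all add: plus_space_iff minus_space_iff form_def axis_nth)

lemma cross_minus_plus:
  "p \<in> minus_space \<Longrightarrow> a \<in> plus_space \<Longrightarrow> p \<star> a = (- 2 * form p a) *s axis 4 1"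
  by (rule vec7_eqI; simp add: plus_space_iff minus_space_iff cross_def form_def axis_nth algebra_simps char_5)

lemma form_cross_rotate: "form (y \<star> z) x = form (x \<star> y) z"
  and form_cross_swap: "form (y \<star> x) z = - form (x \<star> y) z"
  by (simp_all add: cross_def form_def algebra_simps)

lemma cross_of_crosses:
  "p \<in> minus_space \<Longrightarrow> q \<in> minus_space \<Longrightarrow> r \<in> minus_space \<Longrightarrow>
    (p \<star> q) \<star> (p \<star> r) = (2 * form (p \<star> q) r) *s p"
  by (rule vec7_eqI; simp add: minus_space_iff cross_def form_def algebra_simps)

text \<open>
  Cramer's rule in the three-dimensional minus space, on which \<open>form (x \<star> y) z\<close> is a volume form.
\<close>

lemma minus_cramer:
  "a \<in> minus_space \<Longrightarrow> b \<in> minus_space \<Longrightarrow> c \<in> minus_space \<Longrightarrow> d \<in> minus_space \<Longrightarrow>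
    form (b \<star> c) d *s a - form (a \<star> c) d *s b + form (a \<star> b) d *s c - form (a \<star> b) c *s d = 0"
  by (rule vec7_eqI; simp add: minus_space_iff cross_def form_def algebra_simps)

lemma cross_cross_minus:
  "a \<in> minus_space \<Longrightarrow> b \<in> minus_space \<Longrightarrow> w \<in> plus_space \<Longrightarrow>
    (a \<star> b) \<star> w = (2 * form a w) *s b - (2 * form b w) *s a"
  by (rule vec7_eqI; simp add: plus_space_iff minus_space_iff cross_def form_def algebra_simps)

lemma form_pairing:
  "p \<in> minus_space \<Longrightarrow> p \<noteq> 0 \<Longrightarrow> \<exists>x \<in> plus_space. form p x \<noteq> 0"
  "x \<in> plus_space \<Longrightarrow> x \<noteq> 0 \<Longrightarrow> \<exists>p \<in> minus_space. form x p \<noteq> 0"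
proof -
  show "\<exists>x \<in> plus_space. form p x \<noteq> 0" if "p \<in> minus_space" "p \<noteq> 0"
  proof (rule ccontr)
    assume *: "\<not> ?thesis"
    have "axis 1 1 \<in> plus_space" "axis 5 1 \<in> plus_space" "axis 6 1 \<in> plus_space"
      by (simp_all add: plus_space_iff axis_nth)
    then have "form p (axis 1 1) = 0" "form p (axis 5 1) = 0" "form p (axis 6 1) = 0" using * by blast+
    then have "p = 0" using that(1) by (intro vec7_eqI) (simp_all add: form_def axis_nth minus_space_iff)
    with that(2) show False by simp
  qed
  show "\<exists>p \<in> minus_space. form x p \<noteq> 0" if "x \<in> plus_space" "x \<noteq> 0"
  proof (rule ccontr)
    assume *: "\<not> ?thesis"
    have "axis 2 1 \<in> minus_space" "axis 3 1 \<in> minus_space" "axis 7 1 \<in> minus_space"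
      by (simp_all add: minus_space_iff axis_nth)
    then have "form x (axis 2 1) = 0" "form x (axis 3 1) = 0" "form x (axis 7 1) = 0" using * by blast+
    then have "x = 0" using that(1) by (intro vec7_eqI) (simp_all add: form_def axis_nth plus_space_iff)
    with that(2) show False by simp
  qed
qed

lemma minus_dependent:
  assumes m: "a \<in> minus_space" "b \<in> minus_space" "c \<in> minus_space" and det: "form (a \<star> b) c = 0"
  obtains x y z where "x *s a + y *s b + z *s c = 0" "x \<noteq> 0 \<or> y \<noteq> 0 \<or> z \<noteq> 0"
proof (cases "a \<star> b = 0")
  case True
  show thesis
  proof (cases "a = 0")
    case True
    then show thesis using that[of 1 0 0] by simp
  next
    case False
    then obtain w where w: "w \<in> plus_space" "form a w \<noteq> 0" using form_pairing(1) m(1) by blast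
    have "(2 * form a w) *s b - (2 * form b w) *s a = 0"
      using cross_cross_minus[OF m(1,2) w(1)] True by simp
    then have "(- (2 * form b w)) *s a + (2 * form a w) *s b + 0 *s c = 0"
      by (simp add: vec_eq_iff algebra_simps)
    then show thesis by (rule that) (use w(2) in simp)
  qed
next
  case False
  then obtain d where d: "d \<in> minus_space" "form (a \<star> b) d \<noteq> 0"
    using form_pairing(2) cross_plus_minus(2) m by blast
  have "form (b \<star> c) d *s a + (- form (a \<star> c) d) *s b + form (a \<star> b) d *s c = 0"
    using minus_cramer[OF m d(1)] det by (simp add: vec_eq_iff algebra_simps)
  then show thesis by (rule that) (use d(2) in simp)
qed

text \<open>
  The element that fixes \<open>e\<^sub>4\<close> and sends \<open>e\<^sub>2, e\<^sub>3, e\<^sub>7\<close> to \<open>p, q, r\<close>. The other three columns are forced,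
  since \<open>e\<^sub>1\<close>, \<open>e\<^sub>5\<close>, \<open>e\<^sub>6\<close> are multiples of products of two of \<open>e\<^sub>2, e\<^sub>3, e\<^sub>7\<close>.
\<close>

definition SL3_matrix :: "K ^ 7 \<Rightarrow> K ^ 7 \<Rightarrow> K ^ 7 \<Rightarrow> K ^ 7 ^ 7"
  where "SL3_matrix p q r = transpose (vec7 ((- 2) *s (p \<star> q)) p q (axis 4 1)
    (2 *s (p \<star> r)) (2 *s (q \<star> r)) r)"

lemma SL3_matrix_vec: "SL3_matrix p q r *v x = x$1 *s ((- 2) *s (p \<star> q)) + x$2 *s p + x$3 *s q
    + x$4 *s axis 4 1 + x$5 *s (2 *s (p \<star> r)) + x$6 *s (2 *s (q \<star> r)) + x$7 *s r"
  by (simp add: vec_eq_iff SL3_matrix_def matrix_vector_mult_def transpose_def sum_7 mult.commute)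

text \<open>
  The condition on the volume of \<open>p, q, r\<close> says that the corresponding linear map has determinant one, because
  \<open>e\<^sub>2, e\<^sub>3, e\<^sub>7\<close> have volume 4.
\<close>

lemma SL3_matrix_oct_aut:
  assumes m: "p \<in> minus_space" "q \<in> minus_space" "r \<in> minus_space" and det: "form (p \<star> q) r = 4"
  shows "SL3_matrix p q r \<in> oct_aut"
proof -
  define A1 where "A1 = (- 2) *s (p \<star> q)"
  define A5 where "A5 = 2 *s (p \<star> r)"
  define A6 where "A6 = 2 *s (q \<star> r)"
  have A: "A1 \<in> plus_space" "A5 \<in> plus_space" "A6 \<in> plus_space"
    using m by (simp_all add: A1_def A5_def A6_def plus_minus_closed cross_plus_minus)
  have "form (q \<star> r) p = 4" "form (p \<star> r) q = - 4"
    using det form_cross_rotate[of q r p] form_cross_rotate[of r p q] form_cross_swap[of p r q] by simp_all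
  then have det': "form (q \<star> r) p = 4" "form (p \<star> r) q = - 4" "form p (q \<star> r) = 4" "form q (p \<star> r) = - 4"
    "form r (p \<star> q) = 4" "form (q \<star> p) r = - 4" "form (r \<star> p) q = 4"
    using det form_sym[of p "q \<star> r"] form_sym[of q "p \<star> r"] form_sym[of r "p \<star> q"]
      form_cross_swap[of q p r] form_cross_swap[of r p q] by simp_all
  have f: "form A1 r = 2" "form r A1 = 2" "form A5 q = 2" "form q A5 = 2" "form A6 p = - 2" "form p A6 = - 2"
    "form A1 p = 0" "form p A1 = 0" "form A1 q = 0" "form q A1 = 0" "form A5 p = 0" "form p A5 = 0"
    "form A5 r = 0" "form r A5 = 0" "form A6 q = 0" "form q A6 = 0" "form A6 r = 0" "form r A6 = 0"
    by (simp_all add: A1_def A5_def A6_def det det' char_5)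
  have f0: "form u v = 0" if "u \<in> {A1, A5, A6} \<and> v \<in> {A1, A5, A6} \<or> u \<in> {p, q, r} \<and> v \<in> {p, q, r} \<or>
      u = axis 4 1 \<and> v \<in> {A1, A5, A6, p, q, r} \<or> v = axis 4 1 \<and> u \<in> {A1, A5, A6, p, q, r}" for u v
    using that A m form_plus_minus by auto
  have E: "form (axis 4 1) (axis 4 1) = - 4" by (simp add: form_def axis_nth)
  have SL: "SL3_matrix p q r *v x = x$1 *s A1 + x$2 *s p + x$3 *s q + x$4 *s axis 4 1 + x$5 *s A5
      + x$6 *s A6 + x$7 *s r" for x
    by (simp add: SL3_matrix_vec A1_def A5_def A6_def)
  have t1: "p \<star> q = 2 *s A1" "p \<star> r = (- 2) *s A5" "q \<star> r = (- 2) *s A6"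
    by (simp_all add: A1_def A5_def A6_def char_5)
  have t2: "A1 \<star> A5 = (- 2) *s p" "A1 \<star> A6 = (- 2) *s q" "A5 \<star> A6 = 2 *s r"
  proof -
    have "(p \<star> q) \<star> (q \<star> r) = - ((q \<star> p) \<star> (q \<star> r))" by (simp add: cross_anticomm[of p q])
    moreover have "(p \<star> r) \<star> (q \<star> r) = (r \<star> p) \<star> (r \<star> q)"
      by (simp add: cross_anticomm[of p r] cross_anticomm[of q r])
    ultimately show "A1 \<star> A5 = (- 2) *s p" "A1 \<star> A6 = (- 2) *s q" "A5 \<star> A6 = 2 *s r"
      by (simp_all add: A1_def A5_def A6_def cross_of_crosses m det det' char_5)
  qed
  have t3: "axis 4 1 \<star> A1 = 2 *s A1" "axis 4 1 \<star> A5 = 2 *s A5" "axis 4 1 \<star> A6 = 2 *s A6"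
    "axis 4 1 \<star> p = (- 2) *s p" "axis 4 1 \<star> q = (- 2) *s q" "axis 4 1 \<star> r = (- 2) *s r"
    using A m by (simp_all add: plus_space_def minus_space_def)
  have t4: "p \<star> A1 = 0" "p \<star> A5 = 0" "p \<star> A6 = - axis 4 1" "q \<star> A1 = 0" "q \<star> A5 = axis 4 1"
    "q \<star> A6 = 0" "r \<star> A1 = axis 4 1" "r \<star> A5 = 0" "r \<star> A6 = 0"
    using A m by (simp_all add: cross_minus_plus f char_5)
  note t = t1 t2 t3 t4
  note swap = cross_anticomm[of q p] cross_anticomm[of r p] cross_anticomm[of r q] cross_anticomm[of A5 A1]
    cross_anticomm[of A6 A1] cross_anticomm[of A6 A5] cross_anticomm[of _ "axis 4 1"]
    cross_anticomm[of A1] cross_anticomm[of A5 p] cross_anticomm[of A5 q] cross_anticomm[of A5 r]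
    cross_anticomm[of A6 p] cross_anticomm[of A6 q] cross_anticomm[of A6 r]
  show ?thesis
    unfolding oct_aut_def
  proof (intro CollectI conjI allI)
    fix x y
    show "form (SL3_matrix p q r *v x) (SL3_matrix p q r *v y) = form x y"
      unfolding SL by (simp add: f f0 E) (simp add: form_def algebra_simps)
    have s: "q \<star> p = (- 2) *s A1" "r \<star> p = 2 *s A5" "r \<star> q = 2 *s A6" "A5 \<star> A1 = 2 *s p" "A6 \<star> A1 = 2 *s q"
      "A6 \<star> A5 = (- 2) *s r" "A1 \<star> axis 4 1 = (- 2) *s A1" "A5 \<star> axis 4 1 = (- 2) *s A5"
      "A6 \<star> axis 4 1 = (- 2) *s A6" "p \<star> axis 4 1 = 2 *s p" "q \<star> axis 4 1 = 2 *s q" "r \<star> axis 4 1 = 2 *s r"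
      "A1 \<star> p = 0" "A5 \<star> p = 0" "A6 \<star> p = axis 4 1" "A1 \<star> q = 0" "A5 \<star> q = - axis 4 1" "A6 \<star> q = 0"
      "A1 \<star> r = - axis 4 1" "A5 \<star> r = 0" "A6 \<star> r = 0"
      using t[THEN arg_cong[of _ _ uminus], unfolded cross_anticomm[symmetric]] by simp_all
    show "SL3_matrix p q r *v (x \<star> y) = (SL3_matrix p q r *v x) \<star> (SL3_matrix p q r *v y)"
      unfolding SL by (simp add: t s) (simp add: vec_eq_iff cross_def algebra_simps)
  qed
qed

lemma SL3_matrix_axis:
  "SL3_matrix p q r *v axis 4 1 = axis 4 1" "SL3_matrix p q r *v axis 2 1 = p"
  "SL3_matrix p q r *v axis 3 1 = q" "SL3_matrix p q r *v axis 7 1 = r"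
  by (simp_all add: SL3_matrix_vec axis_nth)

lemma SL3_transitive:
  assumes m: "p \<in> minus_space" "q \<in> minus_space" "r \<in> minus_space"
    "p' \<in> minus_space" "q' \<in> minus_space" "r' \<in> minus_space"
    and det: "form (p \<star> q) r = form (p' \<star> q') r'" "form (p \<star> q) r \<noteq> 0"
  obtains g where "g \<in> oct_aut" "g *v axis 4 1 = axis 4 1" "g *v p = p'" "g *v q = q'" "g *v r = r'"
proof -
  define c where "c = 4 / form (p \<star> q) r"
  have c: "c \<noteq> 0" using det(2) by (simp add: c_def)
  define M where "M = SL3_matrix (c *s p) q r"
  define M' where "M' = SL3_matrix (c *s p') q' r'"
  have M: "M \<in> oct_aut" "M' \<in> oct_aut"
    unfolding M_def M'_def using det m
    by (intro SL3_matrix_oct_aut plus_minus_closed; simp add: c_def)+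
  define h where "h = inv\<^bsub>G2\<^esub> M"
  have h: "h \<in> oct_aut" "h *v (M *v v) = v" for v
    using M(1) by (simp_all add: h_def G2_inv matrix_vector_mul_assoc)
  have "h *v axis 4 1 = axis 4 1" "h *v (c *s p) = axis 2 1" "h *v q = axis 3 1" "h *v r = axis 7 1"
    using h(2)[of "axis 4 1"] h(2)[of "axis 2 1"] h(2)[of "axis 3 1"] h(2)[of "axis 7 1"]
    by (simp_all only: M_def SL3_matrix_axis)
  then have *: "(M' ** h) *v axis 4 1 = axis 4 1" "(M' ** h) *v (c *s p) = c *s p'" "(M' ** h) *v q = q'"
    "(M' ** h) *v r = r'"
    by (simp_all only: matrix_vector_mul_assoc[symmetric] M'_def SL3_matrix_axis)
  have "(M' ** h) *v p = p'" using *(2) c by (simp add: vector_scalar_commute)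
  with * M h show thesis by (intro that[of "M' ** h"] oct_aut_mult)
qed

text \<open>
  The minus space generates \<open>V\<close> under the product.
\<close>

lemma oct_aut_ext_minus:
  assumes A: "A \<in> oct_aut" and B: "B \<in> oct_aut" and m: "p \<in> minus_space" "q \<in> minus_space" "r \<in> minus_space"
    and det: "form (p \<star> q) r \<noteq> 0" and eq: "A *v p = B *v p" "A *v q = B *v q" "A *v r = B *v r"
  shows "A = B"
proof -
  define c where "c = 4 / form (p \<star> q) r"
  have c: "c \<noteq> 0" using det by (simp add: c_def)
  define M where "M = SL3_matrix (c *s p) q r"
  have M: "M \<in> oct_aut"
    unfolding M_def using det m by (intro SL3_matrix_oct_aut plus_minus_closed; simp add: c_def)
  have 237: "A *v (M *v axis i 1) = B *v (M *v axis i 1)" if "i \<in> {2, 3, 7}" for i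
    using that eq by (auto simp: M_def SL3_matrix_axis vector_scalar_commute)
  have AM: "A ** M \<in> oct_aut" "B ** M \<in> oct_aut" using A B M by (simp_all add: oct_aut_mult)
  have "(A ** M) *v axis i 1 = (B ** M) *v axis i 1" for i
  proof -
    have c: "(A ** M) *v (x \<star> y) = (B ** M) *v (x \<star> y)"
      if "(A ** M) *v x = (B ** M) *v x" "(A ** M) *v y = (B ** M) *v y" for x y
      using that by (simp add: oct_aut_cross AM)
    have s: "C *v axis 1 1 = (- 2) *s (C *v (axis 2 1 \<star> axis 3 1))" "C *v axis 6 1 = 2 *s (C *v (axis 3 1 \<star> axis 7 1))"
      "C *v axis 5 1 = 2 *s (C *v (axis 2 1 \<star> axis 7 1))" "C *v axis 4 1 = - (C *v (axis 1 1 \<star> axis 7 1))"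
      for C :: "K ^ 7 ^ 7"
      by (simp_all add: cross_axis vector_scalar_commute vec.neg char_5)
    have "(A ** M) *v axis 2 1 = (B ** M) *v axis 2 1" "(A ** M) *v axis 3 1 = (B ** M) *v axis 3 1"
      "(A ** M) *v axis 7 1 = (B ** M) *v axis 7 1"
      using 237 by (simp_all flip: matrix_vector_mul_assoc)
    note 0 = this
    have 1: "(A ** M) *v axis 1 1 = (B ** M) *v axis 1 1" "(A ** M) *v axis 5 1 = (B ** M) *v axis 5 1"
      "(A ** M) *v axis 6 1 = (B ** M) *v axis 6 1"
      unfolding s using c[OF 0(1,2)] c[OF 0(1,3)] c[OF 0(2,3)] by simp_all
    have "(A ** M) *v axis 4 1 = (B ** M) *v axis 4 1"
      unfolding s using c[OF 1(1) 0(3)] by simp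
    with 0 1 show ?thesis using forall_7[of "\<lambda>i. (A ** M) *v axis i 1 = (B ** M) *v axis i 1"] by blast
  qed
  then have "A ** M = B ** M" by (rule matrix_eq_on_axes)
  then have "A ** (M ** inv\<^bsub>G2\<^esub> M) = B ** (M ** inv\<^bsub>G2\<^esub> M)" by (simp add: matrix_mul_assoc)
  then show ?thesis by (simp add: G2_inv M)
qed

lemma fixes_axis_4:
  assumes "g \<in> oct_aut" "g *v axis 4 1 = axis 4 1"
  shows "x \<in> plus_space \<Longrightarrow> g *v x \<in> plus_space" "x \<in> minus_space \<Longrightarrow> g *v x \<in> minus_space"
  using oct_aut_cross[OF assms(1), of "axis 4 1" x] assms(2)
  by (simp_all add: plus_space_def minus_space_def vector_scalar_commute vec.neg)

lemma negates_axis_4: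
  assumes "g \<in> oct_aut" "g *v axis 4 1 = - axis 4 1"
  shows "x \<in> plus_space \<Longrightarrow> g *v x \<in> minus_space" "x \<in> minus_space \<Longrightarrow> g *v x \<in> plus_space"
  using oct_aut_cross[OF assms(1), of "axis 4 1" x] assms(2)
  by (simp_all add: plus_space_def minus_space_def vector_scalar_commute vec.neg minus_equation_iff)

lemma plus_minus_decompose:
  obtains p m c where "p \<in> plus_space" "m \<in> minus_space" "x = p + m + c *s axis 4 1"
proof
  show "vec7 (x$1) 0 0 0 (x$5) (x$6) 0 \<in> plus_space" by (simp add: plus_space_iff)
  show "vec7 0 (x$2) (x$3) 0 0 0 (x$7) \<in> minus_space" by (simp add: minus_space_iff)
  show "x = vec7 (x$1) 0 0 0 (x$5) (x$6) 0 + vec7 0 (x$2) (x$3) 0 0 0 (x$7) + (x$4) *s axis 4 1"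
    by (rule vec7_eqI) (simp_all add: axis_nth)
qed

section \<open>Unipotent elements fixing the vector\<close>

text \<open>
  In characteristic 5 the condition \<open>z\<^sup>5 = 1\<close> makes \<open>z\<close> unipotent.
\<close>

definition unipotent_5 :: "K ^ 7 ^ 7 \<Rightarrow> bool"
  where "unipotent_5 z \<longleftrightarrow> z \<in> oct_aut \<and> z *v axis 4 1 = axis 4 1 \<and> (\<forall>v. ((*v) z ^^ 5) v = v)"

text \<open>
  A nilpotent map of a three-dimensional space has cube zero. Otherwise four vectors \<open>a, N a, N\<^sup>2 a, N\<^sup>3 a\<close> would be
  independent, which Cramer's rule excludes.
\<close>

lemma minus_cube:
  assumes z: "unipotent_5 z" and v: "v \<in> minus_space"
  defines "N \<equiv> z - mat 1"
  shows "N *v (N *v (N *v v)) = 0"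
proof (rule ccontr)
  assume ne: "N *v (N *v (N *v v)) \<noteq> 0"
  have z': "z \<in> oct_aut" "z *v axis 4 1 = axis 4 1" "\<And>v. ((*v) z ^^ 5) v = v"
    using z by (auto simp: unipotent_5_def)
  have cl: "N *v w \<in> minus_space" if "w \<in> minus_space" for w
    using that by (simp add: N_def minus_one_vec plus_minus_closed fixes_axis_4[OF z'(1,2)])
  have N5: "N *v (N *v (N *v (N *v (N *v w)))) = 0" for w
    using unipotent_power_5[OF z'(3), of w] by (simp add: N_def eval_nat_numeral)
  obtain a where a: "a \<in> minus_space" "N *v (N *v (N *v a)) \<noteq> 0" "N *v (N *v (N *v (N *v a))) = 0"
    using ne v cl[OF v] N5[of v] by (cases "N *v (N *v (N *v (N *v v))) = 0") auto
  define b where "b = N *v a"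
  define c where "c = N *v b"
  define d where "d = N *v c"
  have m: "b \<in> minus_space" "c \<in> minus_space" "d \<in> minus_space" using a(1) cl by (simp_all add: b_def c_def d_def)
  have n: "N *v a = b" "N *v b = c" "N *v c = d" "N *v d = 0" "d \<noteq> 0"
    using a by (simp_all add: b_def c_def d_def)
  note lin = matrix_vector_right_distrib vec.diff vector_scalar_commute n
  have rel: "x0 = 0 \<and> x1 = 0 \<and> x2 = 0 \<and> x3 = 0" if "x0 *s a + x1 *s b + x2 *s c + x3 *s d = 0" for x0 x1 x2 x3
  proof -
    have "N *v (N *v (N *v (x0 *s a + x1 *s b + x2 *s c + x3 *s d))) = x0 *s d" by (simp add: lin)
    then have 0: "x0 = 0" using that n(5) by simp
    have "N *v (N *v (x1 *s b + x2 *s c + x3 *s d)) = x1 *s d" by (simp add: lin)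
    then have 1: "x1 = 0" using that n(5) 0 by simp
    have "N *v (x2 *s c + x3 *s d) = x2 *s d" by (simp add: lin)
    then have 2: "x2 = 0" using that n(5) 0 1 by simp
    then show ?thesis using that n(5) 0 1 by simp
  qed
  have "form (b \<star> c) d *s a + (- form (a \<star> c) d) *s b + form (a \<star> b) d *s c + (- form (a \<star> b) c) *s d = 0"
    using minus_cramer[OF a(1) m] by (simp add: vec_eq_iff algebra_simps)
  then have "form (a \<star> b) c = 0" using rel by fastforce
  then obtain x y w where "x *s a + y *s b + w *s c = 0" "x \<noteq> 0 \<or> y \<noteq> 0 \<or> w \<noteq> 0"
    using minus_dependent[OF a(1) m(1,2)] by blast
  then show False using rel[of x y w 0] by simp
qed

lemma unipotent_inverse:
  assumes z: "unipotent_5 z"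
  obtains y where "unipotent_5 y" "\<And>v. y *v (z *v v) = v" "\<And>v. z *v (y *v v) = v"
proof -
  have z': "z \<in> oct_aut" "z *v axis 4 1 = axis 4 1" "\<And>v. ((*v) z ^^ 5) v = v"
    using z by (auto simp: unipotent_5_def)
  obtain y where y: "y \<in> oct_aut" "\<And>v. z *v (y *v v) = v" "\<And>v. y *v (z *v v) = v"
    using oct_aut_inverse[OF z'(1)] by metis
  have "((*v) y ^^ 5) v = v" for v
  proof -
    have "((*v) y ^^ 5) (((*v) z ^^ 5) v) = v" by (simp add: eval_nat_numeral y)
    then show ?thesis by (simp only: z'(3))
  qed
  moreover have "y *v axis 4 1 = axis 4 1" using y(3)[of "axis 4 1"] z'(2) by simp
  ultimately have "unipotent_5 y" using y(1) by (simp add: unipotent_5_def)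
  then show thesis using y(3,2) by (rule that)
qed

text \<open>
  With \<open>y = z\<^sup>-\<^sup>1\<close>, the adjoint of \<open>z - 1\<close> is \<open>z\<^sup>-\<^sup>1 - 1\<close>.
\<close>

lemma form_minus_one:
  assumes z: "z \<in> oct_aut" and y: "\<And>v. z *v (y *v v) = v"
  shows "form ((z - mat 1) *v a) b = form a ((y - mat 1) *v b)"
proof -
  have "form (z *v a) b = form a (y *v b)" using oct_aut_form[OF z, of a "y *v b"] by (simp add: y)
  then show ?thesis by (simp add: minus_one_vec)
qed

text \<open>
  Dual to \<open>minus_cube\<close>, as the two spaces are paired by the form.
\<close>

lemma plus_cube:
  assumes z: "unipotent_5 z" and v: "v \<in> plus_space"
  defines "N \<equiv> z - mat 1"
  shows "N *v (N *v (N *v v)) = 0"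
proof (rule ccontr)
  assume ne: "N *v (N *v (N *v v)) \<noteq> 0"
  obtain y where y: "unipotent_5 y" "\<And>v. z *v (y *v v) = v" using unipotent_inverse[OF z] by metis
  have z': "z \<in> oct_aut" "z *v axis 4 1 = axis 4 1" using z by (auto simp: unipotent_5_def)
  have cl: "N *v w \<in> plus_space" if "w \<in> plus_space" for w
    using that by (simp add: N_def minus_one_vec plus_minus_closed fixes_axis_4[OF z'])
  obtain m where m: "m \<in> minus_space" "form (N *v (N *v (N *v v))) m \<noteq> 0"
    using form_pairing(2)[OF _ ne] cl v by blast
  have "form (N *v (N *v (N *v v))) m = form v ((y - mat 1) *v ((y - mat 1) *v ((y - mat 1) *v m)))"
    unfolding N_def by (simp only: form_minus_one[OF z'(1) y(2)])
  with m(2) show False by (simp add: minus_cube[OF y(1) m(1)])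
qed

lemma unipotent_no_eigenvalue:
  assumes z: "unipotent_5 z" and v: "v \<in> plus_space \<or> v \<in> minus_space" and eq: "z *v v = - v"
  shows "v = 0"
proof -
  have e: "(z - mat 1) *v v = (- 2) *s v" by (simp add: minus_one_vec eq vec_eq_iff)
  have "(z - mat 1) *v ((z - mat 1) *v ((z - mat 1) *v v)) = (- 2 * - 2 * - 2) *s v"
    by (simp only: e vector_scalar_commute vector_smult_assoc)
  then have "(- 2 * - 2 * - 2) *s v = 0" using v plus_cube[OF z] minus_cube[OF z] by metis
  moreover have "(- 2 * - 2 * - 2 :: K) \<noteq> 0" by (simp add: char_5)
  ultimately show ?thesis by (metis vector_mul_eq_0)
qed

lemma plus_orthogonal_exists:
  obtains x where "x \<in> plus_space" "x \<noteq> 0" "form u x = 0" "form v x = 0"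
proof -
  obtain x where x: "x \<noteq> 0" "\<And>y. y \<in> {axis 1 1, axis 5 1, axis 6 1, axis 4 1, u, v} \<Longrightarrow> form y x = 0"
    by (rule orthogonal_to_few_vectors[of "{axis 1 1, axis 5 1, axis 6 1, axis 4 1, u, v}"])
       (auto simp: card_insert_if)
  have "form (axis 1 1) x = 0" "form (axis 5 1) x = 0" "form (axis 6 1) x = 0" "form (axis 4 1) x = 0"
    using x(2) by blast+
  then have "x \<in> plus_space" by (simp add: plus_space_iff form_def axis_nth)
  with x that show thesis by blast
qed

text \<open>
  View \<open>a\<close> as a linear functional on the plus space. If it does not generate the dual space under \<open>z\<close>, then it vanishes on a
  nonzero vector fixed by \<open>z\<close>: on the image of \<open>(z - 1)\<^sup>2\<close> if this is nonzero; otherwise take \<open>x\<close>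
  in the common kernel of \<open>a\<close> and its adjoint image, and use \<open>x\<close> or \<open>(z - 1) x\<close>.
\<close>

lemma not_cyclic_plus:
  assumes z: "unipotent_5 z" and a: "a \<in> minus_space" and sq: "(z - mat 1) *v ((z - mat 1) *v a) = 0"
  obtains e where "e \<in> plus_space" "e \<noteq> 0" "z *v e = e" "form a e = 0"
proof -
  obtain y where y: "unipotent_5 y" "\<And>v. z *v (y *v v) = v" "\<And>v. y *v (z *v v) = v"
    using unipotent_inverse[OF z] by metis
  have z': "z \<in> oct_aut" "z *v axis 4 1 = axis 4 1" and y': "y \<in> oct_aut" using z y by (auto simp: unipotent_5_def)
  define N where "N = z - mat 1"
  define M where "M = y - mat 1"
  have Mv: "M *v v = - (y *v (N *v v))" for v
    by (simp add: M_def N_def minus_one_vec vec.diff y)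
  have MN: "y *v (N *v v) = N *v (y *v v)" for v by (simp add: N_def minus_one_vec vec.diff y)
  have M2: "M *v (M *v a) = 0" using sq by (simp add: Mv vec.neg MN[symmetric] N_def[symmetric])
  have cl: "N *v w \<in> plus_space" if "w \<in> plus_space" for w
    using that by (simp add: N_def minus_one_vec plus_minus_closed fixes_axis_4[OF z'])
  have adj: "form a (N *v x) = form (M *v a) x" for a x
    unfolding M_def N_def by (rule form_minus_one[OF y' y(3), symmetric])
  have fx: "z *v e = e" if "N *v e = 0" for e using that by (simp add: N_def minus_one_vec)
  show thesis
  proof (cases "\<exists>x \<in> plus_space. N *v (N *v x) \<noteq> 0")
    case True
    then obtain x where x: "x \<in> plus_space" "N *v (N *v x) \<noteq> 0" by blast
    have "N *v (N *v (N *v x)) = 0" using plus_cube[OF z x(1)] by (simp add: N_def)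
    moreover have "form a (N *v (N *v x)) = 0" by (simp add: adj M2)
    ultimately show thesis using that[of "N *v (N *v x)"] x cl fx by blast
  next
    case False
    obtain x where x: "x \<in> plus_space" "x \<noteq> 0" "form a x = 0" "form (M *v a) x = 0"
      by (rule plus_orthogonal_exists)
    show thesis
    proof (cases "N *v x = 0")
      case True
      then show thesis using that x fx by blast
    next
      case nz: False
      have "form a (N *v x) = 0" using x(4) by (simp add: adj)
      with nz show thesis using that[of "N *v x"] False x(1) cl fx by blast
    qed
  qed
qed

lemma swap_exists:
  obtains w where "w \<in> oct_aut" "w *v axis 4 1 = - axis 4 1"
  by (rule oct_aut_transitive_nonsingular[of "axis 4 1" "- axis 4 1"]) (auto simp: form_def axis_nth)

text \<open>
  The dual statement; an automorphism that negates \<open>e\<^sub>4\<close> interchanges the two spaces.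
\<close>

lemma not_cyclic_minus:
  assumes z: "unipotent_5 z" and a: "a \<in> plus_space" and sq: "(z - mat 1) *v ((z - mat 1) *v a) = 0"
  obtains e where "e \<in> minus_space" "e \<noteq> 0" "z *v e = e" "form a e = 0"
proof -
  obtain w where w: "w \<in> oct_aut" "w *v axis 4 1 = - axis 4 1" by (rule swap_exists)
  define v where "v = inv\<^bsub>G2\<^esub> w"
  have v: "v \<in> oct_aut" "w *v (v *v x) = x" "v *v (w *v x) = x" for x
    using w(1) by (simp_all add: v_def G2_inv matrix_vector_mul_assoc)
  have v4: "v *v axis 4 1 = - axis 4 1"
    using v(3)[of "axis 4 1"] by (simp add: w(2) vec.neg minus_equation_iff)
  define z' where "z' = w ** (z ** v)"
  have z'v: "z' *v x = w *v (z *v (v *v x))" for x by (simp add: z'_def flip: matrix_vector_mul_assoc)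
  have "((*v) z' ^^ n) x = w *v (((*v) z ^^ n) (v *v x))" for n x
    by (induction n) (simp_all add: z'v v)
  then have "unipotent_5 z'"
    using z w(1) v(1) unfolding unipotent_5_def
    by (intro conjI allI) (simp_all add: z'v v4 vec.neg w(2) v, simp add: z'_def oct_aut_mult v(1))
  moreover have "w *v a \<in> minus_space" using negates_axis_4[OF w] a by blast
  moreover have "w ** z = z' ** w" by (simp add: matrix_vector_eq z'v v flip: matrix_vector_mul_assoc)
  then have "(z' - mat 1) *v ((z' - mat 1) *v (w *v a)) = 0"
    using sq by (simp add: nilpotent_conj)
  ultimately obtain e where e: "e \<in> plus_space" "e \<noteq> 0" "z' *v e = e" "form (w *v a) e = 0"
    by (rule not_cyclic_plus)
  have "v *v e \<in> minus_space" using negates_axis_4[OF v(1) v4] e(1) by blast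
  moreover have "v *v e \<noteq> 0" using e(2) v(1) by (simp add: oct_aut_eq_0)
  moreover have "z *v (v *v e) = v *v e" using arg_cong[OF e(3), of "(*v) v"] by (simp add: z'v v)
  moreover have "form a (v *v e) = 0"
    using oct_aut_form[OF w(1), of a "v *v e"] e(4) by (simp add: v)
  ultimately show thesis by (rule that)
qed

text \<open>
  If \<open>(z - 1)\<^sup>2 a \<noteq> 0\<close> then \<open>a\<close>, \<open>z a\<close>, \<open>z\<^sup>2 a\<close> form a basis, as they are unitriangular in
  \<open>a\<close>, \<open>(z - 1) a\<close>, \<open>(z - 1)\<^sup>2 a\<close>.
\<close>

lemma cyclic_det:
  assumes z: "unipotent_5 z" and a: "a \<in> minus_space" and sq: "(z - mat 1) *v ((z - mat 1) *v a) \<noteq> 0"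
  shows "form (a \<star> (z *v a)) (z *v (z *v a)) \<noteq> 0"
proof
  assume det: "form (a \<star> (z *v a)) (z *v (z *v a)) = 0"
  have z': "z \<in> oct_aut" "z *v axis 4 1 = axis 4 1" using z by (auto simp: unipotent_5_def)
  define N where "N = z - mat 1"
  define b where "b = N *v a"
  define c where "c = N *v b"
  have m: "z *v a \<in> minus_space" "z *v (z *v a) \<in> minus_space"
    using a fixes_axis_4[OF z'] by blast+
  have n: "N *v a = b" "N *v b = c" "N *v c = 0" "c \<noteq> 0"
    using sq minus_cube[OF z a] by (simp_all add: b_def c_def N_def)
  have za: "z *v a = a + b" "z *v (z *v a) = a + 2 *s b + c"
  proof -
    have zv: "z *v v = v + N *v v" for v by (simp add: N_def minus_one_vec)
    show "z *v a = a + b" by (simp add: zv n)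
    show "z *v (z *v a) = a + 2 *s b + c"
      unfolding zv[of a] n(1) by (simp add: zv matrix_vector_right_distrib n vec_eq_iff)
  qed
  obtain x y w where xyw: "x *s a + y *s (z *v a) + w *s (z *v (z *v a)) = 0" "x \<noteq> 0 \<or> y \<noteq> 0 \<or> w \<noteq> 0"
    using minus_dependent[OF a m det] .
  have rel: "(x + y + w) *s a + (y + 2 * w) *s b + w *s c = 0"
    using xyw(1) unfolding za(2) unfolding za(1) by (simp add: vec_eq_iff algebra_simps)
  note lin = matrix_vector_right_distrib vec.diff vector_scalar_commute n
  have "N *v (N *v ((x + y + w) *s a + (y + 2 * w) *s b + w *s c)) = (x + y + w) *s c" by (simp add: lin)
  then have 0: "x + y + w = 0" using rel n(4) by simp
  have "N *v ((y + 2 * w) *s b + w *s c) = (y + 2 * w) *s c" by (simp add: lin)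
  then have 1: "y + 2 * w = 0" using rel n(4) 0 by simp
  have 2: "w = 0" using rel n(4) 0 1 by simp
  show False using 0 1 2 xyw(2) by simp
qed

text \<open>
  An involution in \<open>SL\<^sub>3(K)\<close> is a reflection times \<open>-1\<close>: it is \<open>-1\<close> plus a map of rank one, given by a vector in
  each of the two dual spaces. The fixed vectors \<open>a\<close>, \<open>a'\<close> come from a basic triple \<open>(e\<^sub>4, j, l)\<close> with \<open>j\<close>
  fixed and \<open>l\<close> negated: they are the eigenvectors of \<open>e\<^sub>4\<close> in the span of \<open>j\<close> and \<open>e\<^sub>4 \<star> j\<close>.
\<close>

lemma involution_fixing_axis_4:
  assumes x: "x \<in> oct_aut" "\<And>v. x *v (x *v v) = v" "x \<noteq> mat 1" and e: "x *v axis 4 1 = axis 4 1"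
  obtains a a' where "a \<in> plus_space" "a' \<in> minus_space" "form a' a = 2" "x *v a = a" "x *v a' = a'"
    "\<And>y. y \<in> plus_space \<Longrightarrow> x *v y = form a' y *s a - y"
    "\<And>y. y \<in> minus_space \<Longrightarrow> x *v y = form a y *s a' - y"
proof -
  define E :: "K ^ 7" where "E = axis 4 1"
  have E1: "form E E = 1" by (simp add: E_def form_def axis_nth char_5)
  obtain l where l: "x *v l = - l" "form l l = 1" by (rule involution_minus[OF x])
  obtain j where j: "x *v j = j" and T: "basic_triple E j l"
    using involution_complement[OF x(1,2) e E1[unfolded E_def] l] unfolding E_def by blast
  note tab = basic_triple_table[OF T]
  have jj: "form j j = 1" "form E j = 0" "form j E = 0" "form E l = 0" "form j l = 0"
    using T by (simp_all add: basic_triple_def form_sym[of j E])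
  define k where "k = E \<star> j"
  have k: "x *v k = k" unfolding k_def using x(1) e j by (simp add: oct_aut_cross E_def)
  have kk: "form k k = 1" "form j k = 0" "form k j = 0" "form E k = 0" "form k E = 0" "E \<star> k = - j"
    using tab by (simp_all add: k_def)
  define a where "a = j - 2 *s k"
  define a' where "a' = j + 2 *s k"
  have aP: "a \<in> plus_space" "a' \<in> minus_space"
    unfolding plus_space_def minus_space_def a_def a'_def E_def[symmetric]
    by (simp_all add: kk k_def[symmetric]) (simp_all add: vec_eq_iff algebra_simps char_5)
  have aa: "form a' a = 2" by (simp add: a_def a'_def jj kk char_5)
  have xa: "x *v a = a" "x *v a' = a'"
    by (simp_all add: a_def a'_def matrix_vector_right_distrib vec.diff vector_scalar_commute j k)
  have fixed: "\<exists>\<alpha> \<beta> \<gamma>. w = \<alpha> *s E + \<beta> *s a + \<gamma> *s a'" if w: "x *v w = w" for w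
  proof -
    obtain M where M: "frame_matrix E j l ** M = mat 1" using frame_matrix_invertible[OF T] by blast
    define w0 where "w0 = M *v w"
    have "w = frame_matrix E j l *v w0" by (simp add: w0_def matrix_vector_mul_assoc M)
    then have w_eq: "w = w0$1 *s E + w0$2 *s j + w0$3 *s k + w0$4 *s l + w0$5 *s (E \<star> l) + w0$6 *s (j \<star> l)
        + w0$7 *s (k \<star> l)" by (simp add: frame_matrix_vec k_def)
    have "2 *s w = w + x *v w" using w by (simp add: vec_eq_iff)
    also have "\<dots> = 2 *s (w0$1 *s E + w0$2 *s j + w0$3 *s k)"
      unfolding w_eq
      by (simp add: matrix_vector_right_distrib vector_scalar_commute oct_aut_cross x(1) e[folded E_def] j k l)
         (simp add: vec_eq_iff)
    finally have "w = w0$1 *s E + w0$2 *s j + w0$3 *s k" by simp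
    also have "\<dots> = w0$1 *s E + (w0$3 - 2 * w0$2) *s a + (- 2 * w0$2 - w0$3) *s a'"
      by (simp add: a_def a'_def vec_eq_iff algebra_simps char_5)
    finally show ?thesis by blast
  qed
  have orthE: "form u v = 0" if "u \<in> {E, a} \<and> v = a \<or> u \<in> {E, a'} \<and> v = a'" for u v
    using that aP form_plus_minus by (auto simp: E_def)
  have P: "x *v y = form a' y *s a - y" if y: "y \<in> plus_space" for y
  proof -
    obtain \<alpha> \<beta> \<gamma> where w: "y + x *v y = \<alpha> *s E + \<beta> *s a + \<gamma> *s a'"
      using fixed[of "y + x *v y"] x(2) by (auto simp: matrix_vector_right_distrib add.commute)
    have pl: "y + x *v y \<in> plus_space" using y fixes_axis_4[OF x(1) e] plus_minus_closed(1) by blast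
    have "form E (y + x *v y) = 0" "form a (y + x *v y) = 0"
      using pl aP form_plus_minus unfolding E_def by blast+
    then have "\<alpha> = 0" "\<gamma> = 0"
      unfolding w using E1 orthE aa by (simp_all add: form_sym[of a a'])
    then have w: "y + x *v y = \<beta> *s a" using w by simp
    have "form a' (x *v y) = form a' y" using oct_aut_form[OF x(1), of a' y] xa by simp
    then have "2 * form a' y = form a' (y + x *v y)" by simp
    also have "\<dots> = 2 * \<beta>" unfolding w by (simp add: aa)
    finally have "\<beta> = form a' y" by (simp only: mult_left_cancel[OF two_neq_0_K])
    then show ?thesis using w by (simp add: eq_diff_eq add.commute)
  qed
  have Q: "x *v y = form a y *s a' - y" if y: "y \<in> minus_space" for y
  proof -
    obtain \<alpha> \<beta> \<gamma> where w: "y + x *v y = \<alpha> *s E + \<beta> *s a + \<gamma> *s a'"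
      using fixed[of "y + x *v y"] x(2) by (auto simp: matrix_vector_right_distrib add.commute)
    have pl: "y + x *v y \<in> minus_space" using y fixes_axis_4[OF x(1) e] plus_minus_closed(5) by blast
    have "form E (y + x *v y) = 0" "form a' (y + x *v y) = 0"
      using pl aP form_plus_minus unfolding E_def by blast+
    then have "\<alpha> = 0" "\<beta> = 0"
      unfolding w using E1 orthE aa by simp_all
    then have w: "y + x *v y = \<gamma> *s a'" using w by simp
    have "form a (x *v y) = form a y" using oct_aut_form[OF x(1), of a y] xa by simp
    then have "2 * form a y = form a (y + x *v y)" by simp
    also have "\<dots> = 2 * \<gamma>" unfolding w by (simp add: aa form_sym[of a a'])
    finally have "\<gamma> = form a y" by (simp only: mult_left_cancel[OF two_neq_0_K])
    then show ?thesis using w by (simp add: eq_diff_eq add.commute)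
  qed
  show thesis by (rule that[OF aP aa xa P Q])
qed

section \<open>Conjugacy of the generating pairs\<close>

declare two_neq_0_K [symmetric, simp]

lemma triple_product:
  assumes tri: "triple_2_4_5 t s" and e: "t *v axis 4 1 = c *s axis 4 1" "s *v axis 4 1 = c *s axis 4 1" "c * c = 1"
  shows "unipotent_5 (t ** s)" "(t ** s) *v v = t *v (s *v v)" "s *v v = t *v ((t ** s) *v v)"
  using triple_2_4_5D[OF tri] e
  by (simp_all add: unipotent_5_def oct_aut_mult vector_scalar_commute vector_smult_assoc flip: matrix_vector_mul_assoc)

text \<open>
  This is \<open>(z - 1)\<^sup>3 = 0\<close>.
\<close>

lemma unipotent_recurrence:
  assumes z: "unipotent_5 z" and v: "v \<in> plus_space \<or> v \<in> minus_space"
  shows "z *v (z *v (z *v v)) = 3 *s (z *v (z *v v)) - 3 *s (z *v v) + v"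
proof -
  have "(z - mat 1) *v ((z - mat 1) *v ((z - mat 1) *v v)) = 0"
    using v plus_cube[OF z] minus_cube[OF z] by blast
  then have "z *v (z *v (z *v v)) - 3 *s (z *v (z *v v)) + 3 *s (z *v v) - v = 0"
    by (simp only: minus_one_vec vec.diff) (simp add: vec_eq_iff algebra_simps)
  then show ?thesis by (simp add: algebra_simps)
qed

lemma det_shift:
  assumes z: "z \<in> oct_aut" and q: "z *v q = p"
  shows "form (p \<star> q) (z *v p) = - form (p \<star> (z *v p)) (z *v (z *v p))"
proof -
  have "form (p \<star> q) (z *v p) = form (z *v (p \<star> q)) (z *v (z *v p))" using z by (simp add: oct_aut_form)
  also have "\<dots> = form ((z *v p) \<star> p) (z *v (z *v p))" by (simp add: oct_aut_cross z q)
  also have "\<dots> = - form (p \<star> (z *v p)) (z *v (z *v p))" by (rule form_cross_swap)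
  finally show ?thesis .
qed

lemma orthogonal_to_minus_basis:
  assumes m: "p \<in> minus_space" "q \<in> minus_space" "r \<in> minus_space" and det: "form (p \<star> q) r \<noteq> 0"
    and x: "x \<in> plus_space" "form p x = 0" "form q x = 0" "form r x = 0"
  shows "x = 0"
proof (rule ccontr)
  assume "x \<noteq> 0"
  then obtain d where d: "d \<in> minus_space" "form x d \<noteq> 0" using form_pairing(2) x(1) by blast
  have "form (form (q \<star> r) d *s p - form (p \<star> r) d *s q + form (p \<star> q) d *s r - form (p \<star> q) r *s d) x = 0"
    by (simp only: minus_cramer[OF m d(1)] form_simps)
  then have "form (p \<star> q) r * form d x = 0" by (simp add: x)
  then show False using det d(2) by (simp add: form_sym)
qed

text \<open>
  Write \<open>t = -1 + a a'\<close> and \<open>s\<^sup>2 = -1 + b b'\<close> as rank one perturbations, and let \<open>m\<close> be the moment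
  \<open>form a' (z a)\<close>. As \<open>b\<close>, \<open>b'\<close> are fixed by \<open>s\<close>, the vectors \<open>a\<close>, \<open>a'\<close> are multiples of
  \<open>z b + b\<close>, \<open>z b' + b'\<close>, and all moments of \<open>z\<close> can be computed from \<open>wp = form b' (z b)\<close> with the
  recurrence for \<open>z\<close>. The resulting quadratic equation for \<open>m\<close> has the roots \<open>2\<close> and \<open>-1\<close>. The root
  \<open>2\<close> would mean that \<open>z\<close> fixes \<open>a\<close>, but \<open>a\<close> and \<open>a'\<close> are cyclic for \<open>z\<close>: otherwise \<open>z\<close> would fix a
  vector negated by \<open>t\<close>, on which \<open>s\<close> would be \<open>-1\<close>. So \<open>m = -1\<close>, and \<open>t\<close> and \<open>z\<close> have the stated
  matrices in the basis \<open>a'\<close>, \<open>z\<^sup>-\<^sup>1 a'\<close>, \<open>z a'\<close>, scaled to volume 4.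
\<close>

lemma fixing_triple_basis:
  assumes tri: "triple_2_4_5 t s" and type: "fixes_square_fixed s"
    and e: "t *v axis 4 1 = axis 4 1" "s *v axis 4 1 = axis 4 1"
  obtains p q r where "p \<in> minus_space" "q \<in> minus_space" "r \<in> minus_space" "form (p \<star> q) r = 4"
    "t *v p = p" "t *v q = - p - q" "t *v r = - p - r"
    "(t ** s) *v p = r" "(t ** s) *v q = p" "(t ** s) *v r = q + 2 *s p - 2 *s r"
proof -
  note D = triple_2_4_5D[OF tri]
  define z where "z = t ** s"
  have z: "unipotent_5 z" and zv: "\<And>v. z *v v = t *v (s *v v)" and sv: "\<And>v. s *v v = t *v (z *v v)"
    using triple_product[OF tri, of 1] e by (simp_all add: z_def)
  have z': "z \<in> oct_aut" "z *v axis 4 1 = axis 4 1" using z by (auto simp: unipotent_5_def)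
  obtain y where y: "unipotent_5 y" "\<And>v. y *v (z *v v) = v" "\<And>v. z *v (y *v v) = v"
    using unipotent_inverse[OF z] by metis
  have y': "y \<in> oct_aut" "y *v axis 4 1 = axis 4 1" using y by (auto simp: unipotent_5_def)
  note Z = oct_aut_form[OF z'(1)]
  have Y: "form u (y *v v) = form (z *v u) v" for u v using Z[of u "y *v v"] by (simp add: y)
  obtain a a' where a: "a \<in> plus_space" "a' \<in> minus_space" "form a' a = 2" "t *v a = a" "t *v a' = a'"
    and tP: "\<And>y. y \<in> plus_space \<Longrightarrow> t *v y = form a' y *s a - y"
    and tM: "\<And>y. y \<in> minus_space \<Longrightarrow> t *v y = form a y *s a' - y"
    using involution_fixing_axis_4[OF D(1,2,3) e(1)] by blast
  have ss: "(s ** s) *v v = s *v (s *v v)" for v by (simp flip: matrix_vector_mul_assoc)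
  obtain b b' where b: "b \<in> plus_space" "b' \<in> minus_space" "form b' b = 2"
    "(s ** s) *v b = b" "(s ** s) *v b' = b'"
    and sP: "\<And>y. y \<in> plus_space \<Longrightarrow> (s ** s) *v y = form b' y *s b - y"
    using involution_fixing_axis_4[OF oct_aut_mult[OF D(4) D(4)] _ D(6)] D(5) e(2) by (metis ss)
  have sb: "s *v b = b" "s *v b' = b'" using type b(4,5) by (simp_all add: fixes_square_fixed_def ss)
  define c1 where "c1 = form a' b"
  define c2 where "c2 = form a b'"
  have zb: "z *v b = c1 *s a - b" "z *v b' = c2 *s a' - b'"
    using tP[OF b(1)] tM[OF b(2)] by (simp_all add: zv sb c1_def c2_def)
  have bne: "b \<noteq> 0" "b' \<noteq> 0" using b(3) by auto
  have c0: "c1 \<noteq> 0" "c2 \<noteq> 0"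
    using unipotent_no_eigenvalue[OF z, of b] unipotent_no_eigenvalue[OF z, of b'] zb b bne by auto
  have ca: "c1 *s a = z *v b + b" "c2 *s a' = z *v b' + b'" using zb by simp_all
  \<comment> \<open>The moments of \<open>z\<close> on both spaces agree, and determine each other by \<open>(z - 1)\<^sup>3 = 0\<close>.\<close>
  define wp where "wp = form b' (z *v b)"
  define wm where "wm = form (z *v b') b"
  have c12: "c1 * c2 = wm + 2" "c1 * c2 = wp + 2"
  proof -
    have "c1 * c2 = form (c2 *s a') b" by (simp add: c1_def)
    then show "c1 * c2 = wm + 2" unfolding ca by (simp add: wm_def b)
    have "c1 * c2 = form b' (c1 *s a)" by (simp add: c2_def form_sym)
    then show "c1 * c2 = wp + 2" unfolding ca by (simp add: wp_def b)
  qed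
  then have wm: "wm = wp" by simp
  have w2: "form b' (z *v (z *v b)) = 4 * wp - 6"
  proof -
    have "form b' (z *v (z *v b)) = form (z *v b') (z *v (z *v (z *v b)))" by (simp add: Z)
    also have "\<dots> = 3 * wp - 3 * 2 + wm"
      using b(1) by (simp add: unipotent_recurrence[OF z] Z wp_def wm_def b(3))
    finally show ?thesis by (simp add: wm)
  qed
  define m where "m = form a' (z *v a)"
  have m1: "c1 * c2 * m = 6 * wp - 4"
  proof -
    have "c1 * c2 * m = form (c2 *s a') (z *v (c1 *s a))" by (simp add: m_def vector_scalar_commute)
    also have "\<dots> = form b' (z *v (z *v b)) + wp + wp + 2"
      unfolding ca by (simp add: matrix_vector_right_distrib Z b(3) wp_def)
    finally show ?thesis by (simp add: w2)
  qed
  have m2: "form (z *v a') a = m"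
  proof -
    have "form (z *v (z *v b')) b = form (z *v (z *v (z *v b'))) (z *v b)" by (simp add: Z)
    also have "\<dots> = 3 * wm - 3 * 2 + wp"
      using b(2) by (simp add: unipotent_recurrence[OF z] Z wp_def wm_def b(3))
    finally have w3: "form (z *v (z *v b')) b = 4 * wp - 6" by (simp add: wm)
    have "c1 * c2 * form (z *v a') a = form (z *v (c2 *s a')) (c1 *s a)" by (simp add: vector_scalar_commute)
    also have "\<dots> = form (z *v (z *v b')) b + wm + wm + 2"
      unfolding ca by (simp add: matrix_vector_right_distrib Z b(3) wm_def)
    also have "\<dots> = c1 * c2 * m" by (simp add: m1 w3 wm)
    finally show ?thesis using c0 by simp
  qed
  \<comment> \<open>Compare the two formulas for \<open>t z a = s\<^sup>2 z\<^sup>-\<^sup>1 a\<close>.\<close>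
  have m3: "2 * m = wp + 2"
  proof -
    have ya: "y *v a \<in> plus_space" using a(1) fixes_axis_4[OF y'] by blast
    have "(s ** s) *v (y *v a) = t *v (z *v a)" by (simp add: ss sv y a(4))
    then have "t *v (z *v a) = form b' (y *v a) *s b - y *v a" using sP[OF ya] by simp
    moreover have "t *v (z *v a) = m *s a - z *v a"
      using tP a(1) fixes_axis_4[OF z'] by (simp add: m_def)
    ultimately have "form a' (m *s a - z *v a) = form a' (form b' (y *v a) *s b - y *v a)" by simp
    then have "2 * m = c1 * form b' (y *v a)"
      by (simp add: a(3) m_def[symmetric] Y m2 c1_def mult.commute)
    also have "\<dots> = form (z *v b') (c1 *s a)" by (simp add: Y)
    also have "\<dots> = wp + 2" unfolding ca by (simp add: Z b(3) wm_def[symmetric] wm)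
    finally show ?thesis .
  qed
  \<comment> \<open>Eliminate \<open>wp\<close>.\<close>
  have "(m - 2) * (m + 1) = 0"
  proof -
    have wp: "wp = 2 * m - 2" using m3 by simp
    have "(wp + 2) * m = 6 * wp - 4" using m1 c12(2) by simp
    then have "2 * (m * m) = 12 * m - 16" unfolding wp by (simp add: algebra_simps)
    then have "2 * ((m - 2) * (m + 1)) = 2 * 0" by (simp add: algebra_simps char_5)
    then show ?thesis by (simp only: mult_left_cancel[OF two_neq_0_K])
  qed
  have eig: False if "e \<in> plus_space \<or> e \<in> minus_space" "e \<noteq> 0" "z *v e = e" "t *v e = - e" for e
  proof -
    have se: "s *v e = - e" using that(3,4) by (simp add: sv)
    then have "s *v (s *v e) = e" by (simp add: vec.neg)
    then have "s *v e = e" using type by (simp add: fixes_square_fixed_def)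
    with se have "2 *s e = 0" by (simp add: vec_eq_iff) 
    with that(2) show False by simp
  qed
  have cyc': "(z - mat 1) *v ((z - mat 1) *v a') \<noteq> 0"
  proof
    assume "(z - mat 1) *v ((z - mat 1) *v a') = 0"
    then obtain e where e: "e \<in> plus_space" "e \<noteq> 0" "z *v e = e" "form a' e = 0"
      using not_cyclic_plus[OF z a(2)] by blast
    then show False using eig[of e] tP[OF e(1)] by simp
  qed
  have cyc: "(z - mat 1) *v ((z - mat 1) *v a) \<noteq> 0"
  proof
    assume "(z - mat 1) *v ((z - mat 1) *v a) = 0"
    then obtain e where e: "e \<in> minus_space" "e \<noteq> 0" "z *v e = e" "form a e = 0"
      using not_cyclic_minus[OF z a(1)] by blast
    then show False using eig[of e] tM[OF e(1)] by simp
  qed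
  note det = cyclic_det[OF z a(2) cyc']
  have za': "z *v a' \<in> minus_space" "z *v (z *v a') \<in> minus_space" using a(2) fixes_axis_4[OF z'] by blast+
  have "m \<noteq> 2"
  proof
    assume m: "m = 2"
    have "form (z *v (z *v a')) a = form (z *v (z *v (z *v a'))) (z *v a)" by (simp add: Z)
    also have "\<dots> = 3 * m - 3 * 2 + m"
      using a(2) m2 by (simp add: unipotent_recurrence[OF z] Z m_def a(3))
    finally have "form (z *v (z *v a')) a = 2" by (simp add: m)
    \<comment> \<open>All three moments of \<open>z a - a\<close> vanish.\<close>
    moreover have "z *v a - a \<in> plus_space" using a(1) fixes_axis_4[OF z'] plus_minus_closed(2) by blast
    ultimately have "z *v a - a = 0"
      using orthogonal_to_minus_basis[OF a(2) za' det, of "z *v a - a"] m m2 a(3) by (simp add: m_def Z)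
    then show False using cyc by (simp add: minus_one_vec)
  qed
  with \<open>(m - 2) * (m + 1) = 0\<close> have m: "m = -1" by (simp add: eq_neg_iff_add_eq_0)
  define \<kappa> where "\<kappa> = form (a' \<star> (z *v a')) (z *v (z *v a'))"
  have "\<exists>l :: K. l ^ 3 = 1 / \<kappa>" using nth_root_exists[of 3 "1 / \<kappa>"] by auto
  then obtain l where "l ^ 3 = 1 / \<kappa>" by blast
  then have l: "l * (l * (l * \<kappa>)) = 1" using det by (simp add: \<kappa>_def power3_eq_cube field_simps)
  define p where "p = l *s a'"
  define q where "q = y *v p"
  define r where "r = z *v p"
  have M: "p \<in> minus_space" "q \<in> minus_space" "r \<in> minus_space"
    using a(2) fixes_axis_4[OF y'] fixes_axis_4[OF z'] by (simp_all add: p_def q_def r_def plus_minus_closed)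
  have zq: "z *v q = p" "z *v p = r" by (simp_all add: q_def r_def y)
  have "form (p \<star> q) r = - form (p \<star> (z *v p)) (z *v (z *v p))"
    unfolding r_def by (rule det_shift[OF z'(1) zq(1)])
  also have "\<dots> = - (l * (l * (l * \<kappa>)))" by (simp add: p_def \<kappa>_def vector_scalar_commute)
  finally have "form (p \<star> q) r = 4" by (simp add: l char_5)
  moreover have "t *v p = p" by (simp add: p_def vector_scalar_commute a)
  moreover have "form a q = - l"
    using m by (simp add: q_def p_def vector_scalar_commute Y m_def form_sym[of _ a'])
  then have "t *v q = - p - q" using tM[OF M(2)] by (simp add: p_def)
  moreover have "form a r = - l"
    using m m2 by (simp add: r_def p_def vector_scalar_commute form_sym[of a])
  then have "t *v r = - p - r" using tM[OF M(3)] by (simp add: p_def)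
  moreover have "z *v r = q + 2 *s p - 2 *s r"
    using unipotent_recurrence[OF z, of q] M(2) by (simp add: zq) (simp add: vec_eq_iff char_5)
  ultimately show thesis using that M zq by (simp add: z_def)
qed

text \<open>
  Both \<open>t\<close> and \<open>s\<close> interchange the two spaces, and \<open>s\<^sup>2 = (t z)\<^sup>2\<close> is \<open>-1\<close> plus a map of rank one, so
  that \<open>z t z + t\<close> has rank one on the plus space. It is also symmetric as a bilinear form up to a shift by
  \<open>z\<close>, since \<open>t\<close> is self-adjoint; hence it equals \<open>x \<mapsto> form p x *s z p\<close> for a suitable \<open>p\<close> in the minus
  space. The map \<open>T \<mapsto> z T z + T\<close> is injective because \<open>-1\<close> is not an eigenvalue of the unipotent \<open>z\<close>,
  so \<open>t\<close> is the explicit solution \<open>F\<close> of this equation in terms of \<open>p\<close>, \<open>q = z\<^sup>-\<^sup>1 p\<close>, \<open>r = z p\<close>. That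
  \<open>t\<close> preserves the product forces the volume of \<open>p, q, r\<close> to be \<open>\<plusminus>2\<close>. Changing the sign of all three does
  not affect \<open>F\<close>, so the volume may be taken to be 2.
\<close>

lemma moving_triple_basis:
  assumes tri: "triple_2_4_5 t s"
    and e: "t *v axis 4 1 = - axis 4 1" "s *v axis 4 1 = - axis 4 1"
  obtains p q r where "p \<in> minus_space" "q \<in> minus_space" "r \<in> minus_space" "form (p \<star> q) r = 2"
    "(t ** s) *v p = r" "(t ** s) *v q = p" "(t ** s) *v r = q + 2 *s p - 2 *s r"
    "\<And>x. x \<in> plus_space \<Longrightarrow> t *v x = form r x *s (- 2 *s r - p) + form p x *s (2 *s p + 2 *s q - r)
      + form q x *s (2 *s p + q)"
proof -
  note D = triple_2_4_5D[OF tri]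
  define z where "z = t ** s"
  have e': "t *v axis 4 1 = (- 1) *s axis 4 1" "s *v axis 4 1 = (- 1) *s axis 4 1" using e by (simp_all add: vec_eq_iff)
  have z: "unipotent_5 z" and zv: "\<And>v. z *v v = t *v (s *v v)" and sv: "\<And>v. s *v v = t *v (z *v v)"
    using triple_product[OF tri e'] by (simp_all add: z_def)
  have z': "z \<in> oct_aut" "z *v axis 4 1 = axis 4 1" using z by (auto simp: unipotent_5_def)
  obtain y where y: "unipotent_5 y" "\<And>v. y *v (z *v v) = v" "\<And>v. z *v (y *v v) = v"
    using unipotent_inverse[OF z] by metis
  have y': "y \<in> oct_aut" "y *v axis 4 1 = axis 4 1" using y by (auto simp: unipotent_5_def)
  note Z = oct_aut_form[OF z'(1)]
  have T: "form (t *v u) v = form u (t *v v)" for u v using oct_aut_form[OF D(1), of u "t *v v"] by (simp add: D(2))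
  have tcl: "x \<in> plus_space \<Longrightarrow> t *v x \<in> minus_space" "x \<in> minus_space \<Longrightarrow> t *v x \<in> plus_space" for x
    using negates_axis_4[OF D(1) e(1)] by blast+
  have zcl: "x \<in> plus_space \<Longrightarrow> z *v x \<in> plus_space" "x \<in> minus_space \<Longrightarrow> z *v x \<in> minus_space" for x
    using fixes_axis_4[OF z'] by blast+
  have ycl: "x \<in> plus_space \<Longrightarrow> y *v x \<in> plus_space" "x \<in> minus_space \<Longrightarrow> y *v x \<in> minus_space" for x
    using fixes_axis_4[OF y'] by blast+
  have ss: "(s ** s) *v v = s *v (s *v v)" for v by (simp flip: matrix_vector_mul_assoc)
  have "s *v (s *v axis 4 1) = axis 4 1" using e(2) by (simp add: vec.neg)
  then obtain b b' where b: "b \<in> plus_space" "b' \<in> minus_space" "form b' b = 2"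
    and sP: "\<And>y. y \<in> plus_space \<Longrightarrow> (s ** s) *v y = form b' y *s b - y"
    using involution_fixing_axis_4[OF oct_aut_mult[OF D(4) D(4)] _ D(6)] D(5) by (metis ss)
  have rel: "z *v (t *v (z *v x)) + t *v x = form b' x *s (t *v b)" if "x \<in> plus_space" for x
  proof -
    have "t *v (z *v (t *v (z *v x))) = form b' x *s b - x" using sP[OF that] by (simp add: ss sv)
    then have "t *v (t *v (z *v (t *v (z *v x)))) = t *v (form b' x *s b - x)" by simp
    then show ?thesis by (simp add: D(2) vec.diff vector_scalar_commute)
  qed
  have sym: "form (t *v (z *v x)) w + form (t *v x) (z *v w) = form b' x * form (t *v b) (z *v w)"
    if "x \<in> plus_space" for x w
    using arg_cong[OF rel[OF that], of "\<lambda>v. form v (z *v w)"] by (simp add: Z)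
  have sw: "form (t *v (z *v x)) w + form (t *v x) (z *v w) = form (t *v (z *v w)) x + form (t *v w) (z *v x)" for x w
    by (simp add: T form_sym[of _ x] form_sym[of "z *v x"] add.commute) 
  \<comment> \<open>By symmetry \<open>t b\<close> is the multiple \<open>c\<close> of \<open>z b'\<close>; the factor \<open>3\<close> is the inverse of \<open>form b' b = 2\<close>.\<close>
  define c where "c = 3 * form (t *v b) (z *v b)"
  have tb: "form (t *v b) (z *v w) = c * form b' w" if "w \<in> plus_space" for w
  proof -
    have "2 * form (t *v b) (z *v w) = form b' w * form (t *v b) (z *v b)"
      using sym[OF b(1), of w] sym[OF that, of b] sw[of b w] b(3) by simp
    then have "3 * (2 * form (t *v b) (z *v w)) = 3 * (form b' w * form (t *v b) (z *v b))" by simp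
    then show ?thesis by (simp add: c_def char_5 mult.commute mult.left_commute)
  qed
  have "c \<noteq> 0"
  proof
    assume c: "c = 0"
    have "form (t *v b) w = 0" if "w \<in> plus_space" for w
      using tb[OF ycl(1)[OF that]] by (simp add: c y)
    then have "t *v b = 0" using form_pairing(1) tcl(1) b(1) by blast
    then have "b = 0" using D(1) by (simp add: oct_aut_eq_0)
    then show False using b(3) by simp
  qed
  obtain d where d: "d ^ 2 = c" using nth_root_exists[of 2 c] by auto
  define p0 where "p0 = d *s b'"
  have p0: "p0 \<in> minus_space" using b(2) by (simp add: p0_def plus_minus_closed)
  have relp: "z *v (t *v (z *v x)) + t *v x = form p0 x *s (z *v p0)" if x: "x \<in> plus_space" for x
  proof (rule ccontr)
    define v where "v = z *v (t *v (z *v x)) + t *v x - form p0 x *s (z *v p0)"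
    assume "\<not> ?thesis"
    then have "v \<noteq> 0" by (simp add: v_def)
    moreover have "v \<in> minus_space"
      unfolding v_def using x p0 by (intro plus_minus_closed zcl tcl)
    ultimately obtain w where w: "w \<in> plus_space" "form v w \<noteq> 0" using form_pairing(1) by blast
    have "form v (z *v (y *v w)) = c * (form b' x * form b' (y *v w)) - d * d * (form b' x * form b' (y *v w))"
      using sym[OF x, of "y *v w"] tb[OF ycl(1)[OF w(1)]]
      by (simp only: v_def form_simps Z p0_def vector_scalar_commute) (simp add: algebra_simps)
    then have "form v w = 0" using d by (simp add: y power2_eq_square)
    with w(2) show False by simp
  qed
  have "p0 \<noteq> 0" using \<open>c \<noteq> 0\<close> d b(3) by (auto simp: p0_def)
  have cyc: "(z - mat 1) *v ((z - mat 1) *v p0) \<noteq> 0"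
  proof
    assume "(z - mat 1) *v ((z - mat 1) *v p0) = 0"
    then obtain x where x: "x \<in> plus_space" "x \<noteq> 0" "z *v x = x" "form p0 x = 0"
      using not_cyclic_plus[OF z p0] by blast
    then have "z *v (t *v x) = - (t *v x)" using relp[OF x(1)] by (simp add: eq_neg_iff_add_eq_0)
    then have "t *v x = 0" using unipotent_no_eigenvalue[OF z] tcl(1)[OF x(1)] by blast
    then show False using x(2) D(1) by (simp add: oct_aut_eq_0)
  qed
  note det0 = cyclic_det[OF z p0 cyc]
  \<comment> \<open>The solution of \<open>z F z + F = form p \<cdot> *s z p\<close> in the basis \<open>p, q, r\<close>.\<close>
  define F where "F p q r x = form r x *s (- 2 *s r - p) + form p x *s (2 *s p + 2 *s q - r)
      + form q x *s (2 *s p + q)" for p q r x :: "K ^ 7"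
  define q0 where "q0 = y *v p0"
  define r0 where "r0 = z *v p0"
  have M: "q0 \<in> minus_space" "r0 \<in> minus_space" using p0 zcl ycl by (simp_all add: q0_def r0_def)
  have zq: "z *v q0 = p0" "z *v p0 = r0" by (simp_all add: q0_def r0_def y)
  have zr: "z *v r0 = q0 + 2 *s p0 - 2 *s r0"
    using unipotent_recurrence[OF z, of q0] M(1) by (simp add: zq) (simp add: vec_eq_iff char_5)
  have Fz: "z *v F p0 q0 r0 (z *v x) + F p0 q0 r0 x = form p0 x *s (z *v p0)" for x
  proof -
    have "form r0 (z *v x) = form p0 x" "form p0 (z *v x) = form q0 x"
      using Z[of p0 x] Z[of q0 x] by (simp_all add: zq)
    moreover have "z *v (r0 + 2 *s p0 - 2 *s q0) = q0"
      by (simp add: vec.diff matrix_vector_right_distrib vector_scalar_commute zq zr)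
    then have "form q0 (z *v x) = form (r0 + 2 *s p0 - 2 *s q0) x"
      using Z[of "r0 + 2 *s p0 - 2 *s q0" x] by simp
    ultimately show ?thesis
      unfolding F_def
      by (simp add: vec.diff matrix_vector_right_distrib vector_scalar_commute zq zr vec.neg)
         (simp add: vec_eq_iff algebra_simps char_5)
  qed
  \<comment> \<open>The difference \<open>G\<close> of two solutions vanishes, by descending along the powers of \<open>z - 1\<close>.\<close>
  define G where "G x = t *v x - F p0 q0 r0 x" for x
  have Fadd: "F p0 q0 r0 (u + v) = F p0 q0 r0 u + F p0 q0 r0 v" for u v
    by (simp add: F_def vec_eq_iff algebra_simps)
  have Gadd: "G (u + v) = G u + G v" for u v
    by (simp add: G_def Fadd matrix_vector_right_distrib)
  have Gcl: "G x \<in> minus_space" if "x \<in> plus_space" for x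
    unfolding G_def F_def using that p0 M by (intro plus_minus_closed tcl)
  have Gz: "z *v G (z *v x) = - G x" if "x \<in> plus_space" for x
    using relp[OF that] Fz[of x] by (simp add: G_def vec.diff eq_neg_iff_add_eq_0) (simp add: algebra_simps)
  define N where "N = z - mat 1"
  have zN: "z *v x = x + N *v x" for x by (simp add: N_def minus_one_vec)
  have Ncl: "N *v x \<in> plus_space" if "x \<in> plus_space" for x
    using that zcl plus_minus_closed by (simp add: N_def minus_one_vec)
  have G0: "G x = 0" if "x \<in> plus_space" "G (N *v x) = 0" for x
  proof -
    have "G (z *v x) = G x" using that(2) by (simp add: zN Gadd)
    then have "z *v G x = - G x" using Gz[OF that(1)] by simp
    then show ?thesis using unipotent_no_eigenvalue[OF z] Gcl[OF that(1)] by blast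
  qed
  have tF: "t *v x = F p0 q0 r0 x" if x: "x \<in> plus_space" for x
  proof -
    have "N *v (N *v (N *v x)) = 0" using plus_cube[OF z x] by (simp add: N_def)
    moreover have "G 0 = 0" by (simp add: G_def F_def)
    ultimately have "G (N *v (N *v x)) = 0" using G0 Ncl x by simp
    then have "G (N *v x) = 0" using G0 Ncl x by blast
    then have "G x = 0" using G0 x by blast
    then show ?thesis by (simp add: G_def)
  qed
  define \<kappa> where "\<kappa> = form (p0 \<star> q0) r0"
  have k0: "\<kappa> \<noteq> 0" using det0 det_shift[OF z'(1) zq(1)] by (simp add: \<kappa>_def r0_def)
  \<comment> \<open>Compare the volumes of a basis of the plus space and of its image under \<open>t\<close>.\<close>
  have "\<kappa> * \<kappa> = 4"
  proof -
    have f: "form p0 (q0 \<star> r0) = \<kappa>" "form q0 (r0 \<star> p0) = \<kappa>" "form r0 (p0 \<star> q0) = \<kappa>" "form (r0 \<star> q0) p0 = - \<kappa>"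
      using form_sym[of p0 "q0 \<star> r0"] form_sym[of q0 "r0 \<star> p0"] form_sym[of r0 "p0 \<star> q0"]
        form_cross_rotate[of q0 r0 p0] form_cross_rotate[of r0 p0 q0] form_cross_swap[of r0 q0 p0]
      by (simp_all add: \<kappa>_def)
    have cl: "q0 \<star> r0 \<in> plus_space" "r0 \<star> p0 \<in> plus_space" "p0 \<star> q0 \<in> plus_space"
      using cross_plus_minus p0 M by blast+
    have "(q0 \<star> r0) \<star> (r0 \<star> p0) = - ((r0 \<star> q0) \<star> (r0 \<star> p0))" by (simp add: cross_anticomm[of q0 r0])
    also have "\<dots> = (2 * \<kappa>) *s r0"
      unfolding cross_of_crosses[OF M(2,1) p0] by (simp add: f)
    finally have X: "(q0 \<star> r0) \<star> (r0 \<star> p0) = (2 * \<kappa>) *s r0" .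
    have "2 * \<kappa> * \<kappa> = form ((q0 \<star> r0) \<star> (r0 \<star> p0)) (p0 \<star> q0)" by (simp add: X f)
    also have "\<dots> = form ((t *v (q0 \<star> r0)) \<star> (t *v (r0 \<star> p0))) (t *v (p0 \<star> q0))"
      using D(1) by (simp add: oct_aut_form flip: oct_aut_cross)
    also have "\<dots> = form ((\<kappa> *s (2 *s p0 + 2 *s q0 - r0)) \<star> (\<kappa> *s (2 *s p0 + q0))) (\<kappa> *s (- 2 *s r0 - p0))"
      by (simp add: tF cl F_def f)
    also have "\<dots> = 3 * (\<kappa> * (\<kappa> * (\<kappa> * \<kappa>)))"
      by (simp add: cross_anticomm[of q0 p0] cross_anticomm[of r0 q0] cross_anticomm[of r0 p0])
         (simp add: f \<kappa>_def[symmetric] form_sym[of _ p0] form_sym[of _ r0] cross_anticomm[of p0 r0] form_cross_swap algebra_simps)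
    finally have "\<kappa> * \<kappa> * 2 = \<kappa> * \<kappa> * (3 * (\<kappa> * \<kappa>))" by (simp add: mult_ac)
    then have "2 = 3 * (\<kappa> * \<kappa>)" using k0 by simp
    then have "2 * 2 = 2 * (3 * (\<kappa> * \<kappa>))" by simp
    then show ?thesis by (simp add: char_5)
  qed
  then have "(\<kappa> - 2) * (\<kappa> + 2) = 0" by (simp add: algebra_simps)
  then have "\<kappa> = 2 \<or> \<kappa> = - 2" by (simp add: eq_neg_iff_add_eq_0)
  then obtain \<epsilon> where \<epsilon>: "\<epsilon> * \<epsilon> = 1" "\<epsilon> * \<kappa> = 2" by (metis mult.right_neutral mult_minus1 mult_minus1_right minus_minus mult_1)
  show thesis
  proof (rule that[of "\<epsilon> *s p0" "\<epsilon> *s q0" "\<epsilon> *s r0"])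
    have "form ((\<epsilon> *s p0) \<star> (\<epsilon> *s q0)) (\<epsilon> *s r0) = \<epsilon> * \<epsilon> * (\<epsilon> * \<kappa>)" by (simp add: \<kappa>_def)
    then show "form ((\<epsilon> *s p0) \<star> (\<epsilon> *s q0)) (\<epsilon> *s r0) = 2" by (simp add: \<epsilon>)
    fix x assume "x \<in> plus_space"
    then have "t *v x = (\<epsilon> * \<epsilon>) *s F p0 q0 r0 x" by (simp add: tF \<epsilon>)
    also have "\<dots> = F (\<epsilon> *s p0) (\<epsilon> *s q0) (\<epsilon> *s r0) x" by (simp add: F_def vec_eq_iff algebra_simps)
    finally show "t *v x = form (\<epsilon> *s r0) x *s (- 2 *s (\<epsilon> *s r0) - \<epsilon> *s p0)
        + form (\<epsilon> *s p0) x *s (2 *s (\<epsilon> *s p0) + 2 *s (\<epsilon> *s q0) - \<epsilon> *s r0)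
        + form (\<epsilon> *s q0) x *s (2 *s (\<epsilon> *s p0) + \<epsilon> *s q0)" by (simp add: F_def)
  qed (simp_all add: p0 M plus_minus_closed vector_scalar_commute zq zr z_def[symmetric] vector_ssub_ldistrib vector_add_ldistrib vector_smult_assoc mult.commute)
qed

lemma conjugate_product:
  assumes "g ** t = t' ** g" "g ** (t ** s) = (t' ** s') ** g"
    and t: "\<And>v. t *v (t *v v) = v" "\<And>v. t' *v (t' *v v) = v"
  shows "g ** s = s' ** (g :: K ^ 7 ^ 7)"
proof -
  have "g *v (t *v v) = t' *v (g *v v)" "g *v (t *v (s *v v)) = t' *v (s' *v (g *v v))" for v
    using assms(1,2) by (simp_all add: matrix_vector_mul_assoc matrix_mul_assoc)
  then have "g *v (s *v v) = s' *v (g *v v)" for v by (metis t)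
  then show ?thesis by (simp add: matrix_vector_eq flip: matrix_vector_mul_assoc)
qed

lemma fixing_triples_conjugate:
  assumes tri: "triple_2_4_5 t s" "triple_2_4_5 t' s'" and type: "fixes_square_fixed s" "fixes_square_fixed s'"
    and e: "t *v axis 4 1 = axis 4 1" "s *v axis 4 1 = axis 4 1" "t' *v axis 4 1 = axis 4 1" "s' *v axis 4 1 = axis 4 1"
  obtains g where "g \<in> oct_aut" "g *v axis 4 1 = axis 4 1" "g ** t = t' ** g" "g ** s = s' ** g"
proof -
  note D = triple_2_4_5D[OF tri(1)] and D' = triple_2_4_5D[OF tri(2)]
  obtain p q r where b: "p \<in> minus_space" "q \<in> minus_space" "r \<in> minus_space" "form (p \<star> q) r = 4"
    "t *v p = p" "t *v q = - p - q" "t *v r = - p - r"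
    "(t ** s) *v p = r" "(t ** s) *v q = p" "(t ** s) *v r = q + 2 *s p - 2 *s r"
    using fixing_triple_basis[OF tri(1) type(1) e(1,2)] .
  obtain p' q' r' where b': "p' \<in> minus_space" "q' \<in> minus_space" "r' \<in> minus_space" "form (p' \<star> q') r' = 4"
    "t' *v p' = p'" "t' *v q' = - p' - q'" "t' *v r' = - p' - r'"
    "(t' ** s') *v p' = r'" "(t' ** s') *v q' = p'" "(t' ** s') *v r' = q' + 2 *s p' - 2 *s r'"
    using fixing_triple_basis[OF tri(2) type(2) e(3,4)] .
  obtain g where g: "g \<in> oct_aut" "g *v axis 4 1 = axis 4 1" "g *v p = p'" "g *v q = q'" "g *v r = r'"
    by (rule SL3_transitive[OF b(1-3) b'(1-3)]) (simp_all add: b(4) b'(4))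
  have det: "form (p \<star> q) r \<noteq> 0" by (simp add: b(4))
  have gt: "g ** t = t' ** g"
    by (rule oct_aut_ext_minus[OF oct_aut_mult[OF g(1) D(1)] oct_aut_mult[OF D'(1) g(1)] b(1-3) det])
       (simp_all add: b b' g vec.diff vec.neg flip: matrix_vector_mul_assoc)
  have zo: "t ** s \<in> oct_aut" "t' ** s' \<in> oct_aut" using D D' by (simp_all add: oct_aut_mult)
  have gz: "(g ** (t ** s)) *v v = g *v ((t ** s) *v v)" "((t' ** s') ** g) *v v = (t' ** s') *v (g *v v)" for v
    by (simp_all only: matrix_vector_mul_assoc matrix_mul_assoc)
  have "g ** (t ** s) = (t' ** s') ** g"
    by (rule oct_aut_ext_minus[OF oct_aut_mult[OF g(1) zo(1)] oct_aut_mult[OF zo(2) g(1)] b(1-3) det])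
       (simp_all only: gz b b' g vec.diff matrix_vector_right_distrib vector_scalar_commute)
  then have "g ** s = s' ** g" using conjugate_product gt D(2) D'(2) by blast
  with g(1,2) gt show thesis by (rule that)
qed

text \<open>
  The formula for \<open>t\<close> on the plus space transports from one triple to the other, and the plus space generates
  \<open>V\<close> under the product.
\<close>

lemma moving_triples_conjugate:
  assumes tri: "triple_2_4_5 t s" "triple_2_4_5 t' s'"
    and e: "t *v axis 4 1 = - axis 4 1" "s *v axis 4 1 = - axis 4 1" "t' *v axis 4 1 = - axis 4 1" "s' *v axis 4 1 = - axis 4 1"
  obtains g where "g \<in> oct_aut" "g ** t = t' ** g" "g ** s = s' ** g"
proof -
  note D = triple_2_4_5D[OF tri(1)] and D' = triple_2_4_5D[OF tri(2)]
  obtain p q r where b: "p \<in> minus_space" "q \<in> minus_space" "r \<in> minus_space" "form (p \<star> q) r = 2"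
    "(t ** s) *v p = r" "(t ** s) *v q = p" "(t ** s) *v r = q + 2 *s p - 2 *s r"
    and tx: "\<And>x. x \<in> plus_space \<Longrightarrow> t *v x = form r x *s (- 2 *s r - p) + form p x *s (2 *s p + 2 *s q - r)
      + form q x *s (2 *s p + q)"
    using moving_triple_basis[OF tri(1) e(1,2)] by blast
  obtain p' q' r' where b': "p' \<in> minus_space" "q' \<in> minus_space" "r' \<in> minus_space" "form (p' \<star> q') r' = 2"
    "(t' ** s') *v p' = r'" "(t' ** s') *v q' = p'" "(t' ** s') *v r' = q' + 2 *s p' - 2 *s r'"
    and tx': "\<And>x. x \<in> plus_space \<Longrightarrow> t' *v x = form r' x *s (- 2 *s r' - p') + form p' x *s (2 *s p' + 2 *s q' - r')
      + form q' x *s (2 *s p' + q')"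
    using moving_triple_basis[OF tri(2) e(3,4)] by blast
  obtain g where g: "g \<in> oct_aut" "g *v axis 4 1 = axis 4 1" "g *v p = p'" "g *v q = q'" "g *v r = r'"
    by (rule SL3_transitive[OF b(1-3) b'(1-3)]) (simp_all add: b(4) b'(4))
  have det: "form (p \<star> q) r \<noteq> 0" by (simp add: b(4))
  have zo: "t ** s \<in> oct_aut" "t' ** s' \<in> oct_aut" using D D' by (simp_all add: oct_aut_mult)
  have gz: "(g ** (t ** s)) *v v = g *v ((t ** s) *v v)" "((t' ** s') ** g) *v v = (t' ** s') *v (g *v v)" for v
    by (simp_all only: matrix_vector_mul_assoc matrix_mul_assoc)
  have gz: "g ** (t ** s) = (t' ** s') ** g"
    by (rule oct_aut_ext_minus[OF oct_aut_mult[OF g(1) zo(1)] oct_aut_mult[OF zo(2) g(1)] b(1-3) det])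
       (simp_all only: gz b b' g vec.diff matrix_vector_right_distrib vector_scalar_commute)
  have plus: "(g ** t) *v x = (t' ** g) *v x" if "x \<in> plus_space" for x
  proof -
    have "form p' (g *v x) = form p x" "form q' (g *v x) = form q x" "form r' (g *v x) = form r x"
      using oct_aut_form[OF g(1), of _ x] g(3-5) by metis+
    moreover have "g *v x \<in> plus_space" using fixes_axis_4(1)[OF g(1,2) that] .
    ultimately show ?thesis
      by (simp add: tx[OF that] tx' g(3-5) matrix_vector_right_distrib vec.diff vec.neg vector_scalar_commute
          flip: matrix_vector_mul_assoc)
  qed
  have AB: "g ** t \<in> oct_aut" "t' ** g \<in> oct_aut" using g(1) D(1) D'(1) by (simp_all add: oct_aut_mult)
  have cr: "(g ** t) *v (x \<star> y) = (t' ** g) *v (x \<star> y)" if "x \<in> plus_space" "y \<in> plus_space" for x y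
    using plus[OF that(1)] plus[OF that(2)] by (simp add: oct_aut_cross AB)
  have minus: "(g ** t) *v u = (t' ** g) *v u"
    if m: "u \<in> minus_space" "v \<in> minus_space" "w \<in> minus_space" "form (u \<star> v) w \<noteq> 0" for u v w
  proof -
    have "(g ** t) *v ((u \<star> v) \<star> (u \<star> w)) = (t' ** g) *v ((u \<star> v) \<star> (u \<star> w))"
      using m cross_plus_minus(2) by (intro cr) blast+
    then show ?thesis
      unfolding cross_of_crosses[OF m(1-3)] vector_scalar_commute using m(4) by simp
  qed
  have gt: "g ** t = t' ** g"
    by (rule oct_aut_ext_minus[OF AB b(1-3) det]; rule minus[OF b(1,2,3)] minus[OF b(2,3,1)] minus[OF b(3,1,2)])
       (simp_all add: det form_cross_rotate[of q r p] form_cross_rotate[of r p q])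
  have "g ** s = s' ** g" by (rule conjugate_product[OF gt gz D(2) D'(2)])
  with g(1) gt show thesis by (rule that)
qed

theorem triples_conjugate:
  assumes tri: "triple_2_4_5 t s" "triple_2_4_5 t' s'" and type: "fixes_square_fixed s \<longleftrightarrow> fixes_square_fixed s'"
  obtains g where "g \<in> oct_aut" "g ** t = t' ** g" "g ** s = s' ** g"
proof -
  obtain h u v where h: "h \<in> oct_aut" "h ** t = u ** h" "h ** s = v ** h" "triple_2_4_5 u v"
    "fixes_square_fixed v \<longleftrightarrow> fixes_square_fixed s"
    "u *v axis 4 1 = (if fixes_square_fixed s then axis 4 1 else - axis 4 1)"
    "v *v axis 4 1 = (if fixes_square_fixed s then axis 4 1 else - axis 4 1)"
    using triple_normal_form[OF tri(1)] .
  obtain h' u' v' where h': "h' \<in> oct_aut" "h' ** t' = u' ** h'" "h' ** s' = v' ** h'" "triple_2_4_5 u' v'"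
    "fixes_square_fixed v' \<longleftrightarrow> fixes_square_fixed s'"
    "u' *v axis 4 1 = (if fixes_square_fixed s' then axis 4 1 else - axis 4 1)"
    "v' *v axis 4 1 = (if fixes_square_fixed s' then axis 4 1 else - axis 4 1)"
    using triple_normal_form[OF tri(2)] .
  obtain k where k: "k \<in> oct_aut" "k ** u = u' ** k" "k ** v = v' ** k"
  proof (cases "fixes_square_fixed s")
    case True
    then have "fixes_square_fixed v" "fixes_square_fixed v'" "u *v axis 4 1 = axis 4 1" "v *v axis 4 1 = axis 4 1"
      "u' *v axis 4 1 = axis 4 1" "v' *v axis 4 1 = axis 4 1" using h h' type by simp_all
    from fixing_triples_conjugate[OF h(4) h'(4) this] show thesis using that by blast
  next
    case False
    then have "u *v axis 4 1 = - axis 4 1" "v *v axis 4 1 = - axis 4 1"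
      "u' *v axis 4 1 = - axis 4 1" "v' *v axis 4 1 = - axis 4 1" using h h' type by simp_all
    from moving_triples_conjugate[OF h(4) h'(4) this] show thesis using that by blast
  qed
  define j where "j = inv\<^bsub>G2\<^esub> h'"
  have j: "j \<in> oct_aut" "h' ** j = mat 1" "j ** h' = mat 1" using h'(1) by (simp_all add: j_def G2_inv)
  have move: "(j ** k ** h) ** x = x' ** (j ** k ** h)"
    if "h ** x = y ** h" "k ** y = y' ** k" "h' ** x' = y' ** h'" for x y x' y'
  proof -
    have "(j ** k ** h) ** x = j ** (k ** (h ** x))" by (simp add: matrix_mul_assoc)
    also have "\<dots> = j ** ((k ** y) ** h)" by (simp add: that(1) matrix_mul_assoc)
    also have "\<dots> = j ** (y' ** (h' ** j) ** k ** h)" by (simp add: that(2) j matrix_mul_assoc)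
    also have "\<dots> = (j ** (y' ** h')) ** (j ** k ** h)" by (simp add: matrix_mul_assoc)
    also have "\<dots> = (j ** h') ** x' ** (j ** k ** h)" by (simp add: that(3)[symmetric] matrix_mul_assoc)
    finally show ?thesis by (simp add: j)
  qed
  have "(j ** k ** h) ** t = t' ** (j ** k ** h)" "(j ** k ** h) ** s = s' ** (j ** k ** h)"
    using move h(2,3) k(2,3) h'(2,3) by blast+
  moreover have "j ** k ** h \<in> oct_aut" using j(1) k(1) h(1) by (intro oct_aut_mult)
  ultimately show thesis using that by blast
qed

section \<open>The symmetric group of degree five\<close>

text \<open>
  Five vectors with sum zero whose differences span the minus space. As \<open>5 = 0\<close>, this identifies the
  minus space with the vectors of coordinate sum zero in \<open>K\<^sup>5\<close> modulo the constants, \<open>mu i - mu j\<close> being the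
  image of the difference of two standard basis vectors.
\<close>

definition mu :: "nat \<Rightarrow> K ^ 7"
  where "mu i = (if i = 1 then vec7 0 1 1 0 0 0 1 else if i = 2 then vec7 0 0 1 0 0 0 1
    else if i = 3 then vec7 0 0 0 0 0 0 1 else if i = 5 then - vec7 0 1 2 0 0 0 3 else 0)"

lemma mu_minus: "mu i \<in> minus_space"
  by (auto simp: mu_def minus_space_iff)

lemma atLeastAtMost_1_5: "{1..5 :: nat} = {1, 2, 3, 4, 5}"
  by auto

lemma sum_1_5: "(\<Sum>k \<in> {1..5 :: nat}. f k) = f 1 + f 2 + f 3 + f 4 + f 5"
  unfolding atLeastAtMost_1_5 by (simp add: add.assoc)

lemma mu_values: "mu 1 = vec7 0 1 1 0 0 0 1" "mu 2 = vec7 0 0 1 0 0 0 1" "mu 3 = vec7 0 0 0 0 0 0 1"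
  "mu 4 = vec7 0 0 0 0 0 0 0" "mu 5 = vec7 0 (-1) (-2) 0 0 0 (-3)"
  by (rule vec7_eqI; simp add: mu_def)+

lemma mu_sum: "mu 1 + mu 2 + mu 3 + mu 4 + mu 5 = 0"
  by (rule vec7_eqI) (simp_all add: mu_def)

text \<open>
  The permutation module twisted by the sign character.
\<close>

definition perm_matrix :: "(nat \<Rightarrow> nat) \<Rightarrow> K ^ 7 ^ 7"
  where "perm_matrix \<sigma> = SL3_matrix (of_int (sign \<sigma>) *s (mu (\<sigma> 1) - mu (\<sigma> 2)))
    (of_int (sign \<sigma>) *s (mu (\<sigma> 2) - mu (\<sigma> 3))) (of_int (sign \<sigma>) *s (mu (\<sigma> 3) - mu (\<sigma> 4)))"

lemma mu_axis: "mu 1 - mu 2 = axis 2 1" "mu 2 - mu 3 = axis 3 1" "mu 3 - mu 4 = axis 7 1"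
  by (rule vec7_eqI; simp add: mu_def axis_nth)+

lemma perm_matrix_mu:
  assumes \<sigma>: "\<sigma> permutes {1..5}" and i: "i \<in> {1..5}" and j: "j \<in> {1..5}"
  shows "perm_matrix \<sigma> *v (mu i - mu j) = of_int (sign \<sigma>) *s (mu (\<sigma> i) - mu (\<sigma> j))"
proof -
  define M where "M = perm_matrix \<sigma>"
  define \<epsilon> :: K where "\<epsilon> = of_int (sign \<sigma>)"
  have b: "M *v (mu 1 - mu 2) = \<epsilon> *s (mu (\<sigma> 1) - mu (\<sigma> 2))" "M *v (mu 2 - mu 3) = \<epsilon> *s (mu (\<sigma> 2) - mu (\<sigma> 3))"
    "M *v (mu 3 - mu 4) = \<epsilon> *s (mu (\<sigma> 3) - mu (\<sigma> 4))"
    unfolding mu_axis M_def perm_matrix_def \<epsilon>_def by (rule SL3_matrix_axis)+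
  have b4: "M *v (mu k - mu 4) = \<epsilon> *s (mu (\<sigma> k) - mu (\<sigma> 4))" if "k \<in> {1, 2, 3, 4}" for k
  proof -
    have 3: "M *v (mu 3 - mu 4) = \<epsilon> *s (mu (\<sigma> 3) - mu (\<sigma> 4))" by (fact b)
    have add: "M *v (u + v) = \<epsilon> *s (u' + v')" if "M *v u = \<epsilon> *s u'" "M *v v = \<epsilon> *s v'" for u v u' v'
      using that by (simp only: matrix_vector_right_distrib vector_add_ldistrib)
    have 2: "M *v (mu 2 - mu 4) = \<epsilon> *s (mu (\<sigma> 2) - mu (\<sigma> 4))" using add[OF b(2,3)] by simp
    have "M *v (mu 1 - mu 4) = \<epsilon> *s (mu (\<sigma> 1) - mu (\<sigma> 4))" using add[OF b(1) 2] by simp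
    with 2 3 that show ?thesis by auto
  qed
  have "(\<Sum>k \<in> {1..5}. mu (\<sigma> k)) = (\<Sum>k \<in> {1..5}. mu k)" by (rule sum.permute[OF \<sigma>, symmetric, unfolded comp_def])
  then have s: "mu (\<sigma> 1) + mu (\<sigma> 2) + mu (\<sigma> 3) + mu (\<sigma> 4) + mu (\<sigma> 5) = 0"
    unfolding sum_1_5 mu_sum .
  have h: "M *v (mu 1 - mu 4) = \<epsilon> *s (mu (\<sigma> 1) - mu (\<sigma> 4))"
    "M *v (mu 2 - mu 4) = \<epsilon> *s (mu (\<sigma> 2) - mu (\<sigma> 4))"
    "M *v (mu 3 - mu 4) = \<epsilon> *s (mu (\<sigma> 3) - mu (\<sigma> 4))"
    by (rule b4; simp)+
  have "mu 5 - mu 4 = - (mu 1 - mu 4) - (mu 2 - mu 4) - (mu 3 - mu 4)"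
    by (rule vec7_eqI) (simp_all add: mu_def)
  then have "M *v (mu 5 - mu 4) = - (M *v (mu 1 - mu 4)) - M *v (mu 2 - mu 4) - M *v (mu 3 - mu 4)"
    by (simp only: vec.diff[of M "- (mu 1 - mu 4)" "mu 2 - mu 4"] vec.neg
        vec.diff[of M "- (mu 1 - mu 4) - (mu 2 - mu 4)" "mu 3 - mu 4"])
  also have "\<dots> = \<epsilon> *s (- (mu (\<sigma> 1) - mu (\<sigma> 4)) - (mu (\<sigma> 2) - mu (\<sigma> 4)) - (mu (\<sigma> 3) - mu (\<sigma> 4)))"
    by (simp only: h) (simp add: vec_eq_iff algebra_simps)
  also have "- (mu (\<sigma> 1) - mu (\<sigma> 4)) - (mu (\<sigma> 2) - mu (\<sigma> 4)) - (mu (\<sigma> 3) - mu (\<sigma> 4))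
      = (mu (\<sigma> 5) - mu (\<sigma> 4)) + 5 *s mu (\<sigma> 4) - (mu (\<sigma> 1) + mu (\<sigma> 2) + mu (\<sigma> 3) + mu (\<sigma> 4) + mu (\<sigma> 5))"
    by (simp add: vec_eq_iff)
  also have "\<dots> = mu (\<sigma> 5) - mu (\<sigma> 4)" by (simp only: s five_eq_0_K) simp
  finally have "M *v (mu k - mu 4) = \<epsilon> *s (mu (\<sigma> k) - mu (\<sigma> 4))" if "k \<in> {1..5}" for k
    using that b4[of k] unfolding atLeastAtMost_1_5 by auto
  then have k: "M *v (mu i - mu 4) = \<epsilon> *s (mu (\<sigma> i) - mu (\<sigma> 4))" "M *v (mu j - mu 4) = \<epsilon> *s (mu (\<sigma> j) - mu (\<sigma> 4))"
    using i j by blast+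
  have "M *v ((mu i - mu 4) - (mu j - mu 4)) = \<epsilon> *s ((mu (\<sigma> i) - mu (\<sigma> 4)) - (mu (\<sigma> j) - mu (\<sigma> 4)))"
    unfolding vec.diff[of M "mu i - mu 4" "mu j - mu 4"] k vector_ssub_ldistrib[symmetric] ..
  then show ?thesis by (simp add: M_def \<epsilon>_def)
qed

text \<open>
  The volume of the images of \<open>e\<^sub>2, e\<^sub>3, e\<^sub>7\<close> under the permutation, without the sign.
\<close>

definition perm_det :: "(nat \<Rightarrow> nat) \<Rightarrow> K"
  where "perm_det \<sigma> = form ((mu (\<sigma> 1) - mu (\<sigma> 2)) \<star> (mu (\<sigma> 2) - mu (\<sigma> 3))) (mu (\<sigma> 3) - mu (\<sigma> 4))"

lemma vec7_diff: "vec7 a b c d e f g - vec7 a' b' c' d' e' f' g' =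
    vec7 (a - a') (b - b') (c - c') (d - d') (e - e') (f - f') (g - g')"
  by (rule vec7_eqI) simp_all

lemma minus_det: "form (vec7 0 a b 0 0 0 c \<star> vec7 0 a' b' 0 0 0 c') (vec7 0 a'' b'' 0 0 0 c'') =
    4 * (a * (b' * c'' - c' * b'') - b * (a' * c'' - c' * a'') + c * (a' * b'' - b' * a''))"
  by (simp add: cross_def form_def algebra_simps)

lemma perm_det_transpose:
  assumes "a \<in> {1..5}" "b \<in> {1..5}" "a \<noteq> b"
  shows "perm_det (Transposition.transpose a b) = - 4"
  using assms unfolding atLeastAtMost_1_5
  by (elim insertE emptyE; simp add: perm_det_def Transposition.transpose_def mu_values[unfolded One_nat_def]
      vec7_diff minus_det char_5)

lemma perm_matrix_oct_aut_if_det: "of_int (sign \<sigma>) * perm_det \<sigma> = 4 \<Longrightarrow> perm_matrix \<sigma> \<in> oct_aut"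
  unfolding perm_matrix_def
proof (intro SL3_matrix_oct_aut plus_minus_closed mu_minus)
  have "of_int (sign \<sigma>) * of_int (sign \<sigma>) = (1 :: K)" by (metis of_int_1 of_int_mult sign_idempotent)
  then have s: "of_int (sign \<sigma>) * (of_int (sign \<sigma>) * x) = x" for x :: K by (simp flip: mult.assoc)
  have cube: "form ((e *s x) \<star> (e *s y)) (e *s z) = e * (e * (e * form (x \<star> y) z))" for e x y z by simp
  assume "of_int (sign \<sigma>) * perm_det \<sigma> = 4"
  then show "form ((of_int (sign \<sigma>) *s (mu (\<sigma> 1) - mu (\<sigma> 2))) \<star> (of_int (sign \<sigma>) *s (mu (\<sigma> 2) - mu (\<sigma> 3))))
      (of_int (sign \<sigma>) *s (mu (\<sigma> 3) - mu (\<sigma> 4))) = 4"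
    unfolding perm_det_def by (simp only: cube) (simp only: s)
qed

lemma sign_perm_compose: "\<sigma> permutes {1..5 :: nat} \<Longrightarrow> \<tau> permutes {1..5} \<Longrightarrow> sign (\<sigma> \<circ> \<tau>) = sign \<sigma> * sign \<tau>"
  by (intro sign_compose) (auto simp: permutation_permutes)

text \<open>
  Composition with a transposition changes the sign of the volume, by transporting \<open>perm_det_transpose\<close> with an
  automorphism that is already known.
\<close>

lemma perm_det_sign:
  assumes "\<sigma> permutes {1..5}"
  shows "of_int (sign \<sigma>) * perm_det \<sigma> = 4"
  using finite_atLeastAtMost assms
proof (induction rule: permutes_rev_induct)
  case id
  show ?case unfolding perm_det_def id_apply mu_axis cross_axis by (simp add: form_def axis_nth)
next
  case (swap a b p)
  have A: "perm_matrix p \<in> oct_aut" by (rule perm_matrix_oct_aut_if_det[OF swap.IH])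
  define \<epsilon> :: K where "\<epsilon> = of_int (sign p)"
  have ee: "\<epsilon> * \<epsilon> = 1" unfolding \<epsilon>_def by (metis of_int_1 of_int_mult sign_idempotent)
  have cube: "form ((e *s x) \<star> (e *s y)) (e *s z) = e * (e * (e * form (x \<star> y) z))" for e x y z by simp
  define d where "d i j = mu (Transposition.transpose a b i) - mu (Transposition.transpose a b j)" for i j
  have t: "Transposition.transpose a b i \<in> {1..5}" if "i \<in> {1..5}" for i
    using that swap.hyps(1,2) by (auto simp: Transposition.transpose_def)
  have m: "perm_matrix p *v d i j = \<epsilon> *s (mu ((p \<circ> Transposition.transpose a b) i) - mu ((p \<circ> Transposition.transpose a b) j))"
    if "i \<in> {1..5}" "j \<in> {1..5}" for i j
    unfolding d_def \<epsilon>_def using perm_matrix_mu[OF swap.hyps(4) t t] that by simp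
  have mm: "perm_matrix p *v d 1 2 = \<epsilon> *s (mu ((p \<circ> Transposition.transpose a b) 1) - mu ((p \<circ> Transposition.transpose a b) 2))"
    "perm_matrix p *v d 2 3 = \<epsilon> *s (mu ((p \<circ> Transposition.transpose a b) 2) - mu ((p \<circ> Transposition.transpose a b) 3))"
    "perm_matrix p *v d 3 4 = \<epsilon> *s (mu ((p \<circ> Transposition.transpose a b) 3) - mu ((p \<circ> Transposition.transpose a b) 4))"
    by (rule m; simp)+
  have "- 4 = form (d 1 2 \<star> d 2 3) (d 3 4)" using perm_det_transpose[OF swap.hyps(1-3)] by (simp add: perm_det_def d_def)
  also have "\<dots> = form ((perm_matrix p *v d 1 2) \<star> (perm_matrix p *v d 2 3)) (perm_matrix p *v d 3 4)"
    by (simp only: oct_aut_form[OF A] oct_aut_cross[OF A, symmetric])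
  also have "\<dots> = \<epsilon> * (\<epsilon> * (\<epsilon> * perm_det (p \<circ> Transposition.transpose a b)))"
    unfolding mm cube perm_det_def ..
  also have "\<dots> = \<epsilon> * perm_det (p \<circ> Transposition.transpose a b)" by (simp add: ee flip: mult.assoc)
  finally have eq: "\<epsilon> * perm_det (p \<circ> Transposition.transpose a b) = - 4" by (rule sym)
  have sg: "sign (p \<circ> Transposition.transpose a b) = - sign p"
    using swap.hyps by (simp add: sign_perm_compose sign_swap_id permutes_swap_id)
  show ?case unfolding sg of_int_minus mult_minus_left eq[unfolded \<epsilon>_def] by (rule minus_minus)
qed

lemma perm_matrix_oct_aut: "\<sigma> permutes {1..5} \<Longrightarrow> perm_matrix \<sigma> \<in> oct_aut"
  by (intro perm_matrix_oct_aut_if_det perm_det_sign)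

lemma axis_237_minus: "axis 2 1 \<in> minus_space" "axis 3 1 \<in> minus_space" "axis 7 1 \<in> minus_space"
  "form (axis 2 1 \<star> axis 3 1) (axis 7 1 :: K ^ 7) \<noteq> 0"
  by (simp_all add: minus_space_iff axis_nth cross_axis) (simp add: form_def axis_nth)

lemma oct_aut_ext_mu:
  assumes "A \<in> oct_aut" "B \<in> oct_aut"
    and "\<And>i j. i \<in> {1..5} \<Longrightarrow> j \<in> {1..5} \<Longrightarrow> A *v (mu i - mu j) = B *v (mu i - mu j)"
  shows "A = B"
  by (rule oct_aut_ext_minus[OF assms(1,2) axis_237_minus]; unfold mu_axis[symmetric]; rule assms(3); simp)

lemma perm_matrix_compose:
  assumes "\<sigma> permutes {1..5}" "\<tau> permutes {1..5}"
  shows "perm_matrix (\<sigma> \<circ> \<tau>) = perm_matrix \<sigma> ** perm_matrix \<tau>"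
proof (rule oct_aut_ext_mu)
  have st: "\<sigma> \<circ> \<tau> permutes {1..5}" using assms by (rule permutes_compose[rotated])
  show "perm_matrix (\<sigma> \<circ> \<tau>) \<in> oct_aut" using st by (rule perm_matrix_oct_aut)
  show "perm_matrix \<sigma> ** perm_matrix \<tau> \<in> oct_aut" using assms by (intro oct_aut_mult perm_matrix_oct_aut)
  fix i j :: nat assume ij: "i \<in> {1..5}" "j \<in> {1..5}"
  have t: "\<tau> i \<in> {1..5}" "\<tau> j \<in> {1..5}" using ij permutes_in_image[OF assms(2)] by blast+
  show "perm_matrix (\<sigma> \<circ> \<tau>) *v (mu i - mu j) = (perm_matrix \<sigma> ** perm_matrix \<tau>) *v (mu i - mu j)"
    unfolding matrix_vector_mul_assoc[symmetric] perm_matrix_mu[OF assms(2) ij] perm_matrix_mu[OF st ij]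
      vector_scalar_commute perm_matrix_mu[OF assms(1) t] vector_smult_assoc
    by (simp add: sign_perm_compose[OF assms] mult.commute)
qed

lemma perm_matrix_axis_4: "perm_matrix \<sigma> *v axis 4 1 = axis 4 1"
  unfolding perm_matrix_def by (rule SL3_matrix_axis)

text \<open>
  The involution that corresponds to the invariant symmetric form of the permutation module: up to a constant,
  \<open>form (perm_twist *v x) y\<close> is the standard form \<open>\<Sum> x\<^sub>i y\<^sub>i\<close> on the vectors of coordinate sum zero in
  \<open>K\<^sup>5\<close>, as \<open>perm_twist_difference\<close> shows. It interchanges the plus space and the minus space.
\<close>

definition perm_twist :: "K ^ 7 ^ 7"
  where "perm_twist = transpose (vec7 (vec7 0 1 2 0 0 0 (-2)) (vec7 0 0 0 0 1 2 0) (vec7 1 0 0 0 (-2) (-1) 0)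
    (- axis 4 1) (vec7 0 2 (-1) 0 0 0 2) (vec7 0 2 (-2) 0 0 0 (-1)) (vec7 (-2) 0 0 0 1 0 0))"

lemma perm_twist_vec: "perm_twist *v x = vec7 (x$3 - 2 * x$7) (x$1 + 2 * x$5 + 2 * x$6)
    (2 * x$1 - x$5 - 2 * x$6) (- x$4) (x$2 - 2 * x$3 + x$7) (2 * x$2 - x$3) (2 * x$5 - 2 * x$1 - x$6)"
  by (rule vec7_eqI; simp add: perm_twist_def matrix_vector_mult_def Finite_Cartesian_Product.transpose_def sum_7 axis_nth algebra_simps)

lemma perm_twist_oct_aut: "perm_twist \<in> oct_aut"
  by (auto intro!: vec7_eqI simp: oct_aut_def perm_twist_vec cross_def form_def algebra_simps char_5)

lemma perm_twist_square: "perm_twist *v (perm_twist *v v) = v"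
  by (rule vec7_eqI; simp add: perm_twist_vec algebra_simps char_5)

lemma perm_twist_axis_4: "perm_twist *v axis 4 1 = - axis 4 1"
  by (rule vec7_eqI; simp add: perm_twist_vec axis_nth)

lemma perm_twist_mu:
  assumes "i \<in> {1..5}" "k \<in> {1..5}"
  shows "form (perm_twist *v mu i) (mu k) =
    3 * ((if i = k then 1 else 0) + (if i = 4 then 2 else 3) + (if k = 4 then 2 else 3))"
  using assms unfolding atLeastAtMost_1_5
  by (elim insertE emptyE; simp add: perm_twist_vec mu_values[unfolded One_nat_def] form_def char_5)

lemma perm_twist_difference:
  assumes "i \<in> {1..5}" "j \<in> {1..5}" "k \<in> {1..5}" "l \<in> {1..5}"
  shows "form (perm_twist *v (mu i - mu j)) (mu k - mu l) =
    3 * ((if i = k then 1 else 0) - (if i = l then 1 else 0) - (if j = k then 1 else 0) + (if j = l then 1 else 0))"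
  unfolding vec.diff form_simps perm_twist_mu[OF assms(1,3)] perm_twist_mu[OF assms(1,4)]
    perm_twist_mu[OF assms(2,3)] perm_twist_mu[OF assms(2,4)]
  by (simp only: algebra_simps)

text \<open>
  The standard form recovers the indices from a difference.
\<close>

lemma mu_difference_inject:
  assumes ij: "i \<in> {1..5}" "j \<in> {1..5}" and kl: "k \<in> {1..5}" "l \<in> {1..5}" and ne: "k \<noteq> l"
    and eq: "c *s (mu i - mu j) = mu k - mu l" and c: "c = 1 \<or> c = -1"
  shows "{i, j} = {k, l}"
proof -
  have "c * form (perm_twist *v (mu i - mu j)) (mu k - mu l) = form (perm_twist *v (mu k - mu l)) (mu k - mu l)"
    using arg_cong[OF eq, of "\<lambda>x. form (perm_twist *v x) (mu k - mu l)"]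
    by (simp only: vector_scalar_commute form_simps(7))
  then have "c * (3 * ((if i = k then 1 else 0) - (if i = l then 1 else 0) - (if j = k then 1 else 0)
      + (if j = l then 1 else 0))) = 3 * 2"
    unfolding perm_twist_difference[OF ij kl] perm_twist_difference[OF kl kl] using ne by simp
  then show ?thesis using c ne by (auto split: if_splits simp: char_5)
qed

lemma perm_matrix_eq_one:
  assumes \<sigma>: "\<sigma> permutes {1..5}" and one: "perm_matrix \<sigma> = mat 1"
  shows "\<sigma> = id"
proof -
  have im: "\<sigma> i \<in> {1..5}" if "i \<in> {1..5}" for i using that permutes_in_image[OF \<sigma>] by blast
  have s: "{\<sigma> k, \<sigma> l} = {k, l}" if "k \<in> {1..5}" "l \<in> {1..5}" "k \<noteq> l" for k l
  proof (rule mu_difference_inject[OF im[OF that(1)] im[OF that(2)] that])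
    show "of_int (sign \<sigma>) = (1 :: K) \<or> of_int (sign \<sigma>) = (-1 :: K)" by (simp add: sign_def)
    show "of_int (sign \<sigma>) *s (mu (\<sigma> k) - mu (\<sigma> l)) = mu k - mu l"
      using perm_matrix_mu[OF \<sigma> that(1,2)] by (simp add: one)
  qed
  have 1: "\<sigma> 1 = 1" using s[of 1 2] s[of 1 3] by (auto simp: doubleton_eq_iff)
  have "\<sigma> k = k" if k: "k \<in> {1..5}" for k
    using s[of 1 k] k 1 by (cases "k = 1") (auto simp: doubleton_eq_iff)
  then show "\<sigma> = id" using permutes_not_in[OF \<sigma>] by (metis eq_id_iff)
qed


text \<open>
  The form given by \<open>perm_twist\<close> is invariant under permutations.
\<close>

lemma perm_twist_commutes:
  assumes \<sigma>: "\<sigma> permutes {1..5}"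
  shows "perm_twist ** perm_matrix \<sigma> = perm_matrix \<sigma> ** perm_twist"
proof (rule oct_aut_ext_mu)
  have A: "perm_matrix \<sigma> \<in> oct_aut" using \<sigma> by (rule perm_matrix_oct_aut)
  then show "perm_twist ** perm_matrix \<sigma> \<in> oct_aut" "perm_matrix \<sigma> ** perm_twist \<in> oct_aut"
    by (simp_all add: oct_aut_mult perm_twist_oct_aut)
  fix i j :: nat assume ij: "i \<in> {1..5}" "j \<in> {1..5}"
  have im: "\<sigma> i \<in> {1..5}" if "i \<in> {1..5}" for i using that permutes_in_image[OF \<sigma>] by blast
  have inj: "\<sigma> k = \<sigma> l \<longleftrightarrow> k = l" for k l using permutes_inj[OF \<sigma>] by (simp add: inj_eq)
  have ee: "of_int (sign \<sigma>) * (of_int (sign \<sigma>) * x) = x" for x :: K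
    by (metis mult.assoc mult_1 of_int_1 of_int_mult sign_idempotent)
  define v where "v = perm_twist *v (perm_matrix \<sigma> *v (mu i - mu j)) - perm_matrix \<sigma> *v (perm_twist *v (mu i - mu j))"
  have d: "mu i - mu j \<in> minus_space" for i j by (intro plus_minus_closed mu_minus)
  have p: "perm_twist *v x \<in> plus_space" if "x \<in> minus_space" for x
    using negates_axis_4[OF perm_twist_oct_aut perm_twist_axis_4] that by blast
  have f: "perm_matrix \<sigma> *v x \<in> minus_space" if "x \<in> minus_space" for x
    using fixes_axis_4[OF A perm_matrix_axis_4] that by blast
  have f': "perm_matrix \<sigma> *v x \<in> plus_space" if "x \<in> plus_space" for x
    using fixes_axis_4[OF A perm_matrix_axis_4] that by blast
  have v: "v \<in> plus_space" unfolding v_def by (intro plus_minus_closed p f f' d)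
  have o: "form (perm_matrix \<sigma> *v (mu k - mu l)) v = 0" if kl: "k \<in> {1..5}" "l \<in> {1..5}" for k l
  proof -
    have "form (perm_twist *v (perm_matrix \<sigma> *v (mu i - mu j))) (perm_matrix \<sigma> *v (mu k - mu l))
        = form (perm_twist *v (mu i - mu j)) (mu k - mu l)"
      unfolding perm_matrix_mu[OF \<sigma> ij] perm_matrix_mu[OF \<sigma> kl] vector_scalar_commute form_simps(7,8) ee
        perm_twist_difference[OF im[OF ij(1)] im[OF ij(2)] im[OF kl(1)] im[OF kl(2)]]
        perm_twist_difference[OF ij kl] inj ..
    then show ?thesis
      unfolding form_sym[of _ v] unfolding v_def form_simps(3) by (simp only: oct_aut_form[OF A]) simp
  qed
  have 5: "1 \<in> {1..5 :: nat}" "2 \<in> {1..5 :: nat}" "3 \<in> {1..5 :: nat}" "4 \<in> {1..5 :: nat}" by simp_all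
  have "form ((perm_matrix \<sigma> *v (mu 1 - mu 2)) \<star> (perm_matrix \<sigma> *v (mu 2 - mu 3)))
      (perm_matrix \<sigma> *v (mu 3 - mu 4)) \<noteq> 0"
    unfolding oct_aut_cross[OF A, symmetric] oct_aut_form[OF A] mu_axis by (rule axis_237_minus)
  then have "v = 0"
    by (rule orthogonal_to_minus_basis[OF f[OF d] f[OF d] f[OF d] _ v o[OF 5(1,2)] o[OF 5(2,3)] o[OF 5(3,4)]])
  then show "(perm_twist ** perm_matrix \<sigma>) *v (mu i - mu j) = (perm_matrix \<sigma> ** perm_twist) *v (mu i - mu j)"
    by (simp add: v_def flip: matrix_vector_mul_assoc)
qed

text \<open>
  Two embeddings of \<open>Sym\<^sub>5\<close> in \<open>G\<^sub>2(K)\<close>; in the second one the odd permutations are multiplied by the commuting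
  involution and therefore negate \<open>e\<^sub>4\<close>.
\<close>

definition sym_rep :: "bool \<Rightarrow> (nat \<Rightarrow> nat) \<Rightarrow> K ^ 7 ^ 7"
  where "sym_rep b \<sigma> = (if b \<or> sign \<sigma> = 1 then perm_matrix \<sigma> else perm_matrix \<sigma> ** perm_twist)"

lemma sym_rep_oct_aut: "\<sigma> permutes {1..5} \<Longrightarrow> sym_rep b \<sigma> \<in> oct_aut"
  by (simp add: sym_rep_def perm_matrix_oct_aut oct_aut_mult perm_twist_oct_aut)

lemma sym_rep_compose:
  assumes "\<sigma> permutes {1..5}" "\<tau> permutes {1..5}"
  shows "sym_rep b (\<sigma> \<circ> \<tau>) = sym_rep b \<sigma> ** sym_rep b \<tau>"
proof -
  define A where "A = perm_matrix \<sigma>"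
  define B where "B = perm_matrix \<tau>"
  have ww: "perm_twist ** perm_twist = mat 1"
    by (simp add: matrix_vector_eq perm_twist_square flip: matrix_vector_mul_assoc)
  have wB: "perm_twist ** B = B ** perm_twist" unfolding B_def by (rule perm_twist_commutes[OF assms(2)])
  have AB: "perm_matrix (\<sigma> \<circ> \<tau>) = A ** B" unfolding A_def B_def by (rule perm_matrix_compose[OF assms])
  have "(A ** perm_twist) ** B = A ** (perm_twist ** B)" by (simp only: matrix_mul_assoc)
  then have m1: "(A ** perm_twist) ** B = (A ** B) ** perm_twist" by (simp only: wB matrix_mul_assoc)
  have "(A ** perm_twist) ** (B ** perm_twist) = ((A ** perm_twist) ** B) ** perm_twist" by (simp only: matrix_mul_assoc)
  also have "\<dots> = (A ** B) ** (perm_twist ** perm_twist)" by (simp only: m1 matrix_mul_assoc)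
  finally have m2: "(A ** perm_twist) ** (B ** perm_twist) = A ** B" by (simp add: ww)
  have m3: "A ** (B ** perm_twist) = (A ** B) ** perm_twist" by (simp only: matrix_mul_assoc)
  have sg: "sign (\<sigma> \<circ> \<tau>) = sign \<sigma> * sign \<tau>" by (rule sign_perm_compose[OF assms])
  show ?thesis
    unfolding sym_rep_def AB sg A_def[symmetric] B_def[symmetric]
    by (cases \<sigma> rule: sign_cases; cases \<tau> rule: sign_cases; cases b; simp add: m1 m2 m3)
qed

lemma sym_rep_eq_one:
  assumes \<sigma>: "\<sigma> permutes {1..5}" and one: "sym_rep b \<sigma> = mat 1"
  shows "\<sigma> = id"
proof (cases "b \<or> sign \<sigma> = 1")
  case True
  then show ?thesis using perm_matrix_eq_one[OF \<sigma>] one by (simp add: sym_rep_def)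
next
  case False
  then have "sym_rep b \<sigma> *v axis 4 1 = - axis 4 1"
    by (simp add: sym_rep_def perm_twist_axis_4 perm_matrix_axis_4 vec.neg flip: matrix_vector_mul_assoc)
  then have "axis 4 1 = (- axis 4 1 :: K ^ 7)" by (simp only: one matrix_vector_mul_lid)
  from arg_cong[OF this, of "\<lambda>v. v $ 4"] show ?thesis by (simp add: axis_nth)
qed

lemma sym_rep_id: "sym_rep b id = mat 1"
proof -
  have i: "id permutes {1..5 :: nat}" by (rule permutes_id)
  have o: "sym_rep b id \<in> oct_aut" using i by (rule sym_rep_oct_aut)
  have "sym_rep b id ** sym_rep b id = sym_rep b id" using sym_rep_compose[OF i i, of b] by simp
  then have "sym_rep b id ** (sym_rep b id ** inv\<^bsub>G2\<^esub> (sym_rep b id)) = sym_rep b id ** inv\<^bsub>G2\<^esub> (sym_rep b id)"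
    by (simp add: matrix_mul_assoc)
  then show ?thesis by (simp add: G2_inv[OF o])
qed

definition swap_12 :: "nat \<Rightarrow> nat"
  where "swap_12 = Transposition.transpose 1 2"

definition cycle_5 :: "nat \<Rightarrow> nat"
  where "cycle_5 i = (if i = 5 then 1 else if 1 \<le> i \<and> i \<le> 4 then i + 1 else i)"

definition cycle_5_inv :: "nat \<Rightarrow> nat"
  where "cycle_5_inv i = (if i = 1 then 5 else if 2 \<le> i \<and> i \<le> 5 then i - 1 else i)"

lemma cycle_5_swaps: "cycle_5 = Transposition.transpose 1 2 \<circ> Transposition.transpose 2 3 \<circ>
    Transposition.transpose 3 4 \<circ> Transposition.transpose 4 5"
  by (rule ext) (auto simp: cycle_5_def Transposition.transpose_def)

lemma cycle_5_inv_power: "cycle_5_inv = cycle_5 \<circ> cycle_5 \<circ> cycle_5 \<circ> cycle_5"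
  by (rule ext) (auto simp: cycle_5_def cycle_5_inv_def)

lemma generators_permute:
  "swap_12 permutes {1..5}" "cycle_5 permutes {1..5}" "cycle_5_inv permutes {1..5}"
  "swap_12 \<circ> cycle_5_inv permutes {1..5}"
proof -
  show s: "swap_12 permutes {1..5}" unfolding swap_12_def by (rule permutes_swap_id) auto
  show c: "cycle_5 permutes {1..5}"
    unfolding cycle_5_swaps by (intro permutes_compose permutes_swap_id) auto
  show d: "cycle_5_inv permutes {1..5}" unfolding cycle_5_inv_power by (intro permutes_compose c)
  show "swap_12 \<circ> cycle_5_inv permutes {1..5}" by (intro permutes_compose d s)
qed

lemma sign_swap_12: "sign swap_12 = - 1"
  by (simp add: swap_12_def sign_swap_id)

lemma sign_cycle_5_inv: "sign cycle_5_inv = 1"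
proof -
  have "sign cycle_5 * sign cycle_5 = 1" by (rule sign_idempotent)
  then show ?thesis
    unfolding cycle_5_inv_power by (simp del: One_nat_def add: sign_perm_compose permutes_compose generators_permute)
qed

text \<open>
  Conjugation by the 5-cycle turns (1 2) into the other transpositions of neighbours, and these give all transpositions.
\<close>

lemma generated_by_swap_and_cycle:
  assumes one: "id \<in> H" and comp: "\<And>\<sigma> \<tau>. \<sigma> \<in> H \<Longrightarrow> \<tau> \<in> H \<Longrightarrow> \<sigma> \<circ> \<tau> \<in> H"
    and gen: "swap_12 \<in> H" "cycle_5 \<in> H"
    and \<sigma>: "\<sigma> permutes {1..5}"
  shows "\<sigma> \<in> H"
proof -
  have cinv: "cycle_5_inv \<in> H" unfolding cycle_5_inv_power using comp gen(2) by blast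
  have step: "Transposition.transpose (a + 1) (a + 2) \<in> H"
    if "Transposition.transpose a (a + 1) \<in> H" "a \<in> {1, 2, 3}" for a
  proof -
    have "Transposition.transpose (a + 1) (a + 2) = cycle_5 \<circ> Transposition.transpose a (a + 1) \<circ> cycle_5_inv"
      using that(2) by (auto intro!: ext simp: Transposition.transpose_def cycle_5_def cycle_5_inv_def)
    then show ?thesis using comp gen(2) cinv that(1) by metis
  qed
  have 12: "Transposition.transpose 1 2 \<in> H" using gen(1) by (simp add: swap_12_def)
  have 23: "Transposition.transpose 2 3 \<in> H" using step[of 1] 12 by (simp add: numeral_eq_Suc)
  have 34: "Transposition.transpose 3 4 \<in> H" using step[of 2] 23 by (simp add: numeral_eq_Suc)
  have 45: "Transposition.transpose 4 5 \<in> H" using step[of 3] 34 by (simp add: numeral_eq_Suc)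
  have trip: "Transposition.transpose a c \<in> H"
    if "Transposition.transpose a b \<in> H" "Transposition.transpose b c \<in> H" for a b c :: nat
  proof (cases "a = c \<or> b = c")
    case True
    then show ?thesis using one that by auto
  next
    case False
    then have "Transposition.transpose a c = Transposition.transpose a b \<circ> Transposition.transpose b c \<circ> Transposition.transpose a b"
      by (simp add: transpose_comp_triple)
    then show ?thesis using comp that by metis
  qed
  have 13: "Transposition.transpose 1 3 \<in> H" using 12 23 by (rule trip)
  have 14: "Transposition.transpose 1 4 \<in> H" using 13 34 by (rule trip)
  have 15: "Transposition.transpose 1 5 \<in> H" using 14 45 by (rule trip)
  have 1: "Transposition.transpose 1 a \<in> H" if "a \<in> {1..5}" for a
    using that 12 13 14 15 one unfolding atLeastAtMost_1_5 by auto
  have "Transposition.transpose a b \<in> H" if "a \<in> {1..5}" "b \<in> {1..5}" for a b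
    using trip[of a 1 b] 1 that by (simp add: transpose_commute)
  with \<sigma> finite_atLeastAtMost show ?thesis
    by (induction rule: permutes_induct) (auto intro: one comp)
qed

lemma sym_rep_vec:
  assumes "\<sigma> permutes {1..5}" "\<tau> permutes {1..5}"
  shows "sym_rep b \<sigma> *v (sym_rep b \<tau> *v v) = sym_rep b (\<sigma> \<circ> \<tau>) *v v"
  by (simp add: sym_rep_compose[OF assms] matrix_vector_mul_assoc)

lemma perm_matrix_4_cycle:
  "perm_matrix (swap_12 \<circ> cycle_5_inv) = SL3_matrix (vec7 0 1 3 0 0 0 4) (vec7 0 1 0 0 0 0 0) (vec7 0 (-1) (-1) 0 0 0 0)"
proof -
  define \<sigma> where "\<sigma> = swap_12 \<circ> cycle_5_inv"
  have \<sigma>: "\<sigma> 1 = 5" "\<sigma> 2 = 2" "\<sigma> 3 = 1" "\<sigma> 4 = 3"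
    by (simp_all add: \<sigma>_def swap_12_def cycle_5_inv_def Transposition.transpose_def)
  have "sign \<sigma> = -1"
    unfolding \<sigma>_def by (simp del: One_nat_def add: sign_perm_compose generators_permute sign_swap_12 sign_cycle_5_inv)
  then have "perm_matrix \<sigma> = SL3_matrix (- (mu 5 - mu 2)) (- (mu 2 - mu 1)) (- (mu 1 - mu 3))"
    unfolding perm_matrix_def \<sigma> by (simp add: vec_eq_iff)
  moreover have "- (mu 5 - mu 2) = vec7 0 1 3 0 0 0 4" "- (mu 2 - mu 1) = vec7 0 1 0 0 0 0 0"
    "- (mu 1 - mu 3) = vec7 0 (-1) (-1) 0 0 0 0"
    by (rule vec7_eqI; simp add: mu_def)+
  ultimately show ?thesis by (simp add: \<sigma>_def)
qed

text \<open>
  In the second embedding the 4-cycle negates \<open>e\<^sub>4\<close>. In the first one its matrix \<open>S\<close> satisfies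
  \<open>(S - 1)(S\<^sup>2 + 1) = 0\<close>, so that \<open>S\<^sup>2 v = v\<close> implies \<open>2 (S - 1) v = 0\<close>.
\<close>

lemma sym_rep_4_cycle_type: "fixes_square_fixed (sym_rep b (swap_12 \<circ> cycle_5_inv)) \<longleftrightarrow> b"
proof (cases b)
  case True
  have "fixes_square_fixed (perm_matrix (swap_12 \<circ> cycle_5_inv))"
    unfolding fixes_square_fixed_def perm_matrix_4_cycle
  proof (intro allI impI)
    fix v :: "K ^ 7"
    define S where "S = SL3_matrix (vec7 0 1 3 0 0 0 4) (vec7 0 1 0 0 0 0 0) (vec7 0 (-1) (-1) 0 0 0 0)"
    have S: "S *v x = vec7 (2 * x$1 - 2 * x$5 + x$6) (x$2 + x$3 - x$7) (- 2 * x$2 - x$7)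
        (x$4) (- x$1 - x$5) (- x$5) (- x$2)" for x
      by (rule vec7_eqI; simp add: S_def SL3_matrix_vec cross_def axis_nth char_5)
    assume 2: "S *v (S *v v) = v"
    have "S *v (S *v (S *v v)) - S *v (S *v v) + S *v v - v = 0"
      by (rule vec7_eqI; simp add: S algebra_simps char_5)
    then have "2 *s (S *v v - v) = 0" unfolding 2 by (simp add: vec_eq_iff algebra_simps)
    then show "S *v v = v" by simp
  qed
  then show ?thesis using True by (simp add: sym_rep_def)
next
  case False
  define s where "s = sym_rep b (swap_12 \<circ> cycle_5_inv)"
  have "s *v axis 4 1 = - axis 4 1"
    using False by (simp del: One_nat_def add: s_def sym_rep_def sign_perm_compose generators_permute sign_swap_12 sign_cycle_5_inv
      perm_twist_axis_4 perm_matrix_axis_4 vec.neg flip: matrix_vector_mul_assoc)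
  moreover from this have "s *v (s *v axis 4 1) = axis 4 1" by (simp add: vec.neg)
  ultimately have "\<not> fixes_square_fixed s"
    unfolding fixes_square_fixed_def by (auto intro!: exI[of _ "axis 4 1"] simp: axis_nth dest: arg_cong[of _ _ "\<lambda>v. v $ 4"])
  with False show ?thesis by (simp add: s_def)
qed

lemma permutes_1_5_eq_id:
  fixes \<sigma> :: "nat \<Rightarrow> nat"
  assumes "\<sigma> permutes {1..5}" "\<sigma> 1 = 1" "\<sigma> 2 = 2" "\<sigma> 3 = 3" "\<sigma> 4 = 4" "\<sigma> 5 = 5"
  shows "\<sigma> = id"
proof
  fix i
  show "\<sigma> i = id i"
    using assms permutes_not_in[OF assms(1), of i] unfolding atLeastAtMost_1_5 by (cases "i \<in> {1, 2, 3, 4, 5}") auto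
qed

lemma generator_relations:
  "(swap_12 \<circ> cycle_5_inv) \<circ> ((swap_12 \<circ> cycle_5_inv) \<circ> ((swap_12 \<circ> cycle_5_inv) \<circ> (swap_12 \<circ> cycle_5_inv))) = id"
  "cycle_5_inv \<circ> (cycle_5_inv \<circ> (cycle_5_inv \<circ> (cycle_5_inv \<circ> cycle_5_inv))) = id"
  "cycle_5 \<circ> (cycle_5 \<circ> (cycle_5 \<circ> (cycle_5 \<circ> cycle_5))) = id"
  by (rule permutes_1_5_eq_id, (intro permutes_compose generators_permute);
      simp add: cycle_5_def cycle_5_inv_def swap_12_def Transposition.transpose_def)+

text \<open>
  The reference triple: (1 2), the 4-cycle (1 2)(5 4 3 2 1) and (1 2 3 4 5).
\<close>

lemma sym_rep_triple:
  shows "triple_2_4_5 (sym_rep b swap_12) (sym_rep b (swap_12 \<circ> cycle_5_inv))"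
    and "sym_rep b swap_12 ** sym_rep b (swap_12 \<circ> cycle_5_inv) ** sym_rep b cycle_5 = mat 1"
proof -
  note p = generators_permute
  have ss: "swap_12 \<circ> swap_12 = id" by (simp add: swap_12_def)
  have sc: "swap_12 \<circ> (swap_12 \<circ> cycle_5_inv) = cycle_5_inv" by (simp add: ss flip: comp_assoc)
  have ts: "sym_rep b swap_12 ** sym_rep b (swap_12 \<circ> cycle_5_inv) = sym_rep b cycle_5_inv"
    by (simp add: sc flip: sym_rep_compose[OF p(1,4)])
  have cc: "cycle_5_inv \<circ> cycle_5 = id" by (rule ext) (auto simp: cycle_5_def cycle_5_inv_def)
  show "sym_rep b swap_12 ** sym_rep b (swap_12 \<circ> cycle_5_inv) ** sym_rep b cycle_5 = mat 1"
    unfolding ts by (simp add: cc sym_rep_id flip: sym_rep_compose[OF p(3,2)])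
  have n1: "sym_rep b swap_12 \<noteq> mat 1"
  proof
    assume "sym_rep b swap_12 = mat 1"
    then have "swap_12 = id" by (rule sym_rep_eq_one[OF p(1)])
    from fun_cong[OF this, of 1] show False by (simp add: swap_12_def)
  qed
  have n2: "sym_rep b (swap_12 \<circ> cycle_5_inv) ** sym_rep b (swap_12 \<circ> cycle_5_inv) \<noteq> mat 1"
  proof
    assume "sym_rep b (swap_12 \<circ> cycle_5_inv) ** sym_rep b (swap_12 \<circ> cycle_5_inv) = mat 1"
    then have "(swap_12 \<circ> cycle_5_inv) \<circ> (swap_12 \<circ> cycle_5_inv) = id"
      unfolding sym_rep_compose[OF p(4,4), symmetric] by (rule sym_rep_eq_one[OF permutes_compose[OF p(4,4)]])
    from fun_cong[OF this, of 1] show False by (simp add: swap_12_def cycle_5_inv_def Transposition.transpose_def)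
  qed
  have s4': "sym_rep b (swap_12 \<circ> cycle_5_inv) *v (sym_rep b (swap_12 \<circ> cycle_5_inv) *v
      (sym_rep b (swap_12 \<circ> cycle_5_inv) *v (sym_rep b (swap_12 \<circ> cycle_5_inv) *v v))) = v" for v
    by (simp only: sym_rep_vec p permutes_compose generator_relations sym_rep_id matrix_vector_mul_lid)
  have z5: "((*v) (sym_rep b cycle_5_inv) ^^ 5) v = v" for v
  proof -
    have "((*v) (sym_rep b cycle_5_inv) ^^ 5) v = sym_rep b cycle_5_inv *v (sym_rep b cycle_5_inv *v
      (sym_rep b cycle_5_inv *v (sym_rep b cycle_5_inv *v (sym_rep b cycle_5_inv *v v))))"
      by (simp add: eval_nat_numeral)
    also have "\<dots> = v" by (simp only: sym_rep_vec p permutes_compose generator_relations sym_rep_id matrix_vector_mul_lid)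
    finally show ?thesis .
  qed
  have t2: "sym_rep b swap_12 *v (sym_rep b swap_12 *v v) = v" for v
    by (simp only: sym_rep_vec p ss sym_rep_id matrix_vector_mul_lid)
  show "triple_2_4_5 (sym_rep b swap_12) (sym_rep b (swap_12 \<circ> cycle_5_inv))"
    unfolding triple_2_4_5_def ts using n1 n2 s4' z5 t2 by (simp del: One_nat_def add: sym_rep_oct_aut p)
qed

text \<open>
  The triple is conjugate to the reference triple, whose preimages generate \<open>Sym\<^sub>5\<close>.
\<close>

lemma triple_generates_sym_5:
  assumes tri: "triple_2_4_5 t s" and u: "t ** s ** u = mat 1" and uG: "u \<in> oct_aut"
  shows "G2\<lparr>carrier := generate G2 {t, s, u}\<rparr> \<cong> sym_group 5"
proof -
  define b where "b = fixes_square_fixed s"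
  note p = generators_permute
  obtain g where g: "g \<in> oct_aut" "g ** sym_rep b swap_12 = t ** g"
    "g ** sym_rep b (swap_12 \<circ> cycle_5_inv) = s ** g"
    by (rule triples_conjugate[OF sym_rep_triple(1) tri]) (simp_all add: sym_rep_4_cycle_type b_def)
  define h where "h \<sigma> = g ** sym_rep b \<sigma> ** inv\<^bsub>G2\<^esub> g" for \<sigma>
  have gi: "g ** inv\<^bsub>G2\<^esub> g = mat 1" "inv\<^bsub>G2\<^esub> g ** g = mat 1" "inv\<^bsub>G2\<^esub> g \<in> oct_aut"
    using g(1) by (simp_all add: G2_inv)
  have c: "g ** A = B ** g \<Longrightarrow> g ** A ** inv\<^bsub>G2\<^esub> g = B" for A B
    by (simp add: gi flip: matrix_mul_assoc)
  have ht: "h swap_12 = t" "h (swap_12 \<circ> cycle_5_inv) = s"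
    unfolding h_def using c g by blast+
  interpret S: group "sym_group 5" by (rule sym_group_is_group)
  interpret G: group G2 by (rule group_G2)
  have hm: "h (\<sigma> \<circ> \<tau>) = h \<sigma> ** h \<tau>" if "\<sigma> permutes {1..5}" "\<tau> permutes {1..5}" for \<sigma> \<tau>
  proof -
    have "h \<sigma> ** h \<tau> = g ** (sym_rep b \<sigma> ** ((inv\<^bsub>G2\<^esub> g ** g) ** (sym_rep b \<tau> ** inv\<^bsub>G2\<^esub> g)))"
      by (simp only: h_def matrix_mul_assoc)
    then show ?thesis by (simp only: gi matrix_mul_lid) (simp add: h_def sym_rep_compose[OF that] matrix_mul_assoc)
  qed
  interpret h: group_hom "sym_group 5" G2 h
  proof (unfold_locales, rule homI)
    fix \<sigma> assume "\<sigma> \<in> carrier (sym_group 5)"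
    then show "h \<sigma> \<in> carrier G2"
      by (simp add: carrier_G2 h_def oct_aut_mult g gi sym_rep_oct_aut sym_group_carrier)
  next
    fix \<sigma> \<tau> assume "\<sigma> \<in> carrier (sym_group 5)" "\<tau> \<in> carrier (sym_group 5)"
    then show "h (\<sigma> \<otimes>\<^bsub>sym_group 5\<^esub> \<tau>) = h \<sigma> \<otimes>\<^bsub>G2\<^esub> h \<tau>"
      by (simp add: sym_group_mult sym_group_carrier G2_simps hm)
  qed
  have h1: "h swap_12 ** h (swap_12 \<circ> cycle_5_inv) ** h cycle_5 = mat 1"
  proof -
    have "swap_12 \<circ> (swap_12 \<circ> cycle_5_inv) \<circ> cycle_5 = id"
      by (rule ext) (auto simp: cycle_5_def cycle_5_inv_def swap_12_def Transposition.transpose_def)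
    then show ?thesis using h.hom_one
      by (simp del: One_nat_def add: sym_group_one G2_simps p permutes_compose flip: hm)
  qed
  have ts: "t ** s \<in> oct_aut" using tri by (simp add: triple_2_4_5_def oct_aut_mult)
  have hc: "h cycle_5 \<in> oct_aut" using h.hom_closed by (simp del: One_nat_def add: carrier_G2 sym_group_carrier p)
  have hu: "h cycle_5 = u"
    using G.l_cancel[of "t ** s" "h cycle_5" u] h1 u ts hc uG by (simp add: ht G2_simps carrier_G2)
  have inj: "inj_on h (carrier (sym_group 5))"
  proof (rule h.trivial_ker_imp_inj, intro equalityI subsetI)
    show "\<sigma> \<in> kernel (sym_group 5) G2 h" if "\<sigma> \<in> {\<one>\<^bsub>sym_group 5\<^esub>}" for \<sigma>
      using that by (simp add: kernel_def)
      fix \<sigma> assume "\<sigma> \<in> kernel (sym_group 5) G2 h"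
      then have \<sigma>: "\<sigma> permutes {1..5}" "h \<sigma> = mat 1" by (auto simp: kernel_def sym_group_carrier G2_simps)
      have "inv\<^bsub>G2\<^esub> g ** h \<sigma> ** g = (inv\<^bsub>G2\<^esub> g ** g) ** sym_rep b \<sigma> ** (inv\<^bsub>G2\<^esub> g ** g)"
        by (simp only: h_def matrix_mul_assoc)
      then have "sym_rep b \<sigma> = mat 1" by (simp add: \<sigma> gi)
      with \<sigma> show "\<sigma> \<in> {\<one>\<^bsub>sym_group 5\<^esub>}" by (simp add: sym_group_one sym_rep_eq_one)
  qed
  have sub: "{swap_12, swap_12 \<circ> cycle_5_inv, cycle_5} \<subseteq> carrier (sym_group 5)"
    using p by (simp add: sym_group_carrier)
  have gen: "generate (sym_group 5) {swap_12, swap_12 \<circ> cycle_5_inv, cycle_5} = carrier (sym_group 5)"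
  proof (intro equalityI subsetI)
    fix \<sigma> assume "\<sigma> \<in> carrier (sym_group 5)"
    then show "\<sigma> \<in> generate (sym_group 5) {swap_12, swap_12 \<circ> cycle_5_inv, cycle_5}"
      unfolding sym_group_carrier
      by (rule generated_by_swap_and_cycle[rotated -1])
        (auto intro: generate.incl generate.one[of "sym_group 5", unfolded sym_group_one]
          generate.eng[of _ "sym_group 5", unfolded sym_group_mult])
  qed (use S.generate_incl[OF sub] in blast)
  have img: "generate G2 {t, s, u} = h ` carrier (sym_group 5)"
    using h.generate_img[OF sub] gen by (simp add: ht hu)
  have "h \<in> iso (sym_group 5) (G2\<lparr>carrier := generate G2 {t, s, u}\<rparr>)"
    using inj h.homh by (auto simp: iso_def bij_betw_def img hom_def)
  then have "sym_group 5 \<cong> G2\<lparr>carrier := generate G2 {t, s, u}\<rparr>" by (rule is_isoI)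
  then show ?thesis by (rule S.iso_sym)
qed

section \<open>The class of the unipotent elements\<close>

text \<open>
  A vector with \<open>(z - 1)\<^sup>2 a \<noteq> 0\<close> is cyclic, and \<open>z\<close> acts on \<open>a, z a, z\<^sup>2 a\<close> through the same recurrence for all such
  \<open>z\<close>. A cube root rescales \<open>a\<close> so that the two bases have the same volume.
\<close>

lemma cyclic_unipotents_conjugate:
  assumes z: "unipotent_5 z" and a: "a \<in> minus_space" and sq: "(z - mat 1) *v ((z - mat 1) *v a) \<noteq> 0"
    and z': "unipotent_5 z'" and a': "a' \<in> minus_space" and sq': "(z' - mat 1) *v ((z' - mat 1) *v a') \<noteq> 0"
  obtains g where "g \<in> oct_aut" "g ** z = z' ** g"
proof -
  define d where "d = form (a \<star> (z *v a)) (z *v (z *v a))"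
  define d' where "d' = form (a' \<star> (z' *v a')) (z' *v (z' *v a'))"
  have d: "d \<noteq> 0" "d' \<noteq> 0" unfolding d_def d'_def by (rule cyclic_det; fact)+
  obtain c where c: "c ^ 3 = d / d'" using nth_root_exists[of 3 "d / d'"] by auto
  have zo: "z \<in> oct_aut" "z *v axis 4 1 = axis 4 1" "z' \<in> oct_aut" "z' *v axis 4 1 = axis 4 1"
    using z z' by (simp_all add: unipotent_5_def)
  have m: "z *v x \<in> minus_space" "z' *v x \<in> minus_space" if "x \<in> minus_space" for x
    using that fixes_axis_4[OF zo(1,2)] fixes_axis_4[OF zo(3,4)] by blast+
  have "form ((c *s a') \<star> (c *s (z' *v a'))) (c *s (z' *v (z' *v a'))) = c ^ 3 * d'"
    by (simp add: d'_def power3_eq_cube)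
  then have det: "d = form ((c *s a') \<star> (c *s (z' *v a'))) (c *s (z' *v (z' *v a')))" using c d by simp
  obtain g where g: "g \<in> oct_aut" "g *v axis 4 1 = axis 4 1" "g *v a = c *s a'" "g *v (z *v a) = c *s (z' *v a')"
    "g *v (z *v (z *v a)) = c *s (z' *v (z' *v a'))"
    by (rule SL3_transitive[OF a m(1)[OF a] m(1)[OF m(1)[OF a]] _ _ _ det[unfolded d_def] d(1)[unfolded d_def]])
      (auto intro!: plus_minus_closed m a')
  show thesis
  proof (rule that[OF g(1)], rule oct_aut_ext_minus)
    show "g ** z \<in> oct_aut" "z' ** g \<in> oct_aut" using g zo by (simp_all add: oct_aut_mult)
    show "a \<in> minus_space" "z *v a \<in> minus_space" "z *v (z *v a) \<in> minus_space" using a m by simp_all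
    show "form (a \<star> (z *v a)) (z *v (z *v a)) \<noteq> 0" using d by (simp add: d_def)
    show "(g ** z) *v a = (z' ** g) *v a" "(g ** z) *v (z *v a) = (z' ** g) *v (z *v a)"
      by (simp_all add: g vector_scalar_commute flip: matrix_vector_mul_assoc)
    show "(g ** z) *v (z *v (z *v a)) = (z' ** g) *v (z *v (z *v a))"
      using a a'
      by (simp add: g vector_scalar_commute unipotent_recurrence[OF z] unipotent_recurrence[OF z']
          vec.diff matrix_vector_right_distrib flip: matrix_vector_mul_assoc)
        (simp add: vec_eq_iff algebra_simps)
  qed
qed

lemma sym_rep_5_cycle_cyclic:
  fixes b :: bool
  defines "z \<equiv> sym_rep b cycle_5"
  shows "unipotent_5 z" "(z - mat 1) *v ((z - mat 1) *v (mu 1 - mu 2)) \<noteq> 0"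
proof -
  note p = generators_permute
  have sg: "sign cycle_5 = 1"
    unfolding cycle_5_swaps
    by (subst sign_perm_compose; (intro permutes_compose permutes_swap_id)?; simp add: sign_swap_id)+
  have zp: "z = perm_matrix cycle_5" by (simp add: z_def sym_rep_def sg)
  have z5: "((*v) (sym_rep b cycle_5) ^^ 5) v = v" for v
  proof -
    have "((*v) (sym_rep b cycle_5) ^^ 5) v = sym_rep b cycle_5 *v (sym_rep b cycle_5 *v
      (sym_rep b cycle_5 *v (sym_rep b cycle_5 *v (sym_rep b cycle_5 *v v))))"
      by (simp add: eval_nat_numeral)
    also have "\<dots> = v" by (simp only: sym_rep_vec p permutes_compose generator_relations sym_rep_id matrix_vector_mul_lid)
    finally show ?thesis .
  qed
  show "unipotent_5 z"
    unfolding unipotent_5_def using z5 perm_matrix_axis_4[of cycle_5]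
    by (simp del: One_nat_def add: z_def sym_rep_oct_aut p) (simp flip: z_def add: zp)
  have zm: "z *v (mu 1 - mu 2) = mu 2 - mu 3" "z *v (mu 2 - mu 3) = mu 3 - mu 4"
    unfolding zp using perm_matrix_mu[OF p(2), of 1 2] perm_matrix_mu[OF p(2), of 2 3]
    by (simp_all add: sg cycle_5_def numeral_eq_Suc)
  show "(z - mat 1) *v ((z - mat 1) *v (mu 1 - mu 2)) \<noteq> 0"
    unfolding minus_one_vec zm(1) unfolding vec.diff[of z "mu 2 - mu 3"] zm unfolding mu_axis
  proof
    assume "axis 7 1 - axis 3 1 - (axis 3 1 - axis 2 1) = (0 :: K ^ 7)"
    from arg_cong[OF this, of "\<lambda>v. v $ 2"] show False by (simp add: axis_nth)
  qed
qed

lemma subregular_product_cyclic: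
  defines "u \<equiv> root_element (0, 1) 1 ** root_element (3, 1) 1"
  shows "unipotent_5 u" "(u - mat 1) *v ((u - mat 1) *v axis 7 1) \<noteq> 0"
proof -
  have u: "u *v x = vec7 (x$1 + x$5) (x$2 + x$3 - x$7) (x$3 - x$7) (x$4) (x$5 + x$6) (x$6) (x$7)" for x
    unfolding u_def matrix_vector_mul_assoc[symmetric] by (rule vec7_eqI; simp add: root_element_vec)
  have 15: "(15 :: K) = 0"
  proof -
    have "(15 :: K) = 3 * 5" by simp
    then show ?thesis by (simp only: five_eq_0_K mult_zero_right)
  qed
  have "u *v axis 4 1 = axis 4 1" by (rule vec7_eqI; simp add: u axis_nth)
  moreover have "((*v) u ^^ 5) v = v" for v
    by (rule vec7_eqI; simp add: eval_nat_numeral u) (simp_all add: algebra_simps char_5 15)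
  moreover have "u \<in> oct_aut"
    unfolding u_def by (intro oct_aut_mult root_element_oct_aut root_cases)
  ultimately show "unipotent_5 u" by (simp add: unipotent_5_def)
  show "(u - mat 1) *v ((u - mat 1) *v axis 7 1) \<noteq> 0"
  proof
    assume "(u - mat 1) *v ((u - mat 1) *v axis 7 1) = 0"
    from arg_cong[OF this, of "\<lambda>v. v $ 2"] show False by (simp add: minus_one_vec u axis_nth)
  qed
qed

section \<open>Rigidity\<close>

lemma matrix_group_ord:
  fixes x :: "K ^ 'n ^ 'n" and G (structure)
  assumes G: "group G" "\<And>a b. a \<otimes> b = a ** b" "\<one> = mat 1" and x: "x \<in> carrier G"
  shows "group.ord G x = 2 \<Longrightarrow> x ** x = mat 1 \<and> x \<noteq> mat 1"
    and "group.ord G x = 4 \<Longrightarrow> x ** x ** x ** x = mat 1 \<and> x ** x \<noteq> mat 1"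
    and "group.ord G x = 5 \<Longrightarrow> x ** x ** x ** x ** x = mat 1"
proof -
  interpret group G by (fact G)
  have p: "x [^] (2 :: nat) = x ** x" "x [^] (4 :: nat) = x ** x ** x ** x" "x [^] (5 :: nat) = x ** x ** x ** x ** x"
    "x [^] (1 :: nat) = x"
    using x by (simp_all add: numeral_eq_Suc G)
  show "ord x = 2 \<Longrightarrow> x ** x = mat 1 \<and> x \<noteq> mat 1"
    using pow_eq_id[OF x, of 2] pow_eq_id[OF x, of 1] by (simp add: p[unfolded One_nat_def] G)
  show "ord x = 4 \<Longrightarrow> x ** x ** x ** x = mat 1 \<and> x ** x \<noteq> mat 1"
    using pow_eq_id[OF x, of 4] pow_eq_id[OF x, of 2] by (simp add: p G)
  show "ord x = 5 \<Longrightarrow> x ** x ** x ** x ** x = mat 1"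
    using pow_eq_id[OF x, of 5] by (simp add: p G)
qed

lemma triple_of_relations:
  assumes o: "x \<in> oct_aut" "y \<in> oct_aut"
    and x: "x ** x = mat 1" "x \<noteq> mat 1" and y: "y ** y ** y ** y = mat 1" "y ** y \<noteq> mat 1"
    and z: "z ** z ** z ** z ** z = mat 1" and xyz: "x ** y ** z = mat 1"
  shows "triple_2_4_5 x y"
proof -
  define w where "w = x ** y"
  have wz: "w *v (z *v v) = v" for v using xyz by (simp add: w_def matrix_vector_mul_assoc)
  have z5: "z *v (z *v (z *v (z *v (z *v v)))) = v" for v using z by (simp add: matrix_vector_mul_assoc matrix_mul_assoc)
  have "((*v) w ^^ 5) v = w *v (w *v (w *v (w *v (w *v (z *v (z *v (z *v (z *v (z *v v)))))))))" for v
    by (simp add: z5 eval_nat_numeral)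
  then have "((*v) w ^^ 5) v = v" for v by (simp only: wz)
  with o x y show ?thesis by (simp add: triple_2_4_5_def w_def matrix_vector_mul_assoc matrix_mul_assoc)
qed

lemma conj_class_G2: "x \<in> conj_class G2 t \<longleftrightarrow> (\<exists>g \<in> oct_aut. g ** t = x ** g)"
  by (auto simp: conj_class_def orbit_def carrier_G2 simp flip: conjugate_G2)

lemma product_one_triples:
  "xs \<in> product_one_tuples G2 [A, B, C] \<longleftrightarrow>
    (\<exists>x y z. xs = [x, y, z] \<and> x \<in> A \<and> y \<in> B \<and> z \<in> C \<and> x ** y ** z = mat 1)"
  by (auto simp: product_one_tuples_def set_Cons_def G2_simps matrix_mul_assoc)

lemma conj_oct_aut:
  assumes "g \<in> oct_aut" "x \<in> oct_aut" "g ** x = y ** g"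
  shows "y \<in> oct_aut"
proof -
  have "y = g ** x ** inv\<^bsub>G2\<^esub> g" using assms by (simp add: G2_inv flip: matrix_mul_assoc)
  then show ?thesis using assms(1,2) by (metis oct_aut_mult G2_inv(1))
qed

lemma conj_mult: "g ** x = y ** g \<Longrightarrow> g ** x' = y' ** g \<Longrightarrow> g ** (x ** x') = (y ** y') ** g"
  by (metis matrix_mul_assoc)

lemma conj_inject:
  assumes "g \<in> oct_aut" "g ** x = y ** g" "g ** x' = y ** g"
  shows "x = x'"
proof -
  have "(inv\<^bsub>G2\<^esub> g ** g) ** x = (inv\<^bsub>G2\<^esub> g ** g) ** x'" using assms(2,3) by (simp flip: matrix_mul_assoc)
  then show ?thesis by (simp add: G2_inv assms(1))
qed

lemma conj_inject':
  assumes "g \<in> oct_aut" "g ** x = y ** g" "g ** x = y' ** g"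
  shows "y = y'"
proof -
  have "y ** (g ** inv\<^bsub>G2\<^esub> g) = y' ** (g ** inv\<^bsub>G2\<^esub> g)" using assms(2,3) by (simp add: matrix_mul_assoc)
  then show ?thesis by (simp add: G2_inv assms(1))
qed

lemma conj_eq_one: "g \<in> oct_aut \<Longrightarrow> g ** x = y ** g \<Longrightarrow> x = mat 1 \<longleftrightarrow> y = mat 1"
  using conj_inject[of g x "mat 1" "mat 1"] conj_inject'[of g "mat 1" y "mat 1"] by auto

text \<open>
  Any tuple of the classes with product one gives a pair to which \<open>triples_conjugate\<close> applies, and the third element
  is determined by the first two. The reference triple lies in the three classes.
\<close>

theorem rigid_triples:
  assumes t: "t \<in> carrier G2" "group.ord G2 t = 2" and s: "s \<in> carrier G2" "group.ord G2 s = 4"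
  defines "u \<equiv> root_element (0, 1) 1 ** root_element (3, 1) 1"
  defines "C \<equiv> [conj_class G2 t, conj_class G2 s, conj_class G2 u]"
  shows "rigid G2 C"
    and "xs \<in> product_one_tuples G2 C \<Longrightarrow> G2\<lparr>carrier := generate G2 (set xs)\<rparr> \<cong> sym_group 5"
proof -
  have to: "t \<in> oct_aut" "t ** t = mat 1" "t \<noteq> mat 1" and so: "s \<in> oct_aut" "s ** s ** s ** s = mat 1" "s ** s \<noteq> mat 1"
    using t s matrix_group_ord(1,2)[OF group_G2 G2_simps] by (auto simp: carrier_G2)
  have u: "unipotent_5 u" "(u - mat 1) *v ((u - mat 1) *v axis 7 1) \<noteq> 0"
    unfolding u_def by (rule subregular_product_cyclic)+
  have "((*v) u ^^ 5) v = v" for v using u(1) by (simp add: unipotent_5_def)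
  then have uo: "u \<in> oct_aut" "u ** u ** u ** u ** u = mat 1"
    using u(1) by (auto simp: unipotent_5_def matrix_vector_eq eval_nat_numeral simp flip: matrix_vector_mul_assoc)
  have tri: "triple_2_4_5 x y \<and> (fixes_square_fixed y \<longleftrightarrow> fixes_square_fixed s) \<and> z \<in> oct_aut \<and> x ** y ** z = mat 1"
    if xyz: "[x, y, z] \<in> product_one_tuples G2 C" for x y z
  proof -
    obtain g h k where g: "g \<in> oct_aut" "g ** t = x ** g" and h: "h \<in> oct_aut" "h ** s = y ** h"
      and k: "k \<in> oct_aut" "k ** u = z ** k" and 1: "x ** y ** z = mat 1"
      using xyz by (auto simp: C_def product_one_triples conj_class_G2)
    have o: "x \<in> oct_aut" "y \<in> oct_aut" "z \<in> oct_aut"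
      using conj_oct_aut g h k to so uo by blast+
    have "x ** x = mat 1" using conj_eq_one[OF g(1) conj_mult[OF g(2) g(2)]] to by simp
    moreover have "x \<noteq> mat 1" using conj_eq_one[OF g] to by simp
    moreover have "y ** y \<noteq> mat 1" using conj_eq_one[OF h(1) conj_mult[OF h(2) h(2)]] so by simp
    moreover have "y ** y ** y ** y = mat 1"
      using conj_eq_one[OF h(1) conj_mult[OF conj_mult[OF conj_mult[OF h(2) h(2)] h(2)] h(2)]] so by simp
    moreover have "z ** z ** z ** z ** z = mat 1"
      using conj_eq_one[OF k(1) conj_mult[OF conj_mult[OF conj_mult[OF conj_mult[OF k(2) k(2)] k(2)] k(2)] k(2)]] uo by simp
    ultimately have "triple_2_4_5 x y" using 1 o by (intro triple_of_relations)
    then show ?thesis using 1 o fixes_square_fixed_conj[OF h] by simp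
  qed
  show "G2\<lparr>carrier := generate G2 (set xs)\<rparr> \<cong> sym_group 5" if xs: "xs \<in> product_one_tuples G2 C"
  proof -
    obtain x y z where xyz: "xs = [x, y, z]" using xs by (auto simp: C_def product_one_triples)
    have "G2\<lparr>carrier := generate G2 {x, y, z}\<rparr> \<cong> sym_group 5"
      using tri[of x y z] xs by (intro triple_generates_sym_5) (simp_all add: xyz)
    then show ?thesis by (simp add: xyz)
  qed
  define b where "b = fixes_square_fixed s"
  define x0 where "x0 = sym_rep b swap_12"
  define y0 where "y0 = sym_rep b (swap_12 \<circ> cycle_5_inv)"
  define z0 where "z0 = sym_rep b cycle_5"
  have tri0: "triple_2_4_5 x0 y0" "x0 ** y0 ** z0 = mat 1"
    unfolding x0_def y0_def z0_def by (rule sym_rep_triple)+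
  have z0: "unipotent_5 z0" "(z0 - mat 1) *v ((z0 - mat 1) *v (mu 1 - mu 2)) \<noteq> 0"
    unfolding z0_def by (rule sym_rep_5_cycle_cyclic)+
  have s4: "s *v (s *v (s *v (s *v v))) = v" for v using so(2) by (simp add: matrix_vector_mul_assoc matrix_mul_assoc)
  have ty: "fixes_square_fixed s \<longleftrightarrow> fixes_square_fixed y0" by (simp add: y0_def sym_rep_4_cycle_type b_def)
  have "\<exists>g \<in> oct_aut. g ** t = x0 ** g"
    using involutions_conjugate[OF to(1) _ to(3) triple_2_4_5D(1-3)[OF tri0(1)]] to(2)
    by (metis matrix_vector_mul_assoc matrix_vector_mul_lid)
  moreover have "\<exists>g \<in> oct_aut. g ** s = y0 ** g"
    by (rule order_4_conjugate[OF so(1) s4 so(3) triple_2_4_5D(4-6)[OF tri0(1)] ty]) blast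
  moreover have "\<exists>g \<in> oct_aut. g ** u = z0 ** g"
    by (rule cyclic_unipotents_conjugate[OF u(1) axis_237_minus(3) u(2) z0(1) _ z0(2)])
      (auto simp del: One_nat_def simp: mu_axis axis_237_minus)
  ultimately have 0: "[x0, y0, z0] \<in> product_one_tuples G2 C"
    using tri0(2) by (auto simp: C_def product_one_triples conj_class_G2)
  have "product_one_tuples G2 C = orbit G2 (\<lambda>g. map (conjugate G2 g)) [x0, y0, z0]"
  proof (intro equalityI subsetI)
    fix xs assume xs: "xs \<in> product_one_tuples G2 C"
    then obtain x y z where xyz: "xs = [x, y, z]" by (auto simp: C_def product_one_triples)
    have *: "triple_2_4_5 x y" "fixes_square_fixed y \<longleftrightarrow> fixes_square_fixed s" "z \<in> oct_aut" "x ** y ** z = mat 1"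
      using tri xs xyz by blast+
    obtain g where g: "g \<in> oct_aut" "g ** x0 = x ** g" "g ** y0 = y ** g"
      by (rule triples_conjugate[OF tri0(1) *(1)]) (use *(2) in \<open>auto simp: y0_def sym_rep_4_cycle_type b_def\<close>)
    have "x ** y ** (g ** z0) = g ** (x0 ** y0 ** z0)"
      using conj_mult[OF g(2,3)] by (simp add: matrix_mul_assoc)
    also have "\<dots> = x ** y ** (z ** g)" using tri0(2) *(4) by (simp add: matrix_mul_assoc)
    finally have e: "(x ** y) *v ((g ** z0) *v v) = (x ** y) *v ((z ** g) *v v)" for v
      by (simp add: matrix_vector_mul_assoc)
    have xy: "x ** y \<in> oct_aut" using *(1) by (simp add: triple_2_4_5_def oct_aut_mult)
    have "g ** z0 = z ** g" unfolding matrix_vector_eq using oct_aut_inj[OF xy e] by blast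
    with g have "xs = map (conjugate G2 g) [x0, y0, z0]" by (simp add: xyz conjugate_G2)
    then show "xs \<in> orbit G2 (\<lambda>g. map (conjugate G2 g)) [x0, y0, z0]"
      using g(1) by (auto simp: orbit_def carrier_G2)
  next
    fix xs assume "xs \<in> orbit G2 (\<lambda>g. map (conjugate G2 g)) [x0, y0, z0]"
    then obtain g x y z where g: "g \<in> oct_aut" and xyz: "xs = [x, y, z]"
      and c: "g ** x0 = x ** g" "g ** y0 = y ** g" "g ** z0 = z ** g"
      by (auto simp: orbit_def carrier_G2 simp flip: conjugate_G2)
    have cl: "\<exists>k \<in> oct_aut. k ** r = y ** k" if r: "\<exists>h \<in> oct_aut. h ** r = x ** h" and gx: "g ** x = y ** g" for r x y
    proof -
      obtain h where h: "h \<in> oct_aut" "h ** r = x ** h" using r by blast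
      then have "(g ** h) ** r = y ** (g ** h)" using gx by (metis matrix_mul_assoc)
      then show ?thesis using g h oct_aut_mult by blast
    qed
    have "x ** y ** z = mat 1"
      using conj_eq_one[OF g conj_mult[OF conj_mult[OF c(1,2)] c(3)]] tri0(2) by simp
    then show "xs \<in> product_one_tuples G2 C"
      using 0 cl[OF _ c(1)] cl[OF _ c(2)] cl[OF _ c(3)] by (simp add: C_def product_one_triples conj_class_G2 xyz)
  qed
  with 0 show "rigid G2 C" unfolding rigid_def by blast
qed

section \<open>The finite groups of type \<open>G\<^sub>2\<close>\<close>

lemma CHAR_K: "CHAR(K) = 5"
  by (simp add: card_five)

lemma power_5_add: "(x + y :: K) ^ 5 ^ n = x ^ 5 ^ n + y ^ 5 ^ n"
proof -
  have "prime (5 :: nat)" by simp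
  then show ?thesis using freshmans_dream'[where 'a = K and m = "5 ^ n" and n = n and x = x and y = y]
    unfolding CHAR_K by simp
qed

definition entrywise_power :: "nat \<Rightarrow> K ^ 'n ^ 'm \<Rightarrow> K ^ 'n ^ 'm"
  where "entrywise_power q A = (\<chi> i j. A $ i $ j ^ q)"

lemma entrywise_power_mult: "entrywise_power (5 ^ n) (A ** B) = entrywise_power (5 ^ n) A ** entrywise_power (5 ^ n) B"
proof -
  have "(\<Sum>k \<in> S. f k) ^ 5 ^ n = (\<Sum>k \<in> S. f k ^ 5 ^ n)" for f :: "'c \<Rightarrow> K" and S
    by (induction S rule: infinite_finite_induct) (simp_all add: power_5_add)
  then show ?thesis by (simp add: entrywise_power_def matrix_matrix_mult_def vec_eq_iff power_mult_distrib)
qed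

lemma entrywise_power_one: "entrywise_power (5 ^ n) (mat 1) = mat 1"
  by (simp add: entrywise_power_def mat_def vec_eq_iff)

lemma frobenius_power: "(frobenius ^^ n) A = entrywise_power (5 ^ n) A"
  by (induction n) (simp_all add: entrywise_power_def frobenius_def vec_eq_iff mult.commute flip: power_mult)

lemma group_G2_fin: "group (G2_fin n)"
  unfolding G2_fin_def
proof (rule group.subgroup_imp_group[OF group_G2], rule group.subgroupI[OF group_G2])
  show "{g \<in> carrier G2. (frobenius ^^ n) g = g} \<noteq> {}"
    using monoid.one_closed[OF group.is_monoid[OF group_G2]]
    by (auto simp: G2_simps frobenius_power entrywise_power_one intro!: exI[of _ "mat 1"])
  fix g assume "g \<in> {g \<in> carrier G2. (frobenius ^^ n) g = g}"
  then have g: "g \<in> oct_aut" "entrywise_power (5 ^ n) g = g" by (auto simp: carrier_G2 frobenius_power)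
  have "g ** entrywise_power (5 ^ n) (inv\<^bsub>G2\<^esub> g) = entrywise_power (5 ^ n) (g ** inv\<^bsub>G2\<^esub> g)"
    by (simp add: entrywise_power_mult g)
  then have "g ** entrywise_power (5 ^ n) (inv\<^bsub>G2\<^esub> g) = g ** inv\<^bsub>G2\<^esub> g"
    by (simp add: G2_inv g entrywise_power_one)
  then have "inv\<^bsub>G2\<^esub> g ** (g ** entrywise_power (5 ^ n) (inv\<^bsub>G2\<^esub> g)) = inv\<^bsub>G2\<^esub> g ** (g ** inv\<^bsub>G2\<^esub> g)"
    by (rule arg_cong)
  then have "entrywise_power (5 ^ n) (inv\<^bsub>G2\<^esub> g) = inv\<^bsub>G2\<^esub> g"
    by (simp only: matrix_mul_assoc G2_inv(3)[OF g(1)] matrix_mul_lid)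
  then show "inv\<^bsub>G2\<^esub> g \<in> {g \<in> carrier G2. (frobenius ^^ n) g = g}"
    by (simp add: carrier_G2 frobenius_power G2_inv g)
  fix h assume "h \<in> {g \<in> carrier G2. (frobenius ^^ n) g = g}"
  then show "g \<otimes>\<^bsub>G2\<^esub> h \<in> {g \<in> carrier G2. (frobenius ^^ n) g = g}"
    using g by (auto simp: carrier_G2 frobenius_power G2_simps entrywise_power_mult oct_aut_mult)
qed auto

lemma two_power_5: "(2 :: K) ^ 5 ^ n = 2"
  using power_5_add[of 1 1 n] by simp

lemma root_element_G2_fin:
  assumes "\<gamma> = (1, 0) \<or> \<gamma> = (-1, 0)"
  shows "root_element \<gamma> 1 \<in> carrier (G2_fin n)"
proof -
  have e: "root_element \<gamma> 1 $ i $ j = (root_element \<gamma> 1 *v axis j 1) $ i" for i j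
    by (simp add: matrix_vector_mult_def axis_nth if_distrib cong: if_cong)
  have "(root_element \<gamma> 1 $ i $ j) ^ 5 ^ n = root_element \<gamma> 1 $ i $ j" for i j
  proof -
    have "\<forall>j i. root_element \<gamma> 1 $ i $ j \<in> {0, 1, 2}"
      unfolding e using assms by (elim disjE; simp add: root_element_vec axis_nth forall_7)
    then have "root_element \<gamma> 1 $ i $ j \<in> {0, 1, 2}" by blast
    then show ?thesis by (auto simp: two_power_5 zero_power)
  qed
  then have "(frobenius ^^ n) (root_element \<gamma> 1) = root_element \<gamma> 1"
    by (simp add: frobenius_power entrywise_power_def vec_eq_iff)
  then show ?thesis using assms root_element_G2 root_cases by (auto simp: G2_fin_def)
qed

lemma generate_preserves_line:
  fixes v :: "K ^ 'n" and G (structure)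
  assumes G: "group G" "\<And>a b. a \<otimes> b = a ** b" "\<one> = mat 1" and S: "S \<subseteq> carrier G"
    and v: "\<And>x. x \<in> S \<Longrightarrow> \<exists>c. x *v v = c *s v" and g: "g \<in> generate G S"
  shows "\<exists>c. g *v v = c *s v"
  using g
proof (induction rule: generate.induct)
  case one
  then show ?case by (auto simp: G intro: exI[of _ 1])
next
  case (incl h)
  then show ?case by (rule v)
next
  case (inv h)
  obtain c where c: "h *v v = c *s v" using v inv by blast
  have "inv h ** h = mat 1" using group.l_inv[OF G(1), of h] inv S G by auto
  then have "v = inv h *v (h *v v)" by (simp add: matrix_vector_mul_assoc)
  then have e: "v = c *s (inv h *v v)" by (simp add: c vector_scalar_commute)
  show ?case
  proof (cases "c = 0")
    case True
    then show ?thesis using e by auto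
  next
    case False
    then have "inv h *v v = (1 / c) *s v" by (subst (2) e) (simp add: vec_eq_iff)
    then show ?thesis by blast
  qed
next
  case (eng h k)
  then show ?case by (auto simp: G vector_scalar_commute simp flip: matrix_vector_mul_assoc)
qed

text \<open>
  The generators have a common eigenvector, so the whole group preserves its line. The root elements \<open>x\<^sub>\<alpha>(1)\<close> and
  \<open>x\<^bsub>-\<alpha>\<^esub>(1)\<close> have entries in the prime field and no common eigenvector.
\<close>

theorem G2_fin_not_2_4_5: "\<not> abc_group (G2_fin n) 2 4 5"
proof
  have G: "group (G2_fin n)" "a \<otimes>\<^bsub>G2_fin n\<^esub> b = a ** b" "\<one>\<^bsub>G2_fin n\<^esub> = mat 1" for a b
    by (rule group_G2_fin) (simp_all add: G2_fin_def G2_simps)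
  assume "abc_group (G2_fin n) 2 4 5"
  then obtain x y z where xyz: "x \<in> carrier (G2_fin n)" "y \<in> carrier (G2_fin n)" "z \<in> carrier (G2_fin n)"
    and ord: "group.ord (G2_fin n) x = 2" "group.ord (G2_fin n) y = 4" "group.ord (G2_fin n) z = 5"
    and 1: "x ** y ** z = mat 1" and gen: "generate (G2_fin n) {x, y, z} = carrier (G2_fin n)"
    unfolding abc_group_def G by blast
  have o: "x \<in> oct_aut" "y \<in> oct_aut" "z \<in> oct_aut" using xyz by (auto simp: G2_fin_def carrier_G2)
  have "triple_2_4_5 x y"
    using o 1 ord xyz matrix_group_ord[OF G] by (intro triple_of_relations[where z = z]) blast+
  then obtain v where v: "v \<noteq> 0" "x *v v = v \<and> y *v v = v \<or> x *v v = - v \<and> y *v v = - v"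
    by (rule triple_common_eigenvector) (auto split: if_splits)
  have xy: "x *v (y *v v) = v" using v(2) by (auto simp: vec.neg)
  have "x *v (y *v (z *v v)) = v" using 1 by (simp add: matrix_vector_mul_assoc matrix_mul_assoc)
  then have zv: "z *v v = v" using xy oct_aut_inj o by metis
  have pm: "\<exists>c. g *v v = c *s v" if "g \<in> {x, y, z}" for g
    using that v(2) zv by (auto intro: exI[of _ 1] exI[of _ "- 1"])
  have line: "\<exists>c. root_element \<gamma> 1 *v v = c *s v" if "\<gamma> = (1, 0) \<or> \<gamma> = (-1, 0)" for \<gamma>
    by (rule generate_preserves_line[OF G, where S = "{x, y, z}"])
      (use xyz pm root_element_G2_fin[OF that] gen in auto)
  obtain c where c: "root_element (1, 0) 1 *v v = c *s v" using line[of "(1, 0)"] by auto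
  obtain d where d: "root_element (-1, 0) 1 *v v = d *s v" using line[of "(-1, 0)"] by auto
  have "v $ 2 = 0 \<and> v $ 4 = 0 \<and> v $ 5 = 0 \<and> v $ 7 = 0"
    using c by (cases "c = 1") (auto simp: vec_eq_iff forall_7 root_element_vec)
  moreover have "v $ 1 = 0 \<and> v $ 3 = 0 \<and> v $ 6 = 0"
    using d by (cases "d = 1") (auto simp: vec_eq_iff forall_7 root_element_vec)
  ultimately show False using v(1) by (simp add: vec_eq_iff forall_7)
qed

section \<open>Three-dimensional linear and unitary groups\<close>

definition minus_embed :: "K ^ 3 \<Rightarrow> K ^ 7"
  where "minus_embed x = vec7 0 (x $ 1) (x $ 2) 0 0 0 (x $ 3)"

text \<open>
  The action of \<open>SL\<^sub>3(K)\<close> on the minus space, extended to \<open>V\<close>.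
\<close>

definition SL3_embed :: "K ^ 3 ^ 3 \<Rightarrow> K ^ 7 ^ 7"
  where "SL3_embed A = SL3_matrix (minus_embed (column 1 A)) (minus_embed (column 2 A)) (minus_embed (column 3 A))"

lemma minus_embed_minus: "minus_embed x \<in> minus_space"
  by (simp add: minus_embed_def minus_space_iff)

lemma SL3_embed_oct_aut:
  assumes "A \<in> SL"
  shows "SL3_embed A \<in> oct_aut"
  unfolding SL3_embed_def
proof (intro SL3_matrix_oct_aut minus_embed_minus)
  have "det A = 1" using assms by (simp add: SL_def)
  then show "form (minus_embed (column 1 A) \<star> minus_embed (column 2 A)) (minus_embed (column 3 A)) = 4"
    unfolding minus_embed_def minus_det by (simp add: det_3 column_def algebra_simps)
qed

lemma SL3_embed_axis_4: "SL3_embed A *v axis 4 1 = axis 4 1"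
  unfolding SL3_embed_def by (rule SL3_matrix_axis)

lemma SL3_embed_minus: "SL3_embed A *v minus_embed x = minus_embed (A *v x)"
  unfolding SL3_embed_def SL3_matrix_vec
  by (rule vec7_eqI)
    (simp_all add: minus_embed_def column_def matrix_vector_mult_def sum_3 cross_def axis_nth algebra_simps)

lemma axis_minus_embed: "axis 2 1 = minus_embed (axis 1 1)" "axis 3 1 = minus_embed (axis 2 1)"
  "axis 7 1 = minus_embed (axis 3 1)"
  by (rule vec7_eqI; simp add: minus_embed_def axis_def)+

lemma SL3_embed_mult:
  assumes "A \<in> SL" "B \<in> SL"
  shows "SL3_embed (A ** B) = SL3_embed A ** SL3_embed B"
proof (rule oct_aut_ext_minus[OF _ _ axis_237_minus])
  have "A ** B \<in> SL" using assms by (simp add: SL_def det_mul)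
  then show "SL3_embed (A ** B) \<in> oct_aut" by (rule SL3_embed_oct_aut)
  show "SL3_embed A ** SL3_embed B \<in> oct_aut" using assms by (intro oct_aut_mult SL3_embed_oct_aut)
qed (simp_all only: axis_minus_embed SL3_embed_minus matrix_vector_mul_assoc[symmetric])

lemma SL3_embed_one: "SL3_embed (mat 1) = mat 1"
proof (rule oct_aut_ext_minus[OF _ _ axis_237_minus])
  show "SL3_embed (mat 1) \<in> oct_aut" by (rule SL3_embed_oct_aut) (simp add: SL_def)
qed (simp_all only: axis_minus_embed SL3_embed_minus oct_aut_one matrix_vector_mul_lid)

lemma SL3_embed_eq_one:
  assumes "SL3_embed A = mat 1"
  shows "A = mat 1"
proof -
  have "A *v x = x" for x
  proof -
    have e: "minus_embed (A *v x) = minus_embed x" using SL3_embed_minus[of A x] by (simp add: assms)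
    show ?thesis
      using arg_cong[OF e, of "\<lambda>v. v $ 2"] arg_cong[OF e, of "\<lambda>v. v $ 3"] arg_cong[OF e, of "\<lambda>v. v $ 7"]
      by (simp add: vec_eq_iff forall_3 minus_embed_def)
  qed
  then show ?thesis by (simp add: matrix_vector_eq)
qed

definition diag3 :: "K \<Rightarrow> K ^ 3 ^ 3"
  where "diag3 \<zeta> = (\<chi> i j. if i = j then if i = 1 then \<zeta> else if i = 2 then 1 else 1 / \<zeta> else 0)"

definition cyclic3 :: "K ^ 3 ^ 3"
  where "cyclic3 = (\<chi> i j. if i = 2 \<and> j = 1 \<or> i = 3 \<and> j = 2 \<or> i = 1 \<and> j = 3 then 1 else 0)"

lemma SL3_embed_cyclic3: "SL3_embed cyclic3 *v x = vec7 (x$5) (x$7) (x$2) (x$4) (- x$6) (- x$1) (x$3)"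
  by (rule vec7_eqI)
    (simp_all add: SL3_embed_def SL3_matrix_vec minus_embed_def cyclic3_def column_def cross_def axis_nth char_5)

lemma SL3_embed_diag3: "\<zeta> \<noteq> 0 \<Longrightarrow> SL3_embed (diag3 \<zeta>) *v x =
    vec7 (\<zeta> * x$1) (\<zeta> * x$2) (x$3) (x$4) (x$5) (x$6 / \<zeta>) (x$7 / \<zeta>)"
  by (rule vec7_eqI)
    (simp_all add: SL3_embed_def SL3_matrix_vec minus_embed_def diag3_def column_def cross_def axis_nth char_5)

text \<open>
  The eigenvalue \<open>1\<close> of the diagonal matrix differs from \<open>\<zeta>\<close> and from \<open>1/\<zeta>\<close>, so a common eigenvector has a zero
  coordinate in each space, and the cyclic matrix carries the zero to all coordinates.
\<close>

lemma no_common_eigenvector: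
  assumes \<zeta>: "\<zeta> \<noteq> 0" "\<zeta>\<^sup>2 \<noteq> 1" and v: "v \<in> plus_space \<or> v \<in> minus_space"
    and D: "SL3_embed (diag3 \<zeta>) *v v = c *s v" and P: "SL3_embed cyclic3 *v v = d *s v"
  shows "v = 0"
proof -
  have \<zeta>': "\<zeta> \<noteq> 1" "1 / \<zeta> \<noteq> \<zeta>" "1 / \<zeta> \<noteq> 1" using \<zeta> by (auto simp: field_simps power2_eq_square)
  have c: "c = \<zeta> \<or> v $ 1 = 0" "c = \<zeta> \<or> v $ 2 = 0" "c = 1 \<or> v $ 3 = 0" "c = 1 \<or> v $ 5 = 0"
    "c = 1 / \<zeta> \<or> v $ 6 = 0" "c = 1 / \<zeta> \<or> v $ 7 = 0"
  proof -
    have "\<zeta> * v $ 1 = c * v $ 1" "\<zeta> * v $ 2 = c * v $ 2" "1 * v $ 3 = c * v $ 3" "1 * v $ 5 = c * v $ 5"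
      "(1 / \<zeta>) * v $ 6 = c * v $ 6" "(1 / \<zeta>) * v $ 7 = c * v $ 7"
      using D by (simp_all add: SL3_embed_diag3[OF \<zeta>(1)] vec_eq_iff forall_7 del: mult_cancel_right mult_cancel_left)
    then show "c = \<zeta> \<or> v $ 1 = 0" "c = \<zeta> \<or> v $ 2 = 0" "c = 1 \<or> v $ 3 = 0" "c = 1 \<or> v $ 5 = 0"
      "c = 1 / \<zeta> \<or> v $ 6 = 0" "c = 1 / \<zeta> \<or> v $ 7 = 0"
      by (metis mult_right_cancel)+
  qed
  have e: "(SL3_embed cyclic3 *v v) $ i = d * v $ i" for i by (simp add: P)
  have d: "v $ 5 = d * v $ 1" "v $ 7 = d * v $ 2" "v $ 2 = d * v $ 3" "- v $ 6 = d * v $ 5"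
    "- v $ 1 = d * v $ 6" "v $ 3 = d * v $ 7"
    using e[of 1] e[of 2] e[of 3] e[of 5] e[of 6] e[of 7]
    by (simp_all only: SL3_embed_cyclic3 vec7_nth)
  have 5: "v $ 5 = 0" using c(1,4) \<zeta>'(1) d(1) by (metis mult_zero_right)
  then have 6: "v $ 6 = 0" using d(4) by simp
  then have 1: "v $ 1 = 0" using d(5) by simp
  have 3: "v $ 3 = 0" using c(3,6) \<zeta>'(3) d(6) by (metis mult_zero_right)
  then have 2: "v $ 2 = 0" using d(3) by simp
  then have 7: "v $ 7 = 0" using d(2) by simp
  have "v $ 4 = 0" using v by (auto simp: plus_space_iff minus_space_iff)
  then show ?thesis using 1 2 3 5 6 7 by (simp add: vec_eq_iff forall_7)
qed

text \<open>
  An automorphism \<open>w\<close> that negates \<open>e\<^sub>4\<close> and commutes with the group amounts to a nondegenerate invariant bilinear form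
  \<open>form (w x) y\<close> on the minus space. The diagonal matrix makes the values on \<open>(e\<^sub>2, e\<^sub>2)\<close>, \<open>(e\<^sub>2, e\<^sub>3)\<close>
  and \<open>(e\<^sub>3, e\<^sub>2)\<close> vanish, and the cyclic matrix carries the last one to \<open>(e\<^sub>2, e\<^sub>7)\<close>.
\<close>

lemma no_invariant_form:
  assumes \<zeta>: "\<zeta> \<noteq> 0" "\<zeta>\<^sup>2 \<noteq> 1" and w: "w \<in> oct_aut" "w *v axis 4 1 = - axis 4 1"
    and D: "SL3_embed (diag3 \<zeta>) ** w = w ** SL3_embed (diag3 \<zeta>)"
    and P: "SL3_embed cyclic3 ** w = w ** SL3_embed cyclic3"
    and SL: "diag3 \<zeta> \<in> SL" "cyclic3 \<in> SL"
  shows False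
proof -
  define \<beta> where "\<beta> x y = form (w *v x) y" for x y
  have inv: "\<beta> (SL3_embed A *v x) (SL3_embed A *v y) = \<beta> x y"
    if "A \<in> SL" "SL3_embed A ** w = w ** SL3_embed A" for A x y
  proof -
    have "w *v (SL3_embed A *v x) = SL3_embed A *v (w *v x)" by (simp add: matrix_vector_mul_assoc that(2))
    then show ?thesis by (simp add: \<beta>_def oct_aut_form SL3_embed_oct_aut that(1))
  qed
  have \<zeta>1: "\<zeta> \<noteq> 1" using \<zeta> by auto
  have d: "SL3_embed (diag3 \<zeta>) *v axis 2 1 = \<zeta> *s axis 2 1" "SL3_embed (diag3 \<zeta>) *v axis 3 1 = axis 3 1"
    by (rule vec7_eqI; simp add: SL3_embed_diag3[OF \<zeta>(1)] axis_nth)+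
  have p: "SL3_embed cyclic3 *v axis 2 1 = axis 3 1" "SL3_embed cyclic3 *v axis 3 1 = axis 7 1"
    "SL3_embed cyclic3 *v axis 7 1 = axis 2 1"
    by (rule vec7_eqI; simp add: SL3_embed_cyclic3 axis_nth)+
  have scale: "\<beta> (c *s x) (e *s y) = c * (e * \<beta> x y)" for c e x y
    by (simp add: \<beta>_def vector_scalar_commute)
  have "\<beta> (axis 2 1) (axis 2 1) = 0"
    using inv[OF SL(1) D, of "axis 2 1" "axis 2 1"] \<zeta> by (simp add: d scale power2_eq_square flip: mult.assoc)
  moreover have "\<beta> (axis 3 1) (axis 2 1) = 0" 
    using inv[OF SL(1) D, of "axis 3 1" "axis 2 1"] \<zeta>1 scale[of 1 "axis 3 1"] by (simp add: d)
  moreover have "\<beta> (axis 2 1) (axis 3 1) = 0"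
    using inv[OF SL(1) D, of "axis 2 1" "axis 3 1"] \<zeta>1 scale[of _ _ 1] by (simp add: d)
  moreover have "\<beta> (axis 2 1) (axis 7 1) = \<beta> (axis 3 1) (axis 2 1)"
    using inv[OF SL(2) P, of "axis 2 1" "axis 7 1"] by (simp add: p)
  ultimately have "\<beta> (axis 2 1) (axis 2 1) = 0" "\<beta> (axis 2 1) (axis 3 1) = 0" "\<beta> (axis 2 1) (axis 7 1) = 0"
    by simp_all
  then have "w *v axis 2 1 = 0"
    using negates_axis_4[OF w] axis_237_minus
    by (intro orthogonal_to_minus_basis[OF axis_237_minus]) (simp_all add: \<beta>_def form_sym[of _ "w *v axis 2 1"])
  then have "axis 2 1 = (0 :: K ^ 7)" by (rule oct_aut_eq_0[OF w(1), THEN iffD1])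
  from arg_cong[OF this, of "\<lambda>v. v $ 2"] show False by (simp add: axis_nth)
qed

lemma commutes_inverse:
  assumes "A ** B = mat 1" "B ** A = mat 1" "A ** w = w ** (A :: K ^ 'n ^ 'n)"
  shows "B ** w = w ** B"
proof -
  have "B ** w = B ** (w ** A) ** B" by (simp add: assms(1) flip: matrix_mul_assoc)
  also have "\<dots> = (B ** A) ** w ** B" by (simp only: assms(3)[symmetric] matrix_mul_assoc)
  finally show ?thesis by (simp add: assms(2))
qed

lemma plus_minus_independent:
  assumes "p \<in> plus_space" "m \<in> minus_space" "p + m + c *s axis 4 1 = 0"
  shows "p = 0" "m = 0" "c = 0"
  using assms by (auto simp: plus_space_iff minus_space_iff vec_eq_iff forall_7 axis_nth)

text \<open>
  If \<open>-1\<close> is not an eigenvalue of the element of order four, then the generators are conjugate, inside the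
  stabiliser of \<open>e\<^sub>4\<close>, to the reference pair for the first embedding of \<open>Sym\<^sub>5\<close>. A conjugate \<open>w\<close> of
  \<open>perm_twist\<close> then centralises the whole group. Otherwise the first two generators have a common
  eigenvector for \<open>-1\<close>. They fix \<open>e\<^sub>4\<close>, so its components in the plus space and in the minus space are
  again such eigenvectors, and one of them is nonzero.
\<close>

theorem SL3_subgroup_not_2_4_5:
  fixes G (structure)
  assumes G: "group G" "\<And>a b. a \<otimes> b = a ** b" "\<one> = mat 1" and SL: "carrier G \<subseteq> SL"
    and D: "diag3 \<zeta> \<in> carrier G" and P: "cyclic3 \<in> carrier G" and \<zeta>: "\<zeta> \<noteq> 0" "\<zeta>\<^sup>2 \<noteq> 1"
  shows "\<not> abc_group G 2 4 5"
proof
  interpret G: group G by (fact G)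
  interpret E: group_hom G G2 SL3_embed
  proof (intro group_hom.intro group_hom_axioms.intro G group_G2 homI)
    fix A B assume "A \<in> carrier G" "B \<in> carrier G"
    then show "SL3_embed (A \<otimes> B) = SL3_embed A \<otimes>\<^bsub>G2\<^esub> SL3_embed B"
      using SL3_embed_mult[OF subsetD[OF SL] subsetD[OF SL]] by (simp add: G G2_simps)
  qed (use SL in \<open>auto simp: carrier_G2 SL3_embed_oct_aut\<close>)
  assume "abc_group G 2 4 5"
  then obtain x y z where xyz: "x \<in> carrier G" "y \<in> carrier G" "z \<in> carrier G"
    and ord: "group.ord G x = 2" "group.ord G y = 4" "group.ord G z = 5"
    and 1: "x ** y ** z = mat 1" and gen: "generate G {x, y, z} = carrier G"
    unfolding abc_group_def G by blast
  have SLx: "x \<in> SL" "y \<in> SL" "z \<in> SL" using xyz SL by auto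
  define xE where "xE = SL3_embed x"
  define yE where "yE = SL3_embed y"
  define zE where "zE = SL3_embed z"
  have o: "xE \<in> oct_aut" "yE \<in> oct_aut" "zE \<in> oct_aut"
    using xyz SL by (auto simp: xE_def yE_def zE_def SL3_embed_oct_aut)
  have fix4: "xE *v axis 4 1 = axis 4 1" "yE *v axis 4 1 = axis 4 1"
    by (simp_all add: xE_def yE_def SL3_embed_axis_4)
  have SLm: "a ** b \<in> SL" if "a \<in> SL" "b \<in> SL" for a b :: "K ^ 3 ^ 3" using that by (simp add: SL_def det_mul)
  note mo = matrix_group_ord[OF G]
  have XYZ: "xE ** yE ** zE = mat 1"
    unfolding xE_def yE_def zE_def by (simp add: 1 SLx SLm SL3_embed_one flip: SL3_embed_mult)
  have tri: "triple_2_4_5 xE yE"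
  proof (rule triple_of_relations[OF o(1,2) _ _ _ _ _ XYZ])
    show "xE ** xE = mat 1" "xE \<noteq> mat 1"
      using mo(1)[OF xyz(1) ord(1)] SL3_embed_eq_one by (auto simp: xE_def SLx SL3_embed_one simp flip: SL3_embed_mult)
    show "yE ** yE ** yE ** yE = mat 1" "yE ** yE \<noteq> mat 1"
      using mo(2)[OF xyz(2) ord(2)] SL3_embed_eq_one by (auto simp: yE_def SLx SLm SL3_embed_one simp flip: SL3_embed_mult)
    show "zE ** zE ** zE ** zE ** zE = mat 1"
      using mo(3)[OF xyz(3) ord(3)] by (simp add: zE_def SLx SLm SL3_embed_one flip: SL3_embed_mult)
  qed
  have img: "SL3_embed A \<in> generate G2 {xE, yE, zE}" if "A \<in> carrier G" for A
    using E.generate_img[of "{x, y, z}"] xyz gen that by (auto simp: xE_def yE_def zE_def)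
  have sub: "{xE, yE, zE} \<subseteq> carrier G2" using o by (simp add: carrier_G2)
  show False
  proof (cases "fixes_square_fixed yE")
    case True
    obtain g where g: "g \<in> oct_aut" "g *v axis 4 1 = axis 4 1" "g ** xE = sym_rep True swap_12 ** g"
      "g ** yE = sym_rep True (swap_12 \<circ> cycle_5_inv) ** g"
      by (rule fixing_triples_conjugate[OF tri sym_rep_triple(1)[of True] True _ fix4])
        (simp_all add: sym_rep_4_cycle_type, simp_all add: sym_rep_def perm_matrix_axis_4)
    define w where "w = inv\<^bsub>G2\<^esub> g ** perm_twist ** g"
    have gw: "g ** w = perm_twist ** g"
      using g(1) by (simp add: w_def matrix_mul_assoc G2_inv)
    have w: "w \<in> oct_aut" using g(1) by (simp add: w_def oct_aut_mult G2_inv perm_twist_oct_aut)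
    have w4: "w *v axis 4 1 = - axis 4 1"
    proof -
      have "g *v (w *v axis 4 1) = g *v (- axis 4 1)"
        by (simp add: matrix_vector_mul_assoc gw) (simp add: g perm_twist_axis_4 vec.neg flip: matrix_vector_mul_assoc)
      then show ?thesis by (rule oct_aut_inj[OF g(1)])
    qed
    have comm: "A ** w = w ** A" if "g ** A = sym_rep True \<sigma> ** g" "\<sigma> permutes {1..5}" for A \<sigma>
    proof -
      have t: "perm_twist ** sym_rep True \<sigma> = sym_rep True \<sigma> ** perm_twist"
        using perm_twist_commutes[OF that(2)] by (simp add: sym_rep_def)
      show ?thesis
        using conj_inject[OF g(1) conj_mult[OF that(1) gw] conj_mult[OF gw that(1), unfolded t]] .
    qed
    have XY: "xE ** w = w ** xE" "yE ** w = w ** yE" using comm g(3,4) generators_permute by blast+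
    have "(xE ** yE) ** w = w ** (xE ** yE)" by (metis XY matrix_mul_assoc)
    moreover have "zE ** (xE ** yE) = mat 1" using XYZ matrix_left_right_inverse by metis
    ultimately have Zw: "zE ** w = w ** zE" using XYZ by (auto intro: commutes_inverse[of "xE ** yE"])
    have all: "A ** w = w ** A" if "A \<in> generate G2 {xE, yE, zE}" for A
      using that
    proof (induction rule: generate.induct)
      case (inv h)
      then have h: "h \<in> oct_aut" "h ** w = w ** h" using o XY Zw by auto
      show ?case by (rule commutes_inverse[OF G2_inv(2,3)[OF h(1)] h(2)])
    next
      case (eng h k)
      have "(h ** k) ** w = h ** (k ** w)" by (simp only: matrix_mul_assoc)
      also have "\<dots> = (h ** w) ** k" by (simp only: eng.IH matrix_mul_assoc)
      also have "\<dots> = w ** (h ** k)" by (simp only: eng.IH matrix_mul_assoc)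
      finally show ?case by (simp only: G2_simps)
    qed (use XY Zw in \<open>auto simp: G2_simps\<close>)
    show False
      by (rule no_invariant_form[OF \<zeta> w w4 all[OF img[OF D]] all[OF img[OF P]]]) (use D P SL in auto)
  next
    case False
    obtain v where v: "v \<noteq> 0" "xE *v v = - v" "yE *v v = - v"
      by (rule triple_common_eigenvector[OF tri]) (use False in auto)
    obtain p m c where pm: "p \<in> plus_space" "m \<in> minus_space" "v = p + m + c *s axis 4 1"
      by (rule plus_minus_decompose)
    have parts: "A *v p = - p \<and> A *v m = - m \<and> c = 0"
      if A: "A \<in> oct_aut" "A *v axis 4 1 = axis 4 1" "A *v v = - v" for A
    proof -
      have "(A *v p + p) + (A *v m + m) + (2 * c) *s axis 4 1 = A *v v + v"
        unfolding pm(3) matrix_vector_right_distrib vector_scalar_commute A(2) by (simp add: vec_eq_iff algebra_simps)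
      then have "(A *v p + p) + (A *v m + m) + (2 * c) *s axis 4 1 = 0" by (simp add: A(3))
      moreover have "A *v p + p \<in> plus_space" "A *v m + m \<in> minus_space"
        using fixes_axis_4[OF A(1,2)] pm by (simp_all add: plus_minus_closed)
      ultimately have "A *v p + p = 0" "A *v m + m = 0" "2 * c = 0" using plus_minus_independent by blast+
      then show ?thesis by (simp add: eq_neg_iff_add_eq_0)
    qed
    have "\<exists>u. u \<noteq> 0 \<and> (u \<in> plus_space \<or> u \<in> minus_space) \<and> xE *v u = - u \<and> yE *v u = - u"
      using parts[OF o(1) fix4(1) v(2)] parts[OF o(2) fix4(2) v(3)] pm v(1)
      by (cases "p = 0") auto
    then obtain u where u: "u \<noteq> 0" "u \<in> plus_space \<or> u \<in> minus_space" "xE *v u = - u" "yE *v u = - u" by blast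
    have "xE *v (yE *v (zE *v u)) = xE *v (yE *v u)"
      using XYZ u by (simp add: matrix_vector_mul_assoc matrix_mul_assoc) (simp add: u vec.neg flip: matrix_vector_mul_assoc)
    then have "zE *v u = u" using oct_aut_inj o by metis
    then have line: "\<exists>c. g *v u = c *s u" if "g \<in> {xE, yE, zE}" for g
      using that u by (auto intro: exI[of _ 1] exI[of _ "- 1"])
    have "\<exists>c. SL3_embed A *v u = c *s u" if "A \<in> carrier G" for A
      using generate_preserves_line[OF group_G2 G2_simps sub line img[OF that]] .
    then show False using no_common_eigenvector[OF \<zeta> u(2)] u(1) D P by metis
  qed
qed

lemma group_of_matrices:
  assumes S: "S \<subseteq> SL" and one: "mat 1 \<in> S" and mult: "\<And>A B. A \<in> S \<Longrightarrow> B \<in> S \<Longrightarrow> A ** B \<in> S"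
    and inv: "\<And>A B. A \<in> S \<Longrightarrow> A ** B = mat 1 \<Longrightarrow> B ** A = mat 1 \<Longrightarrow> B \<in> S"
  shows "group (GL\<lparr>carrier := (S :: (K ^ 'n ^ 'n) set)\<rparr>)"
proof (rule group.subgroup_imp_group[OF group_GL], rule group.subgroupI[OF group_GL])
  have GL: "A \<in> carrier GL" if "A \<in> S" for A
    using S that by (auto simp: GL_def SL_def invertible_det_nz)
  show "S \<subseteq> carrier GL" "S \<noteq> {}" using GL one by auto
  have GL_simps: "A \<otimes>\<^bsub>GL\<^esub> B = A ** B" "\<one>\<^bsub>GL\<^esub> = mat 1" for A B :: "K ^ 'n ^ 'n" by (simp_all add: GL_def)
  show "inv\<^bsub>GL\<^esub> A \<in> S" if "A \<in> S" for A
    by (rule inv[OF that group.r_inv[OF group_GL GL[OF that], unfolded GL_simps]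
          group.l_inv[OF group_GL GL[OF that], unfolded GL_simps]])
  show "A \<otimes>\<^bsub>GL\<^esub> B \<in> S" if "A \<in> S" "B \<in> S" for A B using mult that by (simp add: GL_simps)
qed

lemma diag3_cyclic3_SL: "\<zeta> \<noteq> 0 \<Longrightarrow> diag3 \<zeta> \<in> SL" "cyclic3 \<in> SL"
  by (simp_all add: SL_def det_3 diag3_def cyclic3_def)

lemma subfield_entrywise: "(\<forall>i j. A $ i $ j \<in> subfield_of_order q) \<longleftrightarrow> entrywise_power q A = A"
  by (simp add: subfield_of_order_def entrywise_power_def vec_eq_iff)

lemma entrywise_power_inverse:
  assumes "entrywise_power (5 ^ n) A = A" "A ** B = mat 1" "B ** A = mat 1"
  shows "entrywise_power (5 ^ n) B = (B :: K ^ 'n ^ 'n)"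
proof -
  have "A ** entrywise_power (5 ^ n) B = entrywise_power (5 ^ n) (A ** B)"
    by (simp add: entrywise_power_mult assms(1))
  then have "B ** (A ** entrywise_power (5 ^ n) B) = B" by (simp add: assms(2) entrywise_power_one)
  then show ?thesis by (simp add: matrix_mul_assoc assms(3))
qed

theorem SL3_fin_not_2_4_5: "\<not> abc_group (SL3_fin (5 ^ n)) 2 4 5"
proof (rule SL3_subgroup_not_2_4_5)
  have det: "det B = 1" if "A ** B = mat 1" "det A = 1" for A B :: "K ^ 3 ^ 3"
    using that det_mul[of A B] by simp
  show "group (SL3_fin (5 ^ n))"
    unfolding SL3_fin_def subfield_entrywise
    by (rule group_of_matrices)
      (auto simp: SL_def det_mul entrywise_power_mult entrywise_power_one det entrywise_power_inverse)
  show "(2 :: K) \<noteq> 0" "(2 :: K)\<^sup>2 \<noteq> 1" by (simp_all add: char_5)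
  then show "diag3 2 \<in> carrier (SL3_fin (5 ^ n))" "cyclic3 \<in> carrier (SL3_fin (5 ^ n))"
    by (simp_all add: SL3_fin_def diag3_cyclic3_SL)
      (auto simp: subfield_of_order_def diag3_def cyclic3_def two_power_5 power_divide zero_power)
qed (auto simp: SL3_fin_def GL_def)

text \<open>
  With \<open>2 m = q + 1\<close>, take \<open>\<zeta>\<^sup>2\<close> to be a root of \<open>1 + y + \<dots> + y\<^sup>m\<^sup>-\<^sup>1\<close>: an \<open>m\<close>-th root of unity, different from 1
  because \<open>2 m = 1\<close> in \<open>K\<close>.
\<close>

lemma unitary_scalar:
  assumes "n \<ge> 1"
  obtains \<zeta> :: K where "\<zeta> ^ (5 ^ n + 1) = 1" "\<zeta>\<^sup>2 \<noteq> 1"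
proof -
  define m :: nat where "m = (5 ^ n + 1) div 2"
  have m: "2 * m = 5 ^ n + 1" by (simp add: m_def)
  have "(5 :: nat) \<le> 5 ^ n" using assms by (simp add: self_le_power)
  then have "m > 1" using m by linarith
  then have "\<exists>y :: K. (\<Sum>k \<le> m - 1. 1 * y ^ k) = 0" by (intro alg_closed) auto
  then obtain y :: K where y: "(\<Sum>k < m. y ^ k) = 0"
    using \<open>m > 1\<close> lessThan_Suc_atMost[of "m - 1"] by auto
  have "y ^ m - 1 = (y - 1) * (\<Sum>k < m. y ^ k)" by (rule power_diff_1_eq)
  then have ym: "y ^ m = 1" using y by simp
  have "y \<noteq> 1"
  proof
    assume "y = 1"
    then have "of_nat m = (0 :: K)" using y by simp
    then have "of_nat (2 * m) = (0 :: K)" by simp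
    then show False using assms unfolding m by (simp add: five_eq_0_K zero_power)
  qed
  obtain \<zeta> where \<zeta>: "\<zeta> ^ 2 = y" using nth_root_exists[of 2 y] by auto
  have "\<zeta> ^ (5 ^ n + 1) = y ^ m" unfolding m[symmetric] power_mult \<zeta> ..
  with ym \<zeta> \<open>y \<noteq> 1\<close> that show thesis by simp
qed

theorem SU3_fin_not_2_4_5:
  assumes "n \<ge> 1"
  shows "\<not> abc_group (SU3_fin (5 ^ n)) 2 4 5"
proof -
  obtain \<zeta> :: K where \<zeta>: "\<zeta> ^ (5 ^ n + 1) = 1" "\<zeta>\<^sup>2 \<noteq> 1" using unitary_scalar[OF assms] .
  have \<zeta>0: "\<zeta> \<noteq> 0" using \<zeta>(1) by auto
  have \<zeta>q: "\<zeta> ^ 5 ^ n = 1 / \<zeta>" using \<zeta>(1) \<zeta>0 by (simp add: field_simps)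
  then have \<zeta>qq: "\<zeta> ^ (5 ^ n)\<^sup>2 = \<zeta>" by (simp add: power2_eq_square power_mult power_divide \<zeta>0)
  have qq: "((5 :: nat) ^ n)\<^sup>2 = 5 ^ (n * 2)" by (simp add: power_mult)
  have U: "SU3_fin (5 ^ n) = GL\<lparr>carrier := {A \<in> SL. entrywise_power (5 ^ (n * 2)) A = A \<and>
      Finite_Cartesian_Product.transpose (entrywise_power (5 ^ n) A) ** A = mat 1}\<rparr>"
    unfolding SU3_fin_def subfield_entrywise qq by (simp add: entrywise_power_def)
  show ?thesis
  proof (rule SL3_subgroup_not_2_4_5)
    show "group (SU3_fin (5 ^ n))"
      unfolding U
    proof (rule group_of_matrices)
      let ?q = "5 ^ n"
      let ?t = "Finite_Cartesian_Product.transpose :: K ^ 3 ^ 3 \<Rightarrow> K ^ 3 ^ 3"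
      show "mat 1 \<in> {A \<in> SL. entrywise_power (5 ^ (n * 2)) A = A \<and> ?t (entrywise_power ?q A) ** A = mat 1}"
        by (simp add: SL_def entrywise_power_one transpose_mat)
      fix A B assume "A \<in> {A \<in> SL. entrywise_power (5 ^ (n * 2)) A = A \<and> ?t (entrywise_power ?q A) ** A = mat 1}"
      then have A: "det A = 1" "entrywise_power (5 ^ (n * 2)) A = A" "?t (entrywise_power ?q A) ** A = mat 1"
        by (auto simp: SL_def)
      {
        assume "B \<in> {A \<in> SL. entrywise_power (5 ^ (n * 2)) A = A \<and> ?t (entrywise_power ?q A) ** A = mat 1}"
        then have B: "det B = 1" "entrywise_power (5 ^ (n * 2)) B = B" "?t (entrywise_power ?q B) ** B = mat 1"
          by (auto simp: SL_def)
        have "?t (entrywise_power ?q (A ** B)) ** (A ** B)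
            = ?t (entrywise_power ?q B) ** (?t (entrywise_power ?q A) ** A) ** B"
          by (simp only: entrywise_power_mult matrix_transpose_mul matrix_mul_assoc)
        then have "?t (entrywise_power ?q (A ** B)) ** (A ** B) = mat 1" by (simp add: A B)
        then show "A ** B \<in> {A \<in> SL. entrywise_power (5 ^ (n * 2)) A = A \<and> ?t (entrywise_power ?q A) ** A = mat 1}"
          using A B by (simp add: SL_def det_mul entrywise_power_mult)
      }
      assume B: "A ** B = mat 1" "B ** A = mat 1"
      have "?t (entrywise_power ?q A) ** (A ** B) = B" by (simp add: matrix_mul_assoc A)
      then have "B = ?t (entrywise_power ?q A)" by (simp add: B)
      then have "?t (entrywise_power ?q B) ** B = ?t (entrywise_power ?q (A ** B))"
        by (simp only: entrywise_power_mult matrix_transpose_mul)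
      then have "?t (entrywise_power ?q B) ** B = mat 1" by (simp add: B entrywise_power_one transpose_mat)
      moreover have "det B = 1" using A(1) B(1) det_mul[of A B] by simp
      ultimately show "B \<in> {A \<in> SL. entrywise_power (5 ^ (n * 2)) A = A \<and> ?t (entrywise_power ?q A) ** A = mat 1}"
        using entrywise_power_inverse[OF A(2) B] by (simp add: SL_def)
    qed auto
    have D: "entrywise_power q (diag3 \<xi>) = diag3 (\<xi> ^ q)" if "q > 0" for q \<xi>
      using that by (simp add: entrywise_power_def diag3_def vec_eq_iff power_divide zero_power)
    have C: "entrywise_power q cyclic3 = cyclic3" if "q > 0" for q
      using that by (simp add: entrywise_power_def cyclic3_def vec_eq_iff zero_power)
    show "diag3 \<zeta> \<in> carrier (SU3_fin (5 ^ n))"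
      using \<zeta>0 by (simp add: U D \<zeta>q \<zeta>qq[unfolded qq] diag3_cyclic3_SL)
        (simp add: diag3_def Finite_Cartesian_Product.transpose_def matrix_matrix_mult_def mat_def vec_eq_iff forall_3 sum_3)
    show "cyclic3 \<in> carrier (SU3_fin (5 ^ n))"
      by (simp add: U C diag3_cyclic3_SL)
        (simp add: cyclic3_def Finite_Cartesian_Product.transpose_def matrix_matrix_mult_def mat_def vec_eq_iff forall_3 sum_3)
    show "\<zeta> \<noteq> 0" "\<zeta>\<^sup>2 \<noteq> 1" by (fact \<zeta>0 \<zeta>(2))+
  qed (auto simp: SU3_fin_def GL_def)
qed

theorem theorem1p1:
  fixes t s\<^sub>1 s\<^sub>2 u :: "K ^ 7 ^ 7"
    and A\<^sub>1 A\<^sub>1' T' T'' :: "(K ^ 7 ^ 7) set"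
    and C D :: "(K ^ 7 ^ 7) set list"
  assumes t: "t \<in> carrier G2" "group.ord G2 t = 2"
    and s1: "s\<^sub>1 \<in> carrier G2" "group.ord G2 s\<^sub>1 = 4"
    and cent_s1: "SL2_generated_by long_root_subgroups A\<^sub>1" "one_dim_torus T'"
      "centralizer G2 s\<^sub>1 = A\<^sub>1 <#>\<^bsub>G2\<^esub> T'"
    and s2: "s\<^sub>2 \<in> carrier G2" "group.ord G2 s\<^sub>2 = 4"
    and cent_s2: "SL2_generated_by short_root_subgroups A\<^sub>1'" "one_dim_torus T''"
      "centralizer G2 s\<^sub>2 = A\<^sub>1' <#>\<^bsub>G2\<^esub> T''"
    and u: "u = root_element (0, 1) 1 \<otimes>\<^bsub>G2\<^esub> root_element (3, 1) 1"
    and C: "C = [conj_class G2 t, conj_class G2 s\<^sub>1, conj_class G2 u]"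
    and D: "D = [conj_class G2 t, conj_class G2 s\<^sub>2, conj_class G2 u]"
  shows "(rigid G2 C \<and> rigid G2 D) \<and>
    (\<forall>xs \<in> product_one_tuples G2 C \<union> product_one_tuples G2 D.
       G2\<lparr>carrier := generate G2 (set xs)\<rparr> \<cong> sym_group 5) \<and>
    (\<forall>n \<ge> 1. \<not> abc_group (G2_fin n) 2 4 5 \<and>
              \<not> abc_group (SL3_fin (5 ^ n)) 2 4 5 \<and>
              \<not> abc_group (SU3_fin (5 ^ n)) 2 4 5)"
proof -
  have u': "u = root_element (0, 1) 1 ** root_element (3, 1) 1" by (simp only: u G2_simps)
  have s: "x \<in> oct_aut" "\<And>v. x *v (x *v (x *v (x *v v))) = v" "x ** x \<noteq> mat 1"
    if "x \<in> carrier G2" "group.ord G2 x = 4" for x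
    using that matrix_group_ord(2)[OF group_G2 G2_simps that]
    by (simp_all add: carrier_G2 matrix_vector_mul_assoc matrix_mul_assoc)
  have "rigid G2 C" "rigid G2 D"
    unfolding C D u' using t s1 s2 by (auto intro: rigid_triples)
  moreover have "G2\<lparr>carrier := generate G2 (set xs)\<rparr> \<cong> sym_group 5"
    if "xs \<in> product_one_tuples G2 C \<union> product_one_tuples G2 D" for xs
    using that unfolding C D u' by (elim UnE rigid_triples(2)[OF t s1] rigid_triples(2)[OF t s2])
  ultimately show ?thesis
    using G2_fin_not_2_4_5 SL3_fin_not_2_4_5 SU3_fin_not_2_4_5 by blast
qed

end
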